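(* Let $\mathcal{C}$ be a cartesian Rosický tangent category with scalar $R$-multiplication, and let $X\in\mathcal{C}$. The action of vector fields $v\in\Gamma(X,TX)$ on functions $f\in\mathrm{Hom}(X,R)$ defined by $v\cdot f:=\eta_R\circ Tf\circ v$ is a representation of the Lie algebra of vector fields by derivations on the ring of $R$-valued functions. That is, for all $v,w\in\Gamma(X,TX)$ and $f,g\in\mathrm{Hom}(X,R)$: \begin{align*} v\cdot(f+g)&=v\cdot f+v\cdot g,\\ (v+w)\cdot f&=v\cdot f+w\cdot f,\\ [v,w]\cdot f&=v\cdot(w\cdot f)-w\cdot(v\cdot f),\\ v\cdot(fg)&=(v\cdot f)\,g+f\,(v\cdot g). \end{align*}
   Context: **Rosický tangent structure.** A Rosický tangent structure on a category $\mathcal{C}$ consists of a functor $T:\mathcal{C}\to\mathcal{C}$ and natural transformations $\pi:T\to 1$, $0:1\to T$, $+:T_2\to T$, $\lambda:T\to T^2$, $\tau:T^2\to T^2$ such that for all objects $X$: (i) for all $k\ge1$ the fiber product $T_kX=TX\times_X\cdots\times_XTX$ of $k$ copies of $\pi_X:TX\to X$ exists and is preserved by $T$, i.e. the natural morphism $\nu_{k,X}:T(T_kX)\to T^2X\times_{TX}^{T\pi_X,T\pi_X}\cdots\times_{TX}^{T\pi_X,T\pi_X}T^2X$ is an isomorphism; (ii) $\pi_X:TX\to X$ with addition $+_X$ and zero $0_X$ is an abelian group object in the slice category $\mathcal{C}_{/X}$; let $-_X:T_2X\to TX$ denote the fiberwise difference; (iii) $\tau_X\circ\tau_X=\mathrm{id}$,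 $\tau_{TX}\circ T\tau_X\circ\tau_{TX}=T\tau_X\circ\tau_{TX}\circ T\tau_X$, $\pi_{TX}\circ\tau_X=T\pi_X$, and $+_{TX}\circ(\tau_X\times_{TX}\tau_X)=\tau_X\circ T(+_X)\circ\nu_{2,X}^{-1}$ on $T^2X\times_{TX}^{T\pi_X,T\pi_X}T^2X$; (iv) $\pi_{TX}\circ\lambda_X=0_X\circ\pi_X$, $\lambda_{TX}\circ\lambda_X=T\lambda_X\circ\lambda_X$, and $+_{TX}\circ(\lambda_X\times_{0_X}\lambda_X)=\lambda_X\circ+_X$; (v) $\tau_X\circ\lambda_X=\lambda_X$ and $T\tau_X\circ\tau_{TX}\circ T\lambda_X=\lambda_{TX}\circ\tau_X$; (vi) the commutative square $(\pi_{TX},T\pi_X)\circ\lambda_X=(0_X,0_X)\circ\pi_X:TX\to T_2X$ is a pullback square. The extended vertical lift is $(\lambda_2)_X:=\tau_X\circ+_{TX}\circ(T0_X\times_{0_X}\lambda_X):T_2X\to T^2X$. It is known that the square with $(\lambda_2)_X$, $T\pi_X:T^2X\to TX$, $\pi_X\circ\mathrm{pr}_1:T_2X\to X$ and $0_X:X\to TX$ is a pullback. **Cartesian.** The tangent structure is cartesian if $\mathcal{C}$ has finite products and $\chi_{X,Y}:=(T\mathrm{pr}_1,T\mathrm{pr}_2):T(X\times Y)\to TX\times TY$ is invertible for all $X,Y$. For $f:X\times Y\to Z$ the partial tangent morphisms are $T_{(1)}f:=Tf\circ\chi_{X,Y}^{-1}\circ(\mathrm{id}_{TX}\times0_Y):TX\times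 Y\to TZ$ and $T_{(2)}f:=Tf\circ\chi_{X,Y}^{-1}\circ(0_X\times\mathrm{id}_{TY}):X\times TY\to TZ$. **Vector fields.** A vector field on $X$ is a section $v:X\to TX$ of $\pi_X$; $\Gamma(X,TX)$ denotes the set of them, with sum $v+w:=+_X\circ(v,w)$. The bracket $[v,w]$ is the unique vector field with $\delta(v,w)=(\lambda_2)_X\circ(w,[v,w])$, where $\delta(v,w):=-_{TX}\circ(Tw\circ v,\ \tau_X\circ Tv\circ w):X\to T^2X$. It is known that this is a Lie bracket. **Scalar multiplication.** Let $R$ be a commutative unital ring object in $\mathcal{C}$ with addition $\hat{+}$, zero $\hat{0}$, multiplication $\hat{m}$, unit $\hat{1}$. An $R$-module structure on the tangent bundle is a natural morphism $\kappa_X:R\times TX\to TX$ with $\pi_X\circ\kappa_X=\pi_X\circ\mathrm{pr}_2$, $\kappa_X\circ(\mathrm{id}_R\times\kappa_X)=\kappa_X\circ(\hat{m}\times\mathrm{id}_{TX})$, $\kappa_X\circ(\hat{1}\times\mathrm{id}_{TX})$ equal to the canonical isomorphism $*\times TX\cong TX$, $\kappa_X\circ(\hat{+}\times\mathrm{id}_{TX})=+_X\circ(\kappa_X\circ(\mathrm{pr}_1,\mathrm{pr}_3),\kappa_X\circ(\mathrm{pr}_2,\mathrm{pr}_3))$, and $\kappa_X\circ(\mathrm{id}_R\times+_X)=+_X\circ(\kappa_X\circ(\mathrm{pr}_1,\mathrm{pr}_2),\kappa_X\circ(\mathrm{pr}_1,\mathrm{pr}_3))$ on $R\times T_2X$.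 The tangent fiber $T_{\hat{0}}R:=*\times_R^{\hat{0},\pi_R}TR$ (if it exists) inherits an $R$-module structure from $+_R,0_R,\kappa_R$. $R$ is tangent-stable if $T_{\hat{0}}R$ exists and there is an isomorphism of $R$-modules $T_{\hat{0}}R\cong R$, which is then fixed. In that case $\eta_R:TR\to R$ is the projection onto the fiber: the morphism $T_{(2)}\hat{+}\circ(\hat{\iota}\circ\pi_R,\mathrm{id}_{TR}):TR\to TR$ (with $\hat{\iota}$ the additive inverse of $R$) factors uniquely through $T_{\hat{0}}R\to TR$, and $\eta_R$ is the resulting $TR\to T_{\hat{0}}R$ followed by $T_{\hat{0}}R\cong R$. The $R$-module structure $\kappa$ is a scalar $R$-multiplication if $R$ is tangent-stable and for all $X$: (S1) $\lambda_X\circ\kappa_X=\kappa_{TX}\circ(\mathrm{id}_R\times\lambda_X)$; (S2) $T_{(1)}\kappa_X=(\lambda_2)_X\circ(\kappa_X\circ(\mathrm{pr}_1,\mathrm{pr}_3),\kappa_X\circ(\mathrm{pr}_2,\mathrm{pr}_3))\circ((\pi_R,\eta_R)\times\mathrm{id}_{TX})$ on $TR\times TX$; (S3) $T_{(2)}\kappa_X=\tau_X\circ\kappa_{TX}\circ(\mathrm{id}_R\times\tau_X)$ on $R\times T^2X$. **Functions.** $\mathrm{Hom}(X,R)$ is a commutative ring with $f+g:=\hat{+}\circ(f,g)$ and $fg:=\hat{m}\circ(f,g)$. *)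

theory Defs
  imports Main
begin

section \<open>Categories, finite limits and group objects\<close>

record ('o, 'm) category =
  Obj :: "'o set"
  Arr :: "'m set"
  Dom :: "'m \<Rightarrow> 'o"
  Cod :: "'m \<Rightarrow> 'o"
  idt :: "'o \<Rightarrow> 'm"
  cmp :: "'m \<Rightarrow> 'm \<Rightarrow> 'm"  (infixr "\<cdot>\<index>" 70)

definition Hom :: "('o, 'm, 'x) category_scheme \<Rightarrow> 'o \<Rightarrow> 'o \<Rightarrow> 'm set" where
  "Hom C X Y = {f \<in> Arr C. Dom C f = X \<and> Cod C f = Y}"

locale category =
  fixes C :: "('o, 'm, 'x) category_scheme" (structure)
  assumes Dom_Obj: "f \<in> Arr C \<Longrightarrow> Dom C f \<in> Obj C"
    and Cod_Obj: "f \<in> Arr C \<Longrightarrow> Cod C f \<in> Obj C"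
    and idt_Hom: "X \<in> Obj C \<Longrightarrow> idt C X \<in> Hom C X X"
    and cmp_Hom: "f \<in> Hom C X Y \<Longrightarrow> g \<in> Hom C Y Z \<Longrightarrow> g \<cdot> f \<in> Hom C X Z"
    and idt_left: "f \<in> Hom C X Y \<Longrightarrow> idt C Y \<cdot> f = f"
    and idt_right: "f \<in> Hom C X Y \<Longrightarrow> f \<cdot> idt C X = f"
    and cmp_assoc: "f \<in> Hom C W X \<Longrightarrow> g \<in> Hom C X Y \<Longrightarrow> h \<in> Hom C Y Z \<Longrightarrow>
      (h \<cdot> g) \<cdot> f = h \<cdot> (g \<cdot> f)"

definition is_inverse :: "('o, 'm, 'x) category_scheme \<Rightarrow> 'm \<Rightarrow> 'm \<Rightarrow> bool" where
  "is_inverse C f g \<longleftrightarrow> f \<in> Arr C \<and> g \<in> Hom C (Cod C f) (Dom C f) \<and>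
     g \<cdot>\<^bsub>C\<^esub> f = idt C (Dom C f) \<and> f \<cdot>\<^bsub>C\<^esub> g = idt C (Cod C f)"

definition is_iso :: "('o, 'm, 'x) category_scheme \<Rightarrow> 'm \<Rightarrow> bool" where
  "is_iso C f \<longleftrightarrow> (\<exists>g. is_inverse C f g)"

definition inv_arr :: "('o, 'm, 'x) category_scheme \<Rightarrow> 'm \<Rightarrow> 'm" where
  "inv_arr C f = (THE g. is_inverse C f g)"

definition is_terminal :: "('o, 'm, 'x) category_scheme \<Rightarrow> 'o \<Rightarrow> bool" where
  "is_terminal C t \<longleftrightarrow> t \<in> Obj C \<and> (\<forall>Y\<in>Obj C. \<exists>!h. h \<in> Hom C Y t)"

definition to_terminal :: "('o, 'm, 'x) category_scheme \<Rightarrow> 'o \<Rightarrow> 'o \<Rightarrow> 'm" where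
  "to_terminal C t Y = (THE h. h \<in> Hom C Y t)"

definition is_product ::
  "('o, 'm, 'x) category_scheme \<Rightarrow> 'o \<Rightarrow> 'o \<Rightarrow> 'o \<Rightarrow> 'm \<Rightarrow> 'm \<Rightarrow> bool" where
  "is_product C A B P p q \<longleftrightarrow> p \<in> Hom C P A \<and> q \<in> Hom C P B \<and>
     (\<forall>Y. \<forall>a\<in>Hom C Y A. \<forall>b\<in>Hom C Y B.
        \<exists>!h. h \<in> Hom C Y P \<and> p \<cdot>\<^bsub>C\<^esub> h = a \<and> q \<cdot>\<^bsub>C\<^esub> h = b)"

definition is_pullback ::
  "('o, 'm, 'x) category_scheme \<Rightarrow> 'm \<Rightarrow> 'm \<Rightarrow> 'o \<Rightarrow> 'm \<Rightarrow> 'm \<Rightarrow> bool" where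
  "is_pullback C f g P p q \<longleftrightarrow>
     f \<in> Arr C \<and> g \<in> Arr C \<and> Cod C f = Cod C g \<and>
     p \<in> Hom C P (Dom C f) \<and> q \<in> Hom C P (Dom C g) \<and> f \<cdot>\<^bsub>C\<^esub> p = g \<cdot>\<^bsub>C\<^esub> q \<and>
     (\<forall>Y. \<forall>a\<in>Hom C Y (Dom C f). \<forall>b\<in>Hom C Y (Dom C g). f \<cdot>\<^bsub>C\<^esub> a = g \<cdot>\<^bsub>C\<^esub> b \<longrightarrow>
        (\<exists>!h. h \<in> Hom C Y P \<and> p \<cdot>\<^bsub>C\<^esub> h = a \<and> q \<cdot>\<^bsub>C\<^esub> h = b))"

text \<open>The morphism \<open>(a, b)\<close> into a product or fiber product \<open>P\<close> with projections \<open>p\<close>, \<open>q\<close>.\<close>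

definition pairing ::
  "('o, 'm, 'x) category_scheme \<Rightarrow> 'o \<Rightarrow> 'm \<Rightarrow> 'm \<Rightarrow> 'm \<Rightarrow> 'm \<Rightarrow> 'm" where
  "pairing C P p q a b =
     (THE h. h \<in> Hom C (Dom C a) P \<and> p \<cdot>\<^bsub>C\<^esub> h = a \<and> q \<cdot>\<^bsub>C\<^esub> h = b)"

text \<open>Fiber product of \<open>k\<close> copies of \<open>p\<close>, with projections \<open>pr 0, \<dots>, pr (k - 1)\<close>; meant for
  \<open>k \<ge> 1\<close>.\<close>

definition is_fiber_power ::
  "('o, 'm, 'x) category_scheme \<Rightarrow> nat \<Rightarrow> 'm \<Rightarrow> 'o \<Rightarrow> (nat \<Rightarrow> 'm) \<Rightarrow> bool" where
  "is_fiber_power C k p P pr \<longleftrightarrow>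
     p \<in> Arr C \<and> P \<in> Obj C \<and> (\<forall>i<k. pr i \<in> Hom C P (Dom C p)) \<and>
     (\<forall>i<k. \<forall>j<k. p \<cdot>\<^bsub>C\<^esub> pr i = p \<cdot>\<^bsub>C\<^esub> pr j) \<and>
     (\<forall>Y\<in>Obj C. \<forall>a. (\<forall>i<k. a i \<in> Hom C Y (Dom C p)) \<longrightarrow>
        (\<forall>i<k. \<forall>j<k. p \<cdot>\<^bsub>C\<^esub> a i = p \<cdot>\<^bsub>C\<^esub> a j) \<longrightarrow>
        (\<exists>!h. h \<in> Hom C Y P \<and> (\<forall>i<k. pr i \<cdot>\<^bsub>C\<^esub> h = a i)))"

definition tupling ::
  "('o, 'm, 'x) category_scheme \<Rightarrow> nat \<Rightarrow> 'o \<Rightarrow> (nat \<Rightarrow> 'm) \<Rightarrow> 'o \<Rightarrow> (nat \<Rightarrow> 'm) \<Rightarrow> 'm" where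
  "tupling C k P pr Y a = (THE h. h \<in> Hom C Y P \<and> (\<forall>i<k. pr i \<cdot>\<^bsub>C\<^esub> h = a i))"

definition is_functor ::
  "('o, 'm, 'x) category_scheme \<Rightarrow> ('o \<Rightarrow> 'o) \<Rightarrow> ('m \<Rightarrow> 'm) \<Rightarrow> bool" where
  "is_functor C F\<^sub>0 F\<^sub>1 \<longleftrightarrow>
     (\<forall>X\<in>Obj C. F\<^sub>0 X \<in> Obj C \<and> F\<^sub>1 (idt C X) = idt C (F\<^sub>0 X)) \<and>
     (\<forall>X Y. \<forall>f\<in>Hom C X Y. F\<^sub>1 f \<in> Hom C (F\<^sub>0 X) (F\<^sub>0 Y)) \<and>
     (\<forall>X Y Z. \<forall>f\<in>Hom C X Y. \<forall>g\<in>Hom C Y Z. F\<^sub>1 (g \<cdot>\<^bsub>C\<^esub> f) = F\<^sub>1 g \<cdot>\<^bsub>C\<^esub> F\<^sub>1 f)"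

definition is_natural ::
  "('o, 'm, 'x) category_scheme \<Rightarrow> ('o \<Rightarrow> 'o) \<Rightarrow> ('m \<Rightarrow> 'm) \<Rightarrow> ('o \<Rightarrow> 'o) \<Rightarrow> ('m \<Rightarrow> 'm) \<Rightarrow>
    ('o \<Rightarrow> 'm) \<Rightarrow> bool" where
  "is_natural C F\<^sub>0 F\<^sub>1 G\<^sub>0 G\<^sub>1 \<eta> \<longleftrightarrow>
     (\<forall>X\<in>Obj C. \<eta> X \<in> Hom C (F\<^sub>0 X) (G\<^sub>0 X)) \<and>
     (\<forall>X Y. \<forall>f\<in>Hom C X Y. G\<^sub>1 f \<cdot>\<^bsub>C\<^esub> \<eta> X = \<eta> Y \<cdot>\<^bsub>C\<^esub> F\<^sub>1 f)"

text \<open>A morphism of the slice category is a triple \<open>(p, f, q)\<close> with \<open>q \<circ> f = p\<close>: the underlying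
  morphism \<open>f\<close> together with its source and target.\<close>

definition slice ::
  "('o, 'm, 'x) category_scheme \<Rightarrow> 'o \<Rightarrow> ('m, 'm \<times> 'm \<times> 'm) category" where
  "slice C B = \<lparr>
     Obj = {p \<in> Arr C. Cod C p = B},
     Arr = {(p, f, q). p \<in> Arr C \<and> q \<in> Arr C \<and> Cod C p = B \<and> Cod C q = B \<and>
              f \<in> Hom C (Dom C p) (Dom C q) \<and> q \<cdot>\<^bsub>C\<^esub> f = p},
     Dom = (\<lambda>(p, f, q). p),
     Cod = (\<lambda>(p, f, q). q),
     idt = (\<lambda>p. (p, idt C (Dom C p), p)),
     cmp = (\<lambda>(q, g, r) (p, f, q'). (p, g \<cdot>\<^bsub>C\<^esub> f, r)) \<rparr>"

text \<open>The data of a group object: terminal object, square \<open>G \<times> G\<close> with its two projections,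
  the object \<open>G\<close> itself, addition and zero.\<close>

record ('o, 'm) group_data =
  gpt :: 'o
  gsq :: 'o
  gpr1 :: 'm
  gpr2 :: 'm
  gob :: 'o
  gadd :: 'm
  gzero :: 'm

definition gplus :: "('o, 'm, 'x) category_scheme \<Rightarrow> ('o, 'm) group_data \<Rightarrow> 'm \<Rightarrow> 'm \<Rightarrow> 'm" where
  "gplus C G a b = gadd G \<cdot>\<^bsub>C\<^esub> pairing C (gsq G) (gpr1 G) (gpr2 G) a b"

definition is_group_inverse ::
  "('o, 'm, 'x) category_scheme \<Rightarrow> ('o, 'm) group_data \<Rightarrow> 'm \<Rightarrow> bool" where
  "is_group_inverse C G n \<longleftrightarrow> n \<in> Hom C (gob G) (gob G) \<and>
     gplus C G (idt C (gob G)) n = gzero G \<cdot>\<^bsub>C\<^esub> to_terminal C (gpt G) (gob G)"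

text \<open>Associativity lives on \<open>W = (G \<times> G) \<times> G\<close>, with projections \<open>q\<^sub>1\<close>, \<open>q\<^sub>2\<close>.\<close>

definition abelian_group_object ::
  "('o, 'm, 'x) category_scheme \<Rightarrow> ('o, 'm) group_data \<Rightarrow> bool" where
  "abelian_group_object C G \<longleftrightarrow>
     is_terminal C (gpt G) \<and> is_product C (gob G) (gob G) (gsq G) (gpr1 G) (gpr2 G) \<and>
     gadd G \<in> Hom C (gsq G) (gob G) \<and> gzero G \<in> Hom C (gpt G) (gob G) \<and>
     (\<exists>W q\<^sub>1 q\<^sub>2. is_product C (gsq G) (gob G) W q\<^sub>1 q\<^sub>2 \<and>
        gplus C G (gadd G \<cdot>\<^bsub>C\<^esub> q\<^sub>1) q\<^sub>2 =
        gplus C G (gpr1 G \<cdot>\<^bsub>C\<^esub> q\<^sub>1) (gplus C G (gpr2 G \<cdot>\<^bsub>C\<^esub> q\<^sub>1) q\<^sub>2)) \<and>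
     gplus C G (gpr2 G) (gpr1 G) = gadd G \<and>
     gplus C G (idt C (gob G)) (gzero G \<cdot>\<^bsub>C\<^esub> to_terminal C (gpt G) (gob G)) = idt C (gob G) \<and>
     (\<exists>n. is_group_inverse C G n)"

definition group_inverse ::
  "('o, 'm, 'x) category_scheme \<Rightarrow> ('o, 'm) group_data \<Rightarrow> 'm" where
  "group_inverse C G = (THE n. is_group_inverse C G n)"

definition group_difference ::
  "('o, 'm, 'x) category_scheme \<Rightarrow> ('o, 'm) group_data \<Rightarrow> 'm" where
  "group_difference C G = gplus C G (gpr1 G) (group_inverse C G \<cdot>\<^bsub>C\<^esub> gpr2 G)"

section \<open>Tangent structures\<close>

text \<open>Only the fiber product \<open>T\<^sub>2 X\<close>, on which \<open>+\<close> is defined, is chosen as data; the other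
  fiber products are merely required to exist.\<close>

record ('o, 'm) tangent_category = "('o, 'm) category" +
  Tob :: "'o \<Rightarrow> 'o"
  Tar :: "'m \<Rightarrow> 'm"
  T2 :: "'o \<Rightarrow> 'o"
  T2pr1 :: "'o \<Rightarrow> 'm"
  T2pr2 :: "'o \<Rightarrow> 'm"
  tproj :: "'o \<Rightarrow> 'm"
  tzero :: "'o \<Rightarrow> 'm"
  tplus :: "'o \<Rightarrow> 'm"
  tlift :: "'o \<Rightarrow> 'm"
  tflip :: "'o \<Rightarrow> 'm"

definition T2pair :: "('o, 'm, 'x) tangent_category_scheme \<Rightarrow> 'o \<Rightarrow> 'm \<Rightarrow> 'm \<Rightarrow> 'm" where
  "T2pair C X = pairing C (T2 C X) (T2pr1 C X) (T2pr2 C X)"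

definition T2ar :: "('o, 'm, 'x) tangent_category_scheme \<Rightarrow> 'm \<Rightarrow> 'm" where
  "T2ar C f = T2pair C (Cod C f) (Tar C f \<cdot>\<^bsub>C\<^esub> T2pr1 C (Dom C f)) (Tar C f \<cdot>\<^bsub>C\<^esub> T2pr2 C (Dom C f))"

definition tangent_group ::
  "('o, 'm, 'x) tangent_category_scheme \<Rightarrow> 'o \<Rightarrow> ('m, 'm \<times> 'm \<times> 'm) group_data" where
  "tangent_group C X =
     (let s = tproj C X \<cdot>\<^bsub>C\<^esub> T2pr1 C X in \<lparr>
       gpt = idt C X,
       gsq = s,
       gpr1 = (s, T2pr1 C X, tproj C X),
       gpr2 = (s, T2pr2 C X, tproj C X),
       gob = tproj C X,
       gadd = (s, tplus C X, tproj C X),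
       gzero = (idt C X, tzero C X, tproj C X) \<rparr>)"

text \<open>The fiberwise difference \<open>T\<^sub>2 X \<rightarrow> T X\<close>, as a morphism of \<open>C\<close>.\<close>

definition tminus :: "('o, 'm, 'x) tangent_category_scheme \<Rightarrow> 'o \<Rightarrow> 'm" where
  "tminus C X = fst (snd (group_difference (slice C X) (tangent_group C X)))"

locale tangent_category = category C
  for C :: "('o, 'm, 'x) tangent_category_scheme" (structure) +
  assumes T_functor: "is_functor C (Tob C) (Tar C)"
    and tproj_natural: "is_natural C (Tob C) (Tar C) (\<lambda>X. X) (\<lambda>f. f) (tproj C)"
    and tzero_natural: "is_natural C (\<lambda>X. X) (\<lambda>f. f) (Tob C) (Tar C) (tzero C)"
    and tplus_natural: "is_natural C (T2 C) (T2ar C) (Tob C) (Tar C) (tplus C)"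
    and tlift_natural: "is_natural C (Tob C) (Tar C)
      (\<lambda>X. Tob C (Tob C X)) (\<lambda>f. Tar C (Tar C f)) (tlift C)"
    and tflip_natural: "is_natural C (\<lambda>X. Tob C (Tob C X)) (\<lambda>f. Tar C (Tar C f))
      (\<lambda>X. Tob C (Tob C X)) (\<lambda>f. Tar C (Tar C f)) (tflip C)"
    and T2_pullback: "X \<in> Obj C \<Longrightarrow>
      is_pullback C (tproj C X) (tproj C X) (T2 C X) (T2pr1 C X) (T2pr2 C X)"
    and fiber_powers: "X \<in> Obj C \<Longrightarrow> k \<ge> 1 \<Longrightarrow>
      \<exists>P p Q q. is_fiber_power C k (tproj C X) P p \<and>
        is_fiber_power C k (Tar C (tproj C X)) Q q \<and>
        is_iso C (tupling C k Q q (Tob C P) (\<lambda>i. Tar C (p i)))"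
    and tangent_group: "X \<in> Obj C \<Longrightarrow> abelian_group_object (slice C X) (tangent_group C X)"
    and flip_flip: "X \<in> Obj C \<Longrightarrow> tflip C X \<cdot> tflip C X = idt C (Tob C (Tob C X))"
    and flip_braid: "X \<in> Obj C \<Longrightarrow>
      tflip C (Tob C X) \<cdot> Tar C (tflip C X) \<cdot> tflip C (Tob C X) =
      Tar C (tflip C X) \<cdot> tflip C (Tob C X) \<cdot> Tar C (tflip C X)"
    and proj_flip: "X \<in> Obj C \<Longrightarrow> tproj C (Tob C X) \<cdot> tflip C X = Tar C (tproj C X)"
    and flip_plus: "X \<in> Obj C \<Longrightarrow>
      is_pullback C (Tar C (tproj C X)) (Tar C (tproj C X)) Q q\<^sub>1 q\<^sub>2 \<Longrightarrow>
      \<nu> = pairing C Q q\<^sub>1 q\<^sub>2 (Tar C (T2pr1 C X)) (Tar C (T2pr2 C X)) \<Longrightarrow>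
      tplus C (Tob C X) \<cdot> T2pair C (Tob C X) (tflip C X \<cdot> q\<^sub>1) (tflip C X \<cdot> q\<^sub>2) =
      tflip C X \<cdot> Tar C (tplus C X) \<cdot> inv_arr C \<nu>"
    and proj_lift: "X \<in> Obj C \<Longrightarrow> tproj C (Tob C X) \<cdot> tlift C X = tzero C X \<cdot> tproj C X"
    and lift_lift: "X \<in> Obj C \<Longrightarrow>
      tlift C (Tob C X) \<cdot> tlift C X = Tar C (tlift C X) \<cdot> tlift C X"
    and lift_plus: "X \<in> Obj C \<Longrightarrow>
      tplus C (Tob C X) \<cdot> T2pair C (Tob C X) (tlift C X \<cdot> T2pr1 C X) (tlift C X \<cdot> T2pr2 C X) =
      tlift C X \<cdot> tplus C X"
    and flip_lift: "X \<in> Obj C \<Longrightarrow> tflip C X \<cdot> tlift C X = tlift C X"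
    and flip_flip_lift: "X \<in> Obj C \<Longrightarrow>
      Tar C (tflip C X) \<cdot> tflip C (Tob C X) \<cdot> Tar C (tlift C X) =
      tlift C (Tob C X) \<cdot> tflip C X"
    and lift_pullback: "X \<in> Obj C \<Longrightarrow>
      is_pullback C (T2pair C X (tproj C (Tob C X)) (Tar C (tproj C X)))
        (T2pair C X (tzero C X) (tzero C X)) (Tob C X) (tlift C X) (tproj C X)"

definition tlift2 :: "('o, 'm, 'x) tangent_category_scheme \<Rightarrow> 'o \<Rightarrow> 'm" where
  "tlift2 C X = tflip C X \<cdot>\<^bsub>C\<^esub> tplus C (Tob C X) \<cdot>\<^bsub>C\<^esub>
     T2pair C (Tob C X) (Tar C (tzero C X) \<cdot>\<^bsub>C\<^esub> T2pr1 C X) (tlift C X \<cdot>\<^bsub>C\<^esub> T2pr2 C X)"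

definition vector_fields :: "('o, 'm, 'x) tangent_category_scheme \<Rightarrow> 'o \<Rightarrow> 'm set" where
  "vector_fields C X = {v \<in> Hom C X (Tob C X). tproj C X \<cdot>\<^bsub>C\<^esub> v = idt C X}"

definition vf_add :: "('o, 'm, 'x) tangent_category_scheme \<Rightarrow> 'o \<Rightarrow> 'm \<Rightarrow> 'm \<Rightarrow> 'm" where
  "vf_add C X v w = tplus C X \<cdot>\<^bsub>C\<^esub> T2pair C X v w"

definition vf_delta :: "('o, 'm, 'x) tangent_category_scheme \<Rightarrow> 'o \<Rightarrow> 'm \<Rightarrow> 'm \<Rightarrow> 'm" where
  "vf_delta C X v w = tminus C (Tob C X) \<cdot>\<^bsub>C\<^esub>
     T2pair C (Tob C X) (Tar C w \<cdot>\<^bsub>C\<^esub> v) (tflip C X \<cdot>\<^bsub>C\<^esub> Tar C v \<cdot>\<^bsub>C\<^esub> w)"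

definition vf_bracket :: "('o, 'm, 'x) tangent_category_scheme \<Rightarrow> 'o \<Rightarrow> 'm \<Rightarrow> 'm \<Rightarrow> 'm" where
  "vf_bracket C X v w =
     (THE u. u \<in> vector_fields C X \<and> vf_delta C X v w = tlift2 C X \<cdot>\<^bsub>C\<^esub> T2pair C X w u)"

section \<open>Cartesian tangent structures\<close>

record ('o, 'm) cartesian_tangent_category = "('o, 'm) tangent_category" +
  pt :: 'o
  Prd :: "'o \<Rightarrow> 'o \<Rightarrow> 'o"
  pr1 :: "'o \<Rightarrow> 'o \<Rightarrow> 'm"
  pr2 :: "'o \<Rightarrow> 'o \<Rightarrow> 'm"

definition cpair ::
  "('o, 'm, 'x) cartesian_tangent_category_scheme \<Rightarrow> 'm \<Rightarrow> 'm \<Rightarrow> 'm"  ("\<langle>_,/ _\<rangle>\<index>") where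
  "\<langle>a, b\<rangle>\<^bsub>C\<^esub> = pairing C (Prd C (Cod C a) (Cod C b))
     (pr1 C (Cod C a) (Cod C b)) (pr2 C (Cod C a) (Cod C b)) a b"

definition cprod ::
  "('o, 'm, 'x) cartesian_tangent_category_scheme \<Rightarrow> 'm \<Rightarrow> 'm \<Rightarrow> 'm"  (infixr "\<boxtimes>\<index>" 75) where
  "f \<boxtimes>\<^bsub>C\<^esub> g = \<langle>f \<cdot>\<^bsub>C\<^esub> pr1 C (Dom C f) (Dom C g), g \<cdot>\<^bsub>C\<^esub> pr2 C (Dom C f) (Dom C g)\<rangle>\<^bsub>C\<^esub>"

definition chi :: "('o, 'm, 'x) cartesian_tangent_category_scheme \<Rightarrow> 'o \<Rightarrow> 'o \<Rightarrow> 'm" where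
  "chi C X Y = \<langle>Tar C (pr1 C X Y), Tar C (pr2 C X Y)\<rangle>\<^bsub>C\<^esub>"

locale cartesian_tangent_category = tangent_category C
  for C :: "('o, 'm, 'x) cartesian_tangent_category_scheme" (structure) +
  assumes pt_terminal: "is_terminal C (pt C)"
    and Prd_product: "X \<in> Obj C \<Longrightarrow> Y \<in> Obj C \<Longrightarrow>
      is_product C X Y (Prd C X Y) (pr1 C X Y) (pr2 C X Y)"
    and chi_iso: "X \<in> Obj C \<Longrightarrow> Y \<in> Obj C \<Longrightarrow> is_iso C (chi C X Y)"

text \<open>Partial tangent morphisms of \<open>f : X \<times> Y \<rightarrow> Z\<close>.\<close>

definition Tpart1 ::
  "('o, 'm, 'x) cartesian_tangent_category_scheme \<Rightarrow> 'o \<Rightarrow> 'o \<Rightarrow> 'm \<Rightarrow> 'm" where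
  "Tpart1 C X Y f = Tar C f \<cdot>\<^bsub>C\<^esub> inv_arr C (chi C X Y) \<cdot>\<^bsub>C\<^esub> (idt C (Tob C X) \<boxtimes>\<^bsub>C\<^esub> tzero C Y)"

definition Tpart2 ::
  "('o, 'm, 'x) cartesian_tangent_category_scheme \<Rightarrow> 'o \<Rightarrow> 'o \<Rightarrow> 'm \<Rightarrow> 'm" where
  "Tpart2 C X Y f = Tar C f \<cdot>\<^bsub>C\<^esub> inv_arr C (chi C X Y) \<cdot>\<^bsub>C\<^esub> (tzero C X \<boxtimes>\<^bsub>C\<^esub> idt C (Tob C Y))"

section \<open>Scalar multiplication\<close>

text \<open>\<open>rng\<close> is the underlying object of the ring object. The last three fields are the tangent
  fiber at zero, its inclusion into the tangent bundle of the ring, and the fixed isomorphism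
  from the fiber to the ring.\<close>

record ('o, 'm) scalar_tangent_category = "('o, 'm) cartesian_tangent_category" +
  rng :: 'o
  radd :: 'm
  rzero :: 'm
  rmult :: 'm
  rone :: 'm
  scal :: "'o \<Rightarrow> 'm"
  fib :: 'o
  fib_incl :: 'm
  fib_iso :: 'm

definition ring_group ::
  "('o, 'm, 'x) scalar_tangent_category_scheme \<Rightarrow> ('o, 'm) group_data" where
  "ring_group C = \<lparr>
     gpt = pt C,
     gsq = Prd C (rng C) (rng C),
     gpr1 = pr1 C (rng C) (rng C),
     gpr2 = pr2 C (rng C) (rng C),
     gob = rng C,
     gadd = radd C,
     gzero = rzero C \<rparr>"

definition rneg :: "('o, 'm, 'x) scalar_tangent_category_scheme \<Rightarrow> 'm" where
  "rneg C = group_inverse C (ring_group C)"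

definition comm_ring_object :: "('o, 'm, 'x) scalar_tangent_category_scheme \<Rightarrow> bool" where
  "comm_ring_object C \<longleftrightarrow>
     (let R = rng C; R2 = Prd C R R;
        x = pr1 C R R \<cdot>\<^bsub>C\<^esub> pr1 C R2 R; y = pr2 C R R \<cdot>\<^bsub>C\<^esub> pr1 C R2 R; z = pr2 C R2 R in
      abelian_group_object C (ring_group C) \<and>
      rmult C \<in> Hom C R2 R \<and> rone C \<in> Hom C (pt C) R \<and>
      rmult C \<cdot>\<^bsub>C\<^esub> \<langle>rmult C \<cdot>\<^bsub>C\<^esub> \<langle>x, y\<rangle>\<^bsub>C\<^esub>, z\<rangle>\<^bsub>C\<^esub> = rmult C \<cdot>\<^bsub>C\<^esub> \<langle>x, rmult C \<cdot>\<^bsub>C\<^esub> \<langle>y, z\<rangle>\<^bsub>C\<^esub>\<rangle>\<^bsub>C\<^esub> \<and>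
      rmult C \<cdot>\<^bsub>C\<^esub> \<langle>pr2 C R R, pr1 C R R\<rangle>\<^bsub>C\<^esub> = rmult C \<and>
      rmult C \<cdot>\<^bsub>C\<^esub> \<langle>idt C R, rone C \<cdot>\<^bsub>C\<^esub> to_terminal C (pt C) R\<rangle>\<^bsub>C\<^esub> = idt C R \<and>
      rmult C \<cdot>\<^bsub>C\<^esub> \<langle>x, radd C \<cdot>\<^bsub>C\<^esub> \<langle>y, z\<rangle>\<^bsub>C\<^esub>\<rangle>\<^bsub>C\<^esub> =
        radd C \<cdot>\<^bsub>C\<^esub> \<langle>rmult C \<cdot>\<^bsub>C\<^esub> \<langle>x, y\<rangle>\<^bsub>C\<^esub>, rmult C \<cdot>\<^bsub>C\<^esub> \<langle>x, z\<rangle>\<^bsub>C\<^esub>\<rangle>\<^bsub>C\<^esub>)"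

text \<open>Associativity is stated on \<open>R \<times> (R \<times> T X)\<close>; distributivity over the addition of \<open>R\<close>
  on \<open>(R \<times> R) \<times> T X\<close>.\<close>

definition module_structure :: "('o, 'm, 'x) scalar_tangent_category_scheme \<Rightarrow> bool" where
  "module_structure C \<longleftrightarrow>
     (let R = rng C; R2 = Prd C R R; \<kappa> = scal C in
      is_natural C (\<lambda>X. Prd C R (Tob C X)) (\<lambda>f. idt C R \<boxtimes>\<^bsub>C\<^esub> Tar C f) (Tob C) (Tar C) \<kappa> \<and>
      (\<forall>X\<in>Obj C. let TX = Tob C X in
        tproj C X \<cdot>\<^bsub>C\<^esub> \<kappa> X = tproj C X \<cdot>\<^bsub>C\<^esub> pr2 C R TX \<and>
        (let r = pr1 C R (Prd C R TX);
           s = pr1 C R TX \<cdot>\<^bsub>C\<^esub> pr2 C R (Prd C R TX);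
           u = pr2 C R TX \<cdot>\<^bsub>C\<^esub> pr2 C R (Prd C R TX) in
         \<kappa> X \<cdot>\<^bsub>C\<^esub> (idt C R \<boxtimes>\<^bsub>C\<^esub> \<kappa> X) = \<kappa> X \<cdot>\<^bsub>C\<^esub> (rmult C \<boxtimes>\<^bsub>C\<^esub> idt C TX) \<cdot>\<^bsub>C\<^esub> \<langle>\<langle>r, s\<rangle>\<^bsub>C\<^esub>, u\<rangle>\<^bsub>C\<^esub>) \<and>
        \<kappa> X \<cdot>\<^bsub>C\<^esub> (rone C \<boxtimes>\<^bsub>C\<^esub> idt C TX) = pr2 C (pt C) TX \<and>
        (let r = pr1 C R R \<cdot>\<^bsub>C\<^esub> pr1 C R2 TX;
           s = pr2 C R R \<cdot>\<^bsub>C\<^esub> pr1 C R2 TX;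
           u = pr2 C R2 TX in
         \<kappa> X \<cdot>\<^bsub>C\<^esub> (radd C \<boxtimes>\<^bsub>C\<^esub> idt C TX) =
           tplus C X \<cdot>\<^bsub>C\<^esub> T2pair C X (\<kappa> X \<cdot>\<^bsub>C\<^esub> \<langle>r, u\<rangle>\<^bsub>C\<^esub>) (\<kappa> X \<cdot>\<^bsub>C\<^esub> \<langle>s, u\<rangle>\<^bsub>C\<^esub>)) \<and>
        (let r = pr1 C R (T2 C X);
           u = T2pr1 C X \<cdot>\<^bsub>C\<^esub> pr2 C R (T2 C X);
           u' = T2pr2 C X \<cdot>\<^bsub>C\<^esub> pr2 C R (T2 C X) in
         \<kappa> X \<cdot>\<^bsub>C\<^esub> (idt C R \<boxtimes>\<^bsub>C\<^esub> tplus C X) =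
           tplus C X \<cdot>\<^bsub>C\<^esub> T2pair C X (\<kappa> X \<cdot>\<^bsub>C\<^esub> \<langle>r, u\<rangle>\<^bsub>C\<^esub>) (\<kappa> X \<cdot>\<^bsub>C\<^esub> \<langle>r, u'\<rangle>\<^bsub>C\<^esub>))))"

text \<open>The factorization through the tangent fiber of a morphism \<open>a\<close> into the tangent bundle of
  the ring.\<close>

definition to_fib :: "('o, 'm, 'x) scalar_tangent_category_scheme \<Rightarrow> 'm \<Rightarrow> 'm" where
  "to_fib C a = pairing C (fib C) (to_terminal C (pt C) (fib C)) (fib_incl C)
     (to_terminal C (pt C) (Dom C a)) a"

definition fib_add :: "('o, 'm, 'x) scalar_tangent_category_scheme \<Rightarrow> 'm" where
  "fib_add C = to_fib C (tplus C (rng C) \<cdot>\<^bsub>C\<^esub> T2pair C (rng C)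
     (fib_incl C \<cdot>\<^bsub>C\<^esub> pr1 C (fib C) (fib C)) (fib_incl C \<cdot>\<^bsub>C\<^esub> pr2 C (fib C) (fib C)))"

definition fib_scal :: "('o, 'm, 'x) scalar_tangent_category_scheme \<Rightarrow> 'm" where
  "fib_scal C = to_fib C (scal C (rng C) \<cdot>\<^bsub>C\<^esub> (idt C (rng C) \<boxtimes>\<^bsub>C\<^esub> fib_incl C))"

definition tangent_stable :: "('o, 'm, 'x) scalar_tangent_category_scheme \<Rightarrow> bool" where
  "tangent_stable C \<longleftrightarrow>
     is_pullback C (rzero C) (tproj C (rng C)) (fib C) (to_terminal C (pt C) (fib C)) (fib_incl C) \<and>
     fib_iso C \<in> Hom C (fib C) (rng C) \<and> is_iso C (fib_iso C) \<and>
     fib_iso C \<cdot>\<^bsub>C\<^esub> fib_add C = radd C \<cdot>\<^bsub>C\<^esub> (fib_iso C \<boxtimes>\<^bsub>C\<^esub> fib_iso C) \<and>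
     fib_iso C \<cdot>\<^bsub>C\<^esub> fib_scal C = rmult C \<cdot>\<^bsub>C\<^esub> (idt C (rng C) \<boxtimes>\<^bsub>C\<^esub> fib_iso C)"

definition eta :: "('o, 'm, 'x) scalar_tangent_category_scheme \<Rightarrow> 'm" where
  "eta C = fib_iso C \<cdot>\<^bsub>C\<^esub> to_fib C (Tpart2 C (rng C) (rng C) (radd C) \<cdot>\<^bsub>C\<^esub>
     \<langle>rneg C \<cdot>\<^bsub>C\<^esub> tproj C (rng C), idt C (Tob C (rng C))\<rangle>\<^bsub>C\<^esub>)"

text \<open>In the second scalar axiom, \<open>r\<close>, \<open>s\<close>, \<open>u\<close> are the projections of \<open>(R \<times> R) \<times> T X\<close>.\<close>

locale scalar_tangent_category = cartesian_tangent_category C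
  for C :: "('o, 'm, 'x) scalar_tangent_category_scheme" (structure) +
  assumes ring_object: "comm_ring_object C"
    and module_structure: "module_structure C"
    and tangent_stable: "tangent_stable C"
    and lift_scal: "X \<in> Obj C \<Longrightarrow>
      tlift C X \<cdot> scal C X = scal C (Tob C X) \<cdot> (idt C (rng C) \<boxtimes> tlift C X)"
    and Tpart1_scal: "X \<in> Obj C \<Longrightarrow>
      Tpart1 C (rng C) (Tob C X) (scal C X) =
      (let R = rng C; R2 = Prd C R R; TX = Tob C X;
         r = pr1 C R R \<cdot> pr1 C R2 TX; s = pr2 C R R \<cdot> pr1 C R2 TX; u = pr2 C R2 TX in
       tlift2 C X \<cdot> T2pair C X (scal C X \<cdot> \<langle>r, u\<rangle>) (scal C X \<cdot> \<langle>s, u\<rangle>) \<cdot>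
         (\<langle>tproj C R, eta C\<rangle> \<boxtimes> idt C TX))"
    and Tpart2_scal: "X \<in> Obj C \<Longrightarrow>
      Tpart2 C (rng C) (Tob C X) (scal C X) =
      tflip C X \<cdot> scal C (Tob C X) \<cdot> (idt C (rng C) \<boxtimes> tflip C X)"

section \<open>Functions and the action of vector fields\<close>

definition fn_add :: "('o, 'm, 'x) scalar_tangent_category_scheme \<Rightarrow> 'm \<Rightarrow> 'm \<Rightarrow> 'm" where
  "fn_add C f g = radd C \<cdot>\<^bsub>C\<^esub> \<langle>f, g\<rangle>\<^bsub>C\<^esub>"

definition fn_minus :: "('o, 'm, 'x) scalar_tangent_category_scheme \<Rightarrow> 'm \<Rightarrow> 'm \<Rightarrow> 'm" where
  "fn_minus C f g = fn_add C f (rneg C \<cdot>\<^bsub>C\<^esub> g)"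

definition fn_mult :: "('o, 'm, 'x) scalar_tangent_category_scheme \<Rightarrow> 'm \<Rightarrow> 'm \<Rightarrow> 'm" where
  "fn_mult C f g = rmult C \<cdot>\<^bsub>C\<^esub> \<langle>f, g\<rangle>\<^bsub>C\<^esub>"

definition vf_act :: "('o, 'm, 'x) scalar_tangent_category_scheme \<Rightarrow> 'm \<Rightarrow> 'm \<Rightarrow> 'm" where
  "vf_act C v f = eta C \<cdot>\<^bsub>C\<^esub> Tar C f \<cdot>\<^bsub>C\<^esub> v"

end

theory Submission
  imports Defs
begin

text \<open>Write \<open>\<iota> : R \<rightarrow> T R\<close> for the inclusion of the tangent fiber at zero. By Eckmann--Hilton the
  addition of \<open>T R\<close> as a group object agrees with the fiberwise one on the image of \<open>\<iota>\<close>, so \<open>\<eta>\<close> is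
  additive for both and every tangent vector \<open>a\<close> of \<open>R\<close> is the translate of \<open>\<iota> (\<eta> a)\<close> to its base
  point. Axiom (S2) at the unit gives \<open>\<lambda> \<iota> = T\<iota> \<iota>\<close>; hence \<open>T\<eta> \<tau> T\<iota> = \<iota> \<eta>\<close>, which turns (S3) into
  the \<open>R\<close>-linearity of \<open>\<eta>\<close> along the second argument of the multiplication (the Leibniz rule).
  The same decomposition shows \<open>\<eta> T\<eta> \<lambda> = \<eta>\<close> and \<open>\<eta> T\<eta> \<tau> = \<eta> T\<eta>\<close>. Applying \<open>\<eta> T\<eta> T\<^sup>2f\<close> to
  \<open>\<tau> \<delta>(v, w) = T0 w + \<lambda> [v, w]\<close> then yields the bracket formula.\<close>

section \<open>Categories and abelian group objects\<close>

text \<open>The bracket, the fiberwise difference and \<open>\<eta>\<close> are given by unique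
  descriptions, and the fiber powers merely exist, so each first has to be turned into a rule about
  elements. Arrows \<open>Y -> T X\<close> are treated throughout as generalised tangent vectors,
  with \<open>\<pi> X\<close> reading off the base point.

  Why the decomposition is decisive: \<open>T R\<close> carries two additions, the fiberwise one and
  \<open>T\<close> of the ring addition, linked by an interchange law because tangent maps are
  fiberwise additive. A map that is additive for the second is known once it is known on zero
  vectors and on the vectors \<open>\<iota> s\<close>. Zero vectors are under control because an
  idempotent element of a group is zero, even where the axioms list no rule for zeros. On
  \<open>\<iota> s\<close> everything rests on \<open>T\<iota> \<iota>\<close> being a vertical
  lift, which the flip fixes.

  The bracket formula then expresses that \<open>\<eta> T\<eta> T\<^sup>2f\<close> is a symmetric
  second derivative: it does not see the flip, so only \<delta>, the failure of \<open>Tw v\<close>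
  and \<open>Tv w\<close> to agree up to the flip, survives in the commutator.\<close>

context category
begin

lemma cmp_Arr [simp]:
  assumes "f \<in> Arr C" "g \<in> Arr C" "Cod C f = Dom C g"
  shows "g \<cdot> f \<in> Arr C" "Dom C (g \<cdot> f) = Dom C f" "Cod C (g \<cdot> f) = Cod C g"
  using cmp_Hom[of f "Dom C f" "Dom C g" g "Cod C g"] assms by (simp_all add: Hom_def)

lemma idt_Arr [simp]:
  assumes "X \<in> Obj C"
  shows "idt C X \<in> Arr C" "Dom C (idt C X) = X" "Cod C (idt C X) = X"
  using idt_Hom[OF assms] by (auto simp: Hom_def)

lemma Dom_Cod_Obj [simp]: "f \<in> Arr C \<Longrightarrow> Dom C f \<in> Obj C" "f \<in> Arr C \<Longrightarrow> Cod C f \<in> Obj C"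
  by (auto intro: Dom_Obj Cod_Obj)

lemma idt_cmp [simp]:
  "f \<in> Arr C \<Longrightarrow> Cod C f = Y \<Longrightarrow> idt C Y \<cdot> f = f"
  "f \<in> Arr C \<Longrightarrow> Dom C f = X \<Longrightarrow> f \<cdot> idt C X = f"
  using idt_left idt_right by (auto simp: Hom_def)

lemma assoc [simp]:
  "f \<in> Arr C \<Longrightarrow> g \<in> Arr C \<Longrightarrow> h \<in> Arr C \<Longrightarrow> Cod C f = Dom C g \<Longrightarrow> Cod C g = Dom C h \<Longrightarrow>
    (h \<cdot> g) \<cdot> f = h \<cdot> (g \<cdot> f)"
  using cmp_assoc by (auto simp: Hom_def)

text \<open>\<open>assoc\<close> normalises composites to the right, so a rule for
  \<open>g \<cdot> f\<close> no longer matches inside \<open>g \<cdot> f \<cdot> h\<close>. This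
  supplies the form with a tail \<open>h\<close>; many of the \<open>_cmp\<close> rules below are
  instances of it.\<close>

lemma reassoc:
  "g \<cdot> f = k \<Longrightarrow> h \<in> Arr C \<Longrightarrow> f \<in> Arr C \<Longrightarrow> g \<in> Arr C \<Longrightarrow>
    Cod C h = Dom C f \<Longrightarrow> Cod C f = Dom C g \<Longrightarrow> g \<cdot> (f \<cdot> h) = k \<cdot> h"
  using assoc by metis

lemma Hom_Arr: "f \<in> Arr C \<Longrightarrow> f \<in> Hom C (Dom C f) (Cod C f)"
  by (simp add: Hom_def)

lemma product_pairing:
  assumes "is_product C A B P p q" "a \<in> Hom C Y A" "b \<in> Hom C Y B"
  shows "pairing C P p q a b \<in> Hom C Y P"
    and "p \<cdot> pairing C P p q a b = a" and "q \<cdot> pairing C P p q a b = b"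
proof -
  have Y: "Dom C a = Y" using assms(2) by (simp add: Hom_def)
  have "\<exists>!h. h \<in> Hom C (Dom C a) P \<and> p \<cdot> h = a \<and> q \<cdot> h = b"
    using assms unfolding is_product_def Y by blast
  from theI'[OF this] show "pairing C P p q a b \<in> Hom C Y P"
    "p \<cdot> pairing C P p q a b = a" "q \<cdot> pairing C P p q a b = b"
    using assms(2) by (auto simp: pairing_def Hom_def)
qed

lemma product_ext:
  assumes "is_product C A B P p q" "h \<in> Hom C Y P" "k \<in> Hom C Y P" "p \<cdot> h = p \<cdot> k" "q \<cdot> h = q \<cdot> k"
  shows "h = k"
proof -
  have "p \<cdot> k \<in> Hom C Y A" "q \<cdot> k \<in> Hom C Y B"
    using assms cmp_Hom unfolding is_product_def by blast+
  then have "\<exists>!h. h \<in> Hom C Y P \<and> p \<cdot> h = p \<cdot> k \<and> q \<cdot> h = q \<cdot> k"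
    using assms(1) unfolding is_product_def by blast
  then show ?thesis using assms by blast
qed

lemma pairing_cmp:
  assumes "is_product C A B P p q" "a \<in> Hom C Y A" "b \<in> Hom C Y B" "h \<in> Hom C Z Y"
  shows "pairing C P p q a b \<cdot> h = pairing C P p q (a \<cdot> h) (b \<cdot> h)"
proof (rule product_ext[OF assms(1)])
  have p: "p \<in> Hom C P A" and q: "q \<in> Hom C P B" using assms(1) unfolding is_product_def by auto
  note ab = product_pairing[OF assms(1-3)]
  have ah: "a \<cdot> h \<in> Hom C Z A" "b \<cdot> h \<in> Hom C Z B" using assms cmp_Hom by blast+
  note abh = product_pairing[OF assms(1) ah]
  show "pairing C P p q a b \<cdot> h \<in> Hom C Z P" using ab assms(4) cmp_Hom by blast
  show "pairing C P p q (a \<cdot> h) (b \<cdot> h) \<in> Hom C Z P" by (fact abh)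
  show "p \<cdot> pairing C P p q a b \<cdot> h = p \<cdot> pairing C P p q (a \<cdot> h) (b \<cdot> h)"
    using ab abh cmp_assoc[OF assms(4) ab(1) p] by simp
  show "q \<cdot> pairing C P p q a b \<cdot> h = q \<cdot> pairing C P p q (a \<cdot> h) (b \<cdot> h)"
    using ab abh cmp_assoc[OF assms(4) ab(1) q] by simp
qed

lemma pullback_pairing:
  assumes "is_pullback C f g P p q" "a \<in> Hom C Y (Dom C f)" "b \<in> Hom C Y (Dom C g)" "f \<cdot> a = g \<cdot> b"
  shows "pairing C P p q a b \<in> Hom C Y P"
    and "p \<cdot> pairing C P p q a b = a" and "q \<cdot> pairing C P p q a b = b"
proof -
  have Y: "Dom C a = Y" using assms(2) by (simp add: Hom_def)
  have "\<exists>!h. h \<in> Hom C (Dom C a) P \<and> p \<cdot> h = a \<and> q \<cdot> h = b"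
    using assms unfolding is_pullback_def Y by blast
  from theI'[OF this] show "pairing C P p q a b \<in> Hom C Y P"
    "p \<cdot> pairing C P p q a b = a" "q \<cdot> pairing C P p q a b = b"
    using assms(2) by (auto simp: pairing_def Hom_def)
qed

lemma pullback_ext:
  assumes "is_pullback C f g P p q" "h \<in> Hom C Y P" "k \<in> Hom C Y P" "p \<cdot> h = p \<cdot> k" "q \<cdot> h = q \<cdot> k"
  shows "h = k"
proof -
  have pb: "f \<in> Arr C" "g \<in> Arr C" "Cod C f = Cod C g" "p \<in> Hom C P (Dom C f)"
    "q \<in> Hom C P (Dom C g)" "f \<cdot> p = g \<cdot> q"
    using assms(1) unfolding is_pullback_def by blast+
  have pk: "p \<cdot> k \<in> Hom C Y (Dom C f)" "q \<cdot> k \<in> Hom C Y (Dom C g)"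
    using pb assms cmp_Hom by blast+
  have "f \<cdot> (p \<cdot> k) = g \<cdot> (q \<cdot> k)"
    using pb(6) cmp_assoc[OF assms(3) pb(4) Hom_Arr[OF pb(1)]]
      cmp_assoc[OF assms(3) pb(5) Hom_Arr[OF pb(2)]] by simp
  then have "\<exists>!h. h \<in> Hom C Y P \<and> p \<cdot> h = p \<cdot> k \<and> q \<cdot> h = q \<cdot> k"
    using assms(1) pk unfolding is_pullback_def by blast
  then show ?thesis using assms by blast
qed

lemma to_terminal_Hom:
  assumes "is_terminal C t" "Y \<in> Obj C"
  shows "to_terminal C t Y \<in> Hom C Y t"
proof -
  have "\<exists>!h. h \<in> Hom C Y t" using assms unfolding is_terminal_def by blast
  from theI'[OF this] show ?thesis unfolding to_terminal_def .
qed

lemma terminal_ext: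
  "is_terminal C t \<Longrightarrow> h \<in> Hom C Y t \<Longrightarrow> k \<in> Hom C Y t \<Longrightarrow> h = k"
  using Dom_Cod_Obj(1)[of h] unfolding is_terminal_def Hom_def by blast

lemma is_inverse_unique:
  assumes "is_inverse C f g" "is_inverse C f h"
  shows "g = h"
proof -
  have "g = (h \<cdot> f) \<cdot> g" using assms by (auto simp: is_inverse_def Hom_def)
  also have "\<dots> = h \<cdot> (f \<cdot> g)" using assms by (subst assoc) (auto simp: is_inverse_def Hom_def)
  also have "\<dots> = h" using assms by (auto simp: is_inverse_def Hom_def)
  finally show ?thesis .
qed

lemma inv_arr_inverse:
  assumes "is_iso C f"
  shows "is_inverse C f (inv_arr C f)"
proof -
  obtain g where "is_inverse C f g" using assms unfolding is_iso_def by blast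
  then show ?thesis unfolding inv_arr_def by (metis theI is_inverse_unique)
qed

lemma inv_arr_idt:
  assumes "X \<in> Obj C"
  shows "inv_arr C (idt C X) = idt C X"
proof -
  have "is_inverse C (idt C X) (idt C X)" using assms by (simp add: is_inverse_def Hom_def)
  then show ?thesis using inv_arr_inverse is_inverse_unique unfolding is_iso_def by blast
qed

end

section \<open>Abelian group objects through generalised elements\<close>

locale abelian_group_in = category C
  for C :: "('o, 'm, 'x) category_scheme" (structure) +
  fixes G :: "('o, 'm) group_data"
  assumes group: "abelian_group_object C G"
begin

abbreviation gzero_at :: "'o \<Rightarrow> 'm" where
  "gzero_at Y \<equiv> gzero G \<cdot> to_terminal C (gpt G) Y"

lemma
  shows terminal: "is_terminal C (gpt G)"
    and product: "is_product C (gob G) (gob G) (gsq G) (gpr1 G) (gpr2 G)"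
    and gadd_Hom: "gadd G \<in> Hom C (gsq G) (gob G)"
    and gzero_Hom: "gzero G \<in> Hom C (gpt G) (gob G)"
    and gpr_Hom: "gpr1 G \<in> Hom C (gsq G) (gob G)" "gpr2 G \<in> Hom C (gsq G) (gob G)"
  using group unfolding abelian_group_object_def is_product_def by auto

lemma gob_Obj: "gob G \<in> Obj C"
  using gadd_Hom Dom_Cod_Obj(2)[of "gadd G"] by (auto simp: Hom_def)

lemma gplus_Hom:
  assumes "a \<in> Hom C Y (gob G)" "b \<in> Hom C Y (gob G)"
  shows "gplus C G a b \<in> Hom C Y (gob G)"
  unfolding gplus_def using product_pairing[OF product assms] gadd_Hom cmp_Hom by blast

lemma gplus_cmp:
  assumes "a \<in> Hom C Y (gob G)" "b \<in> Hom C Y (gob G)" "h \<in> Hom C Z Y"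
  shows "gplus C G a b \<cdot> h = gplus C G (a \<cdot> h) (b \<cdot> h)"
  unfolding gplus_def using cmp_assoc[OF assms(3) product_pairing(1)[OF product assms(1,2)] gadd_Hom]
    pairing_cmp[OF product assms] by simp

lemma gzero_at_Hom: "Y \<in> Obj C \<Longrightarrow> gzero_at Y \<in> Hom C Y (gob G)"
  using to_terminal_Hom[OF terminal] gzero_Hom cmp_Hom by blast

lemma gzero_at_cmp:
  assumes "h \<in> Hom C Z Y"
  shows "gzero_at Y \<cdot> h = gzero_at Z"
proof -
  have obj: "Y \<in> Obj C" "Z \<in> Obj C" using assms by (auto simp: Hom_def)
  note t = to_terminal_Hom[OF terminal]
  have "to_terminal C (gpt G) Y \<cdot> h = to_terminal C (gpt G) Z"
    using terminal_ext[OF terminal] cmp_Hom[OF assms t] t obj by blast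
  then show ?thesis using cmp_assoc[OF assms t gzero_Hom] obj by simp
qed

text \<open>The axiom is one equation on some triple product \<open>W\<close>. Precomposing it with
  the arrow \<open>h\<close> whose components are \<open>a\<close>, \<open>b\<close>,
  \<open>c\<close> carries it over to arbitrary elements; the other group laws are pulled back in
  the same way.\<close>

lemma gplus_assoc:
  assumes "a \<in> Hom C Y (gob G)" "b \<in> Hom C Y (gob G)" "c \<in> Hom C Y (gob G)"
  shows "gplus C G (gplus C G a b) c = gplus C G a (gplus C G b c)"
proof -
  obtain W q\<^sub>1 q\<^sub>2 where W: "is_product C (gsq G) (gob G) W q\<^sub>1 q\<^sub>2"
    and eq: "gplus C G (gadd G \<cdot> q\<^sub>1) q\<^sub>2 = gplus C G (gpr1 G \<cdot> q\<^sub>1) (gplus C G (gpr2 G \<cdot> q\<^sub>1) q\<^sub>2)"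
    using group unfolding abelian_group_object_def by blast
  define ab where "ab = pairing C (gsq G) (gpr1 G) (gpr2 G) a b"
  define h where "h = pairing C W q\<^sub>1 q\<^sub>2 ab c"
  note ab = product_pairing[OF product assms(1,2), folded ab_def]
  note h = product_pairing[OF W ab(1) assms(3), folded h_def]
  have q: "q\<^sub>1 \<in> Hom C W (gsq G)" "q\<^sub>2 \<in> Hom C W (gob G)" using W unfolding is_product_def by auto
  have p: "gadd G \<cdot> q\<^sub>1 \<in> Hom C W (gob G)" "gpr1 G \<cdot> q\<^sub>1 \<in> Hom C W (gob G)"
    "gpr2 G \<cdot> q\<^sub>1 \<in> Hom C W (gob G)" using q gpr_Hom gadd_Hom cmp_Hom by blast+
  have e: "(gadd G \<cdot> q\<^sub>1) \<cdot> h = gplus C G a b" "(gpr1 G \<cdot> q\<^sub>1) \<cdot> h = a" "(gpr2 G \<cdot> q\<^sub>1) \<cdot> h = b"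
    using cmp_assoc[OF h(1) q(1)] gadd_Hom gpr_Hom ab h by (auto simp: gplus_def ab_def)
  show ?thesis
    using arg_cong[OF eq, of "\<lambda>t. t \<cdot> h"] gplus_cmp[OF p(1) q(2) h(1)]
      gplus_cmp[OF p(2) gplus_Hom[OF p(3) q(2)] h(1)] gplus_cmp[OF p(3) q(2) h(1)] e h
    by simp
qed

lemma gplus_comm:
  assumes "a \<in> Hom C Y (gob G)" "b \<in> Hom C Y (gob G)"
  shows "gplus C G a b = gplus C G b a"
proof -
  have eq: "gplus C G (gpr2 G) (gpr1 G) = gadd G"
    using group unfolding abelian_group_object_def by blast
  note ab = product_pairing[OF product assms]
  have "gplus C G b a = gadd G \<cdot> pairing C (gsq G) (gpr1 G) (gpr2 G) a b"
    using arg_cong[OF eq, of "\<lambda>t. t \<cdot> pairing C (gsq G) (gpr1 G) (gpr2 G) a b"]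
      gplus_cmp[OF gpr_Hom(2,1) ab(1)] ab by simp
  then show ?thesis by (simp add: gplus_def)
qed

lemma gplus_zero:
  assumes "a \<in> Hom C Y (gob G)"
  shows "gplus C G a (gzero_at Y) = a"
proof -
  have eq: "gplus C G (idt C (gob G)) (gzero_at (gob G)) = idt C (gob G)"
    using group unfolding abelian_group_object_def by blast
  show ?thesis
    using arg_cong[OF eq, of "\<lambda>t. t \<cdot> a"]
      gplus_cmp[OF idt_Hom[OF gob_Obj] gzero_at_Hom[OF gob_Obj] assms]
      gzero_at_cmp[OF assms] idt_left[OF assms] by simp
qed

lemma gplus_right_inverse:
  assumes "is_group_inverse C G n" "a \<in> Hom C Y (gob G)"
  shows "n \<cdot> a \<in> Hom C Y (gob G)" "gplus C G a (n \<cdot> a) = gzero_at Y"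
proof -
  have n: "n \<in> Hom C (gob G) (gob G)" and eq: "gplus C G (idt C (gob G)) n = gzero_at (gob G)"
    using assms(1) unfolding is_group_inverse_def by auto
  show "n \<cdot> a \<in> Hom C Y (gob G)" using n assms(2) cmp_Hom by blast
  show "gplus C G a (n \<cdot> a) = gzero_at Y"
    using arg_cong[OF eq, of "\<lambda>t. t \<cdot> a"] gplus_cmp[OF idt_Hom[OF gob_Obj] n assms(2)]
      gzero_at_cmp[OF assms(2)] idt_left[OF assms(2)] by simp
qed

lemma gplus_cancel:
  assumes "a \<in> Hom C Y (gob G)" "b \<in> Hom C Y (gob G)" "c \<in> Hom C Y (gob G)"
    and "gplus C G a c = gplus C G b c"
  shows "a = b"
proof -
  obtain n where n: "is_group_inverse C G n" using group unfolding abelian_group_object_def by blast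
  note nc = gplus_right_inverse[OF n assms(3)]
  have "a = gplus C G (gplus C G a c) (n \<cdot> c)"
    using gplus_assoc[OF assms(1,3) nc(1)] nc(2) gplus_zero[OF assms(1)] by simp
  also have "\<dots> = b"
    using gplus_assoc[OF assms(2,3) nc(1)] nc(2) gplus_zero[OF assms(2)] assms(4) by simp
  finally show ?thesis .
qed

text \<open>Two inverses have the same sum with the identity, so cancellation identifies them; this
  gives the \<open>THE\<close> behind \<open>group_inverse\<close> its meaning.\<close>

lemma group_inverse: "is_group_inverse C G (group_inverse C G)"
proof -
  obtain n where n: "is_group_inverse C G n" using group unfolding abelian_group_object_def by blast
  note i = idt_Hom[OF gob_Obj]
  have "m = n" if m: "is_group_inverse C G m" for m
    using n m i gplus_cancel[of m "gob G" n "idt C (gob G)"]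
      gplus_comm[OF i, of m] gplus_comm[OF i, of n] unfolding is_group_inverse_def by auto
  with n show ?thesis unfolding group_inverse_def by (rule theI)
qed

lemmas gplus_neg = gplus_right_inverse[OF group_inverse]

lemma group_difference_Hom: "group_difference C G \<in> Hom C (gsq G) (gob G)"
  unfolding group_difference_def using gplus_Hom gpr_Hom gplus_neg(1) by blast

text \<open>Subtraction enters later in the form \<open>d + b = a\<close>, which additive maps
  preserve directly.\<close>

lemma gplus_difference:
  assumes "a \<in> Hom C Y (gob G)" "b \<in> Hom C Y (gob G)"
  shows "gplus C G (group_difference C G \<cdot> pairing C (gsq G) (gpr1 G) (gpr2 G) a b) b = a"
proof -
  note ab = product_pairing[OF product assms]
  have n: "group_inverse C G \<in> Hom C (gob G) (gob G)"
    using group_inverse unfolding is_group_inverse_def by blast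
  let ?h = "pairing C (gsq G) (gpr1 G) (gpr2 G) a b" and ?n = "group_inverse C G \<cdot> b"
  have "group_difference C G \<cdot> ?h = gplus C G a ?n"
    unfolding group_difference_def
    using gplus_cmp[OF gpr_Hom(1) gplus_neg(1)[OF gpr_Hom(2)] ab(1)]
      cmp_assoc[OF ab(1) gpr_Hom(2) n] ab by simp
  moreover have "gplus C G (gplus C G a ?n) b = a"
    using gplus_assoc[OF assms(1) gplus_neg(1)[OF assms(2)] assms(2)]
      gplus_comm[OF assms(2) gplus_neg(1)[OF assms(2)]] gplus_neg(2)[OF assms(2)]
      gplus_zero[OF assms(1)] by simp
  ultimately show ?thesis by simp
qed

end

section \<open>Tangent categories\<close>

lemma slice_Hom_iff:
  "u \<in> Hom (slice C X) p q \<longleftrightarrow> (\<exists>f. u = (p, f, q) \<and> p \<in> Arr C \<and> q \<in> Arr C \<and> Cod C p = X \<and>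
    Cod C q = X \<and> f \<in> Arr C \<and> Dom C f = Dom C p \<and> Cod C f = Dom C q \<and> q \<cdot>\<^bsub>C\<^esub> f = p)"
  by (auto simp: slice_def Hom_def)

lemma slice_cmp [simp]: "(q, g, r) \<cdot>\<^bsub>slice C X\<^esub> (p, f, q') = (p, g \<cdot>\<^bsub>C\<^esub> f, r)"
  by (simp add: slice_def)

text \<open>Allows the group calculus above to be instantiated at \<open>slice C X\<close>, where
  the fiberwise group structure of \<open>T X\<close> lives.\<close>

lemma slice_category:
  assumes "category C"
  shows "category (slice C X)"
proof -
  interpret category C by fact
  show ?thesis
  proof
    fix u v p q r
    assume "u \<in> Hom (slice C X) p q" "v \<in> Hom (slice C X) q r"
    then obtain f g where f: "u = (p, f, q)" "f \<in> Arr C" "Dom C f = Dom C p" "Cod C f = Dom C q"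
        "q \<cdot>\<^bsub>C\<^esub> f = p" "p \<in> Arr C" "Cod C p = X"
      and g: "v = (q, g, r)" "g \<in> Arr C" "Dom C g = Dom C q" "Cod C g = Dom C r" "r \<cdot>\<^bsub>C\<^esub> g = q"
        "r \<in> Arr C" "Cod C r = X"
      unfolding slice_Hom_iff by blast
    have "r \<cdot>\<^bsub>C\<^esub> (g \<cdot>\<^bsub>C\<^esub> f) = p" using reassoc[OF g(5) f(2)] f g by simp
    then show "v \<cdot>\<^bsub>slice C X\<^esub> u \<in> Hom (slice C X) p r"
      unfolding slice_Hom_iff f(1) g(1) slice_cmp using f(2-4,6,7) g(2-4,6,7) by simp
  next
    fix u v w p q r s
    assume "u \<in> Hom (slice C X) p q" "v \<in> Hom (slice C X) q r" "w \<in> Hom (slice C X) r s"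
    then obtain f g h where "u = (p, f, q)" "v = (q, g, r)" "w = (r, h, s)"
      "f \<in> Arr C" "g \<in> Arr C" "h \<in> Arr C" "Cod C f = Dom C g" "Cod C g = Dom C h"
      unfolding slice_Hom_iff by metis
    then show "(w \<cdot>\<^bsub>slice C X\<^esub> v) \<cdot>\<^bsub>slice C X\<^esub> u = w \<cdot>\<^bsub>slice C X\<^esub> v \<cdot>\<^bsub>slice C X\<^esub> u"
      by simp
  next
    fix u p q
    assume u: "u \<in> Hom (slice C X) p q"
    then obtain f where f: "u = (p, f, q)" "f \<in> Arr C" "Dom C f = Dom C p" "Cod C f = Dom C q"
      unfolding slice_Hom_iff by blast
    show "idt (slice C X) q \<cdot>\<^bsub>slice C X\<^esub> u = u" "u \<cdot>\<^bsub>slice C X\<^esub> idt (slice C X) p = u"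
      using f by (simp_all add: slice_def)
  qed (auto simp: slice_def Hom_def)
qed

context tangent_category
begin

text \<open>\<open>vf_add\<close> never asks its arguments to be sections, so the same formula
  serves as the sum of any two parallel arrows into \<open>T X\<close> with equal base
  points.\<close>

abbreviation tsum :: "'m \<Rightarrow> 'o \<Rightarrow> 'm \<Rightarrow> 'm"  ("_ +\<^bsub>_\<^esub> _" [66, 0, 66] 65) where
  "a +\<^bsub>X\<^esub> b \<equiv> vf_add C X a b"

abbreviation \<pi> :: "'o \<Rightarrow> 'm" where "\<pi> \<equiv> tproj C"
abbreviation \<zeta> :: "'o \<Rightarrow> 'm" where "\<zeta> \<equiv> tzero C"
abbreviation \<Lambda> :: "'o \<Rightarrow> 'm" where "\<Lambda> \<equiv> tlift C"
abbreviation \<tau> :: "'o \<Rightarrow> 'm" where "\<tau> \<equiv> tflip C"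
abbreviation T :: "'o \<Rightarrow> 'o" where "T \<equiv> Tob C"
abbreviation D :: "'m \<Rightarrow> 'm" where "D \<equiv> Tar C"

section \<open>Functoriality and naturality as rewrite rules\<close>

lemma T_Obj [simp]: "X \<in> Obj C \<Longrightarrow> T X \<in> Obj C"
  and D_idt [simp]: "X \<in> Obj C \<Longrightarrow> D (idt C X) = idt C (T X)"
  using T_functor unfolding is_functor_def by auto

lemma D_Arr [simp]:
  assumes "f \<in> Arr C"
  shows "D f \<in> Arr C" "Dom C (D f) = T (Dom C f)" "Cod C (D f) = T (Cod C f)"
  using assms T_functor unfolding is_functor_def Hom_def by auto

lemma D_cmp [simp]:
  "f \<in> Arr C \<Longrightarrow> g \<in> Arr C \<Longrightarrow> Cod C f = Dom C g \<Longrightarrow> D (g \<cdot> f) = D g \<cdot> D f"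
  using T_functor unfolding is_functor_def Hom_def by auto

lemma T_struct_Arr [simp]:
  assumes "X \<in> Obj C"
  shows "\<pi> X \<in> Arr C" "Dom C (\<pi> X) = T X" "Cod C (\<pi> X) = X"
    and "\<zeta> X \<in> Arr C" "Dom C (\<zeta> X) = X" "Cod C (\<zeta> X) = T X"
    and "\<Lambda> X \<in> Arr C" "Dom C (\<Lambda> X) = T X" "Cod C (\<Lambda> X) = T (T X)"
    and "\<tau> X \<in> Arr C" "Dom C (\<tau> X) = T (T X)" "Cod C (\<tau> X) = T (T X)"
    and "tplus C X \<in> Arr C" "Dom C (tplus C X) = T2 C X" "Cod C (tplus C X) = T X"
  using assms tproj_natural tzero_natural tlift_natural tflip_natural tplus_natural
  unfolding is_natural_def Hom_def by auto

lemma T2pr_Arr [simp]: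
  assumes "X \<in> Obj C"
  shows "T2pr1 C X \<in> Arr C" "Dom C (T2pr1 C X) = T2 C X" "Cod C (T2pr1 C X) = T X"
    and "T2pr2 C X \<in> Arr C" "Dom C (T2pr2 C X) = T2 C X" "Cod C (T2pr2 C X) = T X"
  using T2_pullback[OF assms] assms unfolding is_pullback_def Hom_def by auto

lemma T2_Obj [simp]: "X \<in> Obj C \<Longrightarrow> T2 C X \<in> Obj C"
  using T2pr_Arr Dom_Obj by metis

lemma T2pr_eq: "X \<in> Obj C \<Longrightarrow> \<pi> X \<cdot> T2pr1 C X = \<pi> X \<cdot> T2pr2 C X"
  using T2_pullback unfolding is_pullback_def by blast

lemma proj_nat [simp]: "f \<in> Arr C \<Longrightarrow> Cod C f = Y \<Longrightarrow> \<pi> Y \<cdot> D f = f \<cdot> \<pi> (Dom C f)"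
  using tproj_natural unfolding is_natural_def Hom_def by auto

lemma proj_nat_cmp [simp]:
  "f \<in> Arr C \<Longrightarrow> Cod C f = Y \<Longrightarrow> h \<in> Arr C \<Longrightarrow> Cod C h = T (Dom C f) \<Longrightarrow>
    \<pi> Y \<cdot> D f \<cdot> h = f \<cdot> \<pi> (Dom C f) \<cdot> h"
  by (subst reassoc[OF proj_nat]) auto

lemma zero_nat [simp]: "f \<in> Arr C \<Longrightarrow> Dom C f = X \<Longrightarrow> D f \<cdot> \<zeta> X = \<zeta> (Cod C f) \<cdot> f"
  using tzero_natural unfolding is_natural_def Hom_def by auto

lemma zero_nat_cmp [simp]:
  "f \<in> Arr C \<Longrightarrow> Dom C f = X \<Longrightarrow> h \<in> Arr C \<Longrightarrow> Cod C h = X \<Longrightarrow>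
    D f \<cdot> \<zeta> X \<cdot> h = \<zeta> (Cod C f) \<cdot> f \<cdot> h"
  by (subst reassoc[OF zero_nat]) auto

lemma lift_nat: "f \<in> Arr C \<Longrightarrow> D (D f) \<cdot> \<Lambda> (Dom C f) = \<Lambda> (Cod C f) \<cdot> D f"
  using tlift_natural unfolding is_natural_def Hom_def by auto

lemma flip_nat: "f \<in> Arr C \<Longrightarrow> D (D f) \<cdot> \<tau> (Dom C f) = \<tau> (Cod C f) \<cdot> D (D f)"
  using tflip_natural unfolding is_natural_def Hom_def by auto

lemma lift_nat_cmp:
  "f \<in> Arr C \<Longrightarrow> h \<in> Arr C \<Longrightarrow> Cod C h = T (Dom C f) \<Longrightarrow>
    D (D f) \<cdot> \<Lambda> (Dom C f) \<cdot> h = \<Lambda> (Cod C f) \<cdot> D f \<cdot> h"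
  by (subst reassoc[OF lift_nat]) auto

lemma flip_nat_cmp:
  "f \<in> Arr C \<Longrightarrow> h \<in> Arr C \<Longrightarrow> Cod C h = T (T (Dom C f)) \<Longrightarrow>
    D (D f) \<cdot> \<tau> (Dom C f) \<cdot> h = \<tau> (Cod C f) \<cdot> D (D f) \<cdot> h"
  by (subst reassoc[OF flip_nat]) auto

section \<open>Fiberwise sums of tangent vectors\<close>

lemma T2pair_Arr [simp]:
  assumes "X \<in> Obj C" "a \<in> Arr C" "b \<in> Arr C" "Cod C a = T X" "Cod C b = T X" "Dom C b = Dom C a"
    and "\<pi> X \<cdot> a = \<pi> X \<cdot> b"
  shows "T2pair C X a b \<in> Arr C" "Dom C (T2pair C X a b) = Dom C a" "Cod C (T2pair C X a b) = T2 C X"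
    and "T2pr1 C X \<cdot> T2pair C X a b = a" "T2pr2 C X \<cdot> T2pair C X a b = b"
  using pullback_pairing[OF T2_pullback[OF assms(1)], of a "Dom C a" b] assms
  by (auto simp: T2pair_def Hom_def)

lemma T2_ext:
  assumes "X \<in> Obj C" "h \<in> Arr C" "k \<in> Arr C" "Cod C h = T2 C X" "Cod C k = T2 C X" "Dom C k = Dom C h"
    and "T2pr1 C X \<cdot> h = T2pr1 C X \<cdot> k" "T2pr2 C X \<cdot> h = T2pr2 C X \<cdot> k"
  shows "h = k"
  using pullback_ext[OF T2_pullback[OF assms(1)], of h "Dom C h" k] assms by (auto simp: Hom_def)

lemma T2pair_cmp:
  assumes "X \<in> Obj C" "a \<in> Arr C" "b \<in> Arr C" "Cod C a = T X" "Cod C b = T X" "Dom C b = Dom C a"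
    and "\<pi> X \<cdot> a = \<pi> X \<cdot> b" "h \<in> Arr C" "Cod C h = Dom C a"
  shows "T2pair C X a b \<cdot> h = T2pair C X (a \<cdot> h) (b \<cdot> h)"
proof -
  have "\<pi> X \<cdot> a \<cdot> h = \<pi> X \<cdot> b \<cdot> h"
    using reassoc[OF assms(7)] assms by simp
  then show ?thesis
    using assms
    by - (rule T2_ext[OF assms(1)],
      simp_all add: reassoc[OF T2pair_Arr(4)] reassoc[OF T2pair_Arr(5)])
qed

text \<open>Hidden in the group axiom: addition is a morphism of the slice over \<open>X\<close>,
  which means precisely that it respects base points.\<close>

lemma proj_plus: "X \<in> Obj C \<Longrightarrow> \<pi> X \<cdot> tplus C X = \<pi> X \<cdot> T2pr1 C X"
proof -
  assume X: "X \<in> Obj C"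
  have "gadd (tangent_group C X) \<in>
      Hom (slice C X) (gsq (tangent_group C X)) (gob (tangent_group C X))"
    using tangent_group[OF X] unfolding abelian_group_object_def by blast
  then show ?thesis by (simp add: tangent_group_def Let_def Hom_def slice_def)
qed

lemma tsum_Arr [simp]:
  assumes "X \<in> Obj C" "a \<in> Arr C" "b \<in> Arr C" "Cod C a = T X" "Cod C b = T X" "Dom C b = Dom C a"
    and "\<pi> X \<cdot> a = \<pi> X \<cdot> b"
  shows "a +\<^bsub>X\<^esub> b \<in> Arr C" "Dom C (a +\<^bsub>X\<^esub> b) = Dom C a" "Cod C (a +\<^bsub>X\<^esub> b) = T X"
    "\<pi> X \<cdot> (a +\<^bsub>X\<^esub> b) = \<pi> X \<cdot> b"
  using assms by (simp_all add: vf_add_def reassoc[OF proj_plus])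

lemma tsum_cmp:
  assumes "X \<in> Obj C" "a \<in> Arr C" "b \<in> Arr C" "Cod C a = T X" "Cod C b = T X" "Dom C b = Dom C a"
    and "\<pi> X \<cdot> a = \<pi> X \<cdot> b" "h \<in> Arr C" "Cod C h = Dom C a"
  shows "(a +\<^bsub>X\<^esub> b) \<cdot> h = (a \<cdot> h) +\<^bsub>X\<^esub> (b \<cdot> h)"
  using assms by (simp add: vf_add_def T2pair_cmp)

text \<open>Naturality of \<open>tplus\<close>, read on elements. The interchange law in
  \<open>T R\<close> and the additivity of second derivatives both come from it.\<close>

lemma D_tsum:
  assumes "a \<in> Arr C" "b \<in> Arr C" "Cod C a = T X" "Cod C b = T X" "Dom C b = Dom C a"
    and "\<pi> X \<cdot> a = \<pi> X \<cdot> b" "f \<in> Arr C" "Dom C f = X"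
  shows "D f \<cdot> (a +\<^bsub>X\<^esub> b) = (D f \<cdot> a) +\<^bsub>Cod C f\<^esub> (D f \<cdot> b)"
proof -
  have X: "X \<in> Obj C" using assms(7,8) by auto
  let ?Y = "Cod C f" and ?h = "T2pair C X a b"
  have nat: "D f \<cdot> tplus C X = tplus C ?Y \<cdot> T2ar C f"
    using tplus_natural assms(7,8) unfolding is_natural_def Hom_def by auto
  have T2ar: "T2ar C f = T2pair C ?Y (D f \<cdot> T2pr1 C X) (D f \<cdot> T2pr2 C X)"
    using assms(8) by (simp add: T2ar_def)
  have ok: "\<pi> ?Y \<cdot> D f \<cdot> T2pr1 C X = \<pi> ?Y \<cdot> D f \<cdot> T2pr2 C X"
    using assms X T2pr_eq by simp
  have "D f \<cdot> (a +\<^bsub>X\<^esub> b) = (D f \<cdot> tplus C X) \<cdot> ?h"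
    using assms X by (simp add: vf_add_def)
  also have "\<dots> = tplus C ?Y \<cdot> T2pair C ?Y (D f \<cdot> T2pr1 C X) (D f \<cdot> T2pr2 C X) \<cdot> ?h"
    unfolding nat T2ar using assms X ok by simp
  also have "\<dots> = (D f \<cdot> a) +\<^bsub>?Y\<^esub> (D f \<cdot> b)"
    using assms X ok by (simp add: T2pair_cmp vf_add_def)
  finally show ?thesis .
qed

lemma slice_group: "X \<in> Obj C \<Longrightarrow> abelian_group_in (slice C X) (tangent_group C X)"
  using slice_category[OF category_axioms] tangent_group
  by (simp add: abelian_group_in_def abelian_group_in_axioms_def)

text \<open>The base point is a separate \<open>x\<close> with an equation, since slice arrows over
  \<open>\<pi> X \<cdot> a\<close> and \<open>\<pi> X \<cdot> b\<close> must be recognised as having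
  the same source.\<close>

lemma slice_element:
  assumes "X \<in> Obj C" "a \<in> Arr C" "Cod C a = T X" "x = \<pi> X \<cdot> a"
  shows "(x, a, \<pi> X) \<in> Hom (slice C X) x (gob (tangent_group C X))"
  using assms by (simp add: Hom_def slice_def tangent_group_def Let_def)

lemma slice_pairing:
  assumes "X \<in> Obj C" "a \<in> Arr C" "b \<in> Arr C" "Cod C a = T X" "Cod C b = T X" "Dom C b = Dom C a"
    and "x = \<pi> X \<cdot> a" "x = \<pi> X \<cdot> b"
  shows "pairing (slice C X) (gsq (tangent_group C X)) (gpr1 (tangent_group C X))
    (gpr2 (tangent_group C X)) (x, a, \<pi> X) (x, b, \<pi> X) =
    (x, T2pair C X a b, \<pi> X \<cdot> T2pr1 C X)" (is "?l = ?r")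
proof -
  interpret S: abelian_group_in "slice C X" "tangent_group C X" by (rule slice_group) fact
  note p = S.product_pairing[OF S.product slice_element[OF assms(1,2,4,7)] slice_element[OF assms(1,3,5,8)]]
  show ?thesis
  proof (rule S.product_ext[OF S.product p(1)])
    show "?r \<in> Hom (slice C X) x (gsq (tangent_group C X))"
      using assms by (simp add: Hom_def slice_def tangent_group_def Let_def)
  qed (use p assms in \<open>simp_all add: slice_def tangent_group_def Let_def\<close>)
qed

lemma slice_gplus:
  assumes "X \<in> Obj C" "a \<in> Arr C" "b \<in> Arr C" "Cod C a = T X" "Cod C b = T X" "Dom C b = Dom C a"
    and "x = \<pi> X \<cdot> a" "x = \<pi> X \<cdot> b"
  shows "gplus (slice C X) (tangent_group C X) (x, a, \<pi> X) (x, b, \<pi> X) = (x, a +\<^bsub>X\<^esub> b, \<pi> X)"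
  unfolding gplus_def slice_pairing[OF assms]
  by (simp add: slice_def tangent_group_def Let_def vf_add_def)

lemma tsum_comm:
  assumes "X \<in> Obj C" "a \<in> Arr C" "b \<in> Arr C" "Cod C a = T X" "Cod C b = T X" "Dom C b = Dom C a"
    and "\<pi> X \<cdot> a = \<pi> X \<cdot> b"
  shows "a +\<^bsub>X\<^esub> b = b +\<^bsub>X\<^esub> a"
proof -
  interpret S: abelian_group_in "slice C X" "tangent_group C X" by (rule slice_group) fact
  let ?x = "\<pi> X \<cdot> b"
  show ?thesis
    using S.gplus_comm[of "(?x, a, \<pi> X)" ?x "(?x, b, \<pi> X)"] assms
    by (simp add: slice_element slice_gplus)
qed

lemma proj_zero [simp]: "X \<in> Obj C \<Longrightarrow> \<pi> X \<cdot> \<zeta> X = idt C X"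
proof -
  assume X: "X \<in> Obj C"
  interpret S: abelian_group_in "slice C X" "tangent_group C X" by (rule slice_group) fact
  show ?thesis using S.gzero_Hom by (simp add: tangent_group_def Let_def Hom_def slice_def)
qed

lemma proj_zero_cmp [simp]: "X \<in> Obj C \<Longrightarrow> h \<in> Arr C \<Longrightarrow> Cod C h = X \<Longrightarrow> \<pi> X \<cdot> \<zeta> X \<cdot> h = h"
  by (subst reassoc[OF proj_zero]) auto

text \<open>The zero vector is passed as \<open>z\<close> with an equation, so that the rule also
  applies when simplification has brought \<open>\<zeta> X \<cdot> \<pi> X \<cdot> a\<close> into
  another form.\<close>

lemma tsum_zero:
  assumes "X \<in> Obj C" "a \<in> Arr C" "Cod C a = T X" "z = \<zeta> X \<cdot> \<pi> X \<cdot> a"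
  shows "a +\<^bsub>X\<^esub> z = a" "z +\<^bsub>X\<^esub> a = a"
proof -
  interpret S: abelian_group_in "slice C X" "tangent_group C X" by (rule slice_group) fact
  let ?x = "\<pi> X \<cdot> a"
  have pz: "\<pi> X \<cdot> z = ?x" using assms by simp
  \<comment> \<open>In the slice over \<open>X\<close> the identity of \<open>X\<close> is terminal,
    and the unique arrow to it from \<open>?x\<close> is \<open>?x\<close> itself.\<close>
  have "to_terminal (slice C X) (gpt (tangent_group C X)) ?x = (?x, ?x, idt C X)"
  proof (rule S.terminal_ext[OF S.terminal S.to_terminal_Hom[OF S.terminal]])
    show "?x \<in> Obj (slice C X)" using assms by (simp add: slice_def)
    show "(?x, ?x, idt C X) \<in> Hom (slice C X) ?x (gpt (tangent_group C X))"
      using assms by (simp add: tangent_group_def Let_def Hom_def slice_def)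
  qed
  then have "S.gzero_at ?x = (?x, z, \<pi> X)"
    using assms by (simp add: tangent_group_def Let_def slice_def)
  then show 1: "a +\<^bsub>X\<^esub> z = a"
    using S.gplus_zero[OF slice_element[OF assms(1-3) refl]] assms pz by (simp add: slice_gplus)
  have "z +\<^bsub>X\<^esub> a = a +\<^bsub>X\<^esub> z" using assms pz by (intro tsum_comm) simp_all
  with 1 show "z +\<^bsub>X\<^esub> a = a" by simp
qed

lemma tsum_cancel:
  assumes "X \<in> Obj C" "a \<in> Arr C" "b \<in> Arr C" "c \<in> Arr C" "Cod C a = T X" "Cod C b = T X"
    and "Cod C c = T X" "Dom C b = Dom C a" "Dom C c = Dom C a" "\<pi> X \<cdot> a = \<pi> X \<cdot> b" "\<pi> X \<cdot> b = \<pi> X \<cdot> c"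
    and "a +\<^bsub>X\<^esub> c = b +\<^bsub>X\<^esub> c"
  shows "a = b"
proof -
  interpret S: abelian_group_in "slice C X" "tangent_group C X" by (rule slice_group) fact
  let ?x = "\<pi> X \<cdot> c"
  show ?thesis
    using S.gplus_cancel[of "(?x, a, \<pi> X)" ?x "(?x, b, \<pi> X)" "(?x, c, \<pi> X)"] assms
    by (simp add: slice_element slice_gplus)
qed

text \<open>In a group only zero is idempotent. The proofs that flip, lift and scalar multiplication
  produce zero vectors from zeros go through this.\<close>

lemma tsum_idem:
  assumes "X \<in> Obj C" "a \<in> Arr C" "Cod C a = T X" "a +\<^bsub>X\<^esub> a = a"
  shows "a = \<zeta> X \<cdot> \<pi> X \<cdot> a"
  using tsum_cancel[of X a "\<zeta> X \<cdot> \<pi> X \<cdot> a" a] tsum_zero(2)[OF assms(1-3) refl] assms by simp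

lemma tminus:
  assumes "X \<in> Obj C" "a \<in> Arr C" "b \<in> Arr C" "Cod C a = T X" "Cod C b = T X" "Dom C b = Dom C a"
    and "\<pi> X \<cdot> a = \<pi> X \<cdot> b" and d: "d = tminus C X \<cdot> T2pair C X a b"
  shows "d \<in> Arr C" "Dom C d = Dom C a" "Cod C d = T X" "\<pi> X \<cdot> d = \<pi> X \<cdot> b" "d +\<^bsub>X\<^esub> b = a"
proof -
  interpret S: abelian_group_in "slice C X" "tangent_group C X" by (rule slice_group) fact
  let ?G = "tangent_group C X" and ?x = "\<pi> X \<cdot> b" and ?s = "\<pi> X \<cdot> T2pr1 C X"
  \<comment> \<open>The difference is an arrow of the slice, hence a triple; \<open>m\<close> is the
    underlying morphism that \<open>tminus\<close> selects.\<close>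
  obtain p m q where pmq: "group_difference (slice C X) ?G = (p, m, q)" by (metis prod_cases3)
  have gd: "(p, m, q) \<in> Hom (slice C X) (gsq ?G) (gob ?G)"
    using S.group_difference_Hom unfolding pmq .
  then have m: "p = ?s" "q = \<pi> X" "m \<in> Arr C" "Dom C m = T2 C X" "Cod C m = T X" "\<pi> X \<cdot> m = ?s"
    using assms(1) by (simp_all add: tangent_group_def Let_def slice_Hom_iff)
  have d': "d = m \<cdot> T2pair C X a b" using d pmq by (simp add: tminus_def)
  show d_Arr: "d \<in> Arr C" "Dom C d = Dom C a" "Cod C d = T X" using assms(1-7) m d' by simp_all
  show pd: "\<pi> X \<cdot> d = \<pi> X \<cdot> b" using assms(1-7) m d' by (simp add: reassoc[OF m(6)])
  have "group_difference (slice C X) ?G \<cdot>\<^bsub>slice C X\<^esub>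
      pairing (slice C X) (gsq ?G) (gpr1 ?G) (gpr2 ?G) (?x, a, \<pi> X) (?x, b, \<pi> X) = (?x, d, \<pi> X)"
    using assms(1-7) slice_pairing[of X a b ?x] by (simp add: pmq m d')
  then have "gplus (slice C X) ?G (?x, d, \<pi> X) (?x, b, \<pi> X) = (?x, a, \<pi> X)"
    using S.gplus_difference[of "(?x, a, \<pi> X)" ?x "(?x, b, \<pi> X)"] assms(1-7)
    by (simp add: slice_element)
  then show "d +\<^bsub>X\<^esub> b = a" using assms(1-7) d_Arr pd by (simp add: slice_gplus)
qed

section \<open>Preservation of \<open>T\<^sub>2\<close> by the tangent functor\<close>

lemma fiber_power_tupling:
  assumes "is_fiber_power C k p P pr" "Y \<in> Obj C" "\<And>i. i < k \<Longrightarrow> a i \<in> Hom C Y (Dom C p)"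
    and "\<And>i j. i < k \<Longrightarrow> j < k \<Longrightarrow> p \<cdot> a i = p \<cdot> a j"
  shows "tupling C k P pr Y a \<in> Hom C Y P" "i < k \<Longrightarrow> pr i \<cdot> tupling C k P pr Y a = a i"
proof -
  have "\<exists>!h. h \<in> Hom C Y P \<and> (\<forall>i<k. pr i \<cdot> h = a i)"
    by (rule assms(1)[unfolded is_fiber_power_def, THEN conjunct2, THEN conjunct2, THEN conjunct2,
      THEN conjunct2, THEN bspec, OF assms(2), THEN spec, THEN mp, THEN mp])
      (use assms(3,4) in blast)+
  from theI'[OF this, folded tupling_def]
  show "tupling C k P pr Y a \<in> Hom C Y P" "i < k \<Longrightarrow> pr i \<cdot> tupling C k P pr Y a = a i"
    by auto
qed

lemma fiber_power_ext:
  assumes "is_fiber_power C k p P pr" "h \<in> Hom C Y P" "h' \<in> Hom C Y P"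
    and "\<And>i. i < k \<Longrightarrow> pr i \<cdot> h = pr i \<cdot> h'"
  shows "h = h'"
proof -
  have p: "p \<in> Arr C" and pr: "\<And>i. i < k \<Longrightarrow> pr i \<in> Hom C P (Dom C p)"
    and eq: "\<And>i j. i < k \<Longrightarrow> j < k \<Longrightarrow> p \<cdot> pr i = p \<cdot> pr j"
    using assms(1) unfolding is_fiber_power_def by blast+
  have Y: "Y \<in> Obj C" using assms(2) Dom_Cod_Obj(1)[of h] by (auto simp: Hom_def)
  have a: "pr i \<cdot> h' \<in> Hom C Y (Dom C p)" if "i < k" for i
    using pr[OF that] assms(3) cmp_Hom by blast
  have b: "p \<cdot> (pr i \<cdot> h') = p \<cdot> (pr j \<cdot> h')" if "i < k" "j < k" for i j
    using cmp_assoc[OF assms(3) pr Hom_Arr[OF p]] that eq by metis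
  have "\<exists>!h. h \<in> Hom C Y P \<and> (\<forall>i<k. pr i \<cdot> h = pr i \<cdot> h')"
    by (rule assms(1)[unfolded is_fiber_power_def, THEN conjunct2, THEN conjunct2, THEN conjunct2,
      THEN conjunct2, THEN bspec, OF Y, THEN spec, THEN mp, THEN mp]) (use a b in blast)+
  then show ?thesis using assms(2-4) by blast
qed

text \<open>The fiber power given by the axioms need not be \<open>T2 C X\<close>, so the comparison with it has
  to be transported through \<open>T\<close>.\<close>

lemma D_T2_pullback:
  assumes X: "X \<in> Obj C"
  shows "is_pullback C (D (\<pi> X)) (D (\<pi> X)) (T (T2 C X)) (D (T2pr1 C X)) (D (T2pr2 C X))"
proof -
  obtain P p Q q where P: "is_fiber_power C 2 (\<pi> X) P p" and Q: "is_fiber_power C 2 (D (\<pi> X)) Q q"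
    and iso: "is_iso C (tupling C 2 Q q (T P) (\<lambda>i. D (p i)))"
    using fiber_powers[OF X, of 2] by auto
  have less: "(0::nat) < 2" "(1::nat) < 2" by auto
  have [simp]: "P \<in> Obj C" "Q \<in> Obj C" using P Q unfolding is_fiber_power_def by blast+
  have p [simp]: "p i \<in> Arr C" "Dom C (p i) = P" "Cod C (p i) = T X" if "i < 2" for i
    using P X that unfolding is_fiber_power_def Hom_def by auto
  have q [simp]: "q i \<in> Arr C" "Dom C (q i) = Q" "Cod C (q i) = T (T X)" if "i < 2" for i
    using Q X that unfolding is_fiber_power_def Hom_def by auto
  have p_eq: "\<pi> X \<cdot> p i = \<pi> X \<cdot> p j" if "i < 2" "j < 2" for i j
    using P that unfolding is_fiber_power_def by blast
  \<comment> \<open>\<open>N\<close> is the comparison map of the axiom, with inverse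
    \<open>M\<close>; \<open>n\<close> and \<open>m\<close> below translate between the chosen
    \<open>T2 C X\<close> and the fiber power \<open>P\<close>.\<close>
  define N where "N = tupling C 2 Q q (T P) (\<lambda>i. D (p i))"
  have Dp_eq: "D (\<pi> X) \<cdot> D (p i) = D (\<pi> X) \<cdot> D (p j)" if "i < 2" "j < 2" for i j
    using arg_cong[OF p_eq[OF that], of D] that X by simp
  have N_Hom: "N \<in> Hom C (T P) Q" and N_pr: "i < 2 \<Longrightarrow> q i \<cdot> N = D (p i)" for i
    unfolding N_def
    by (rule fiber_power_tupling[OF Q]; (rule Dp_eq)?; simp add: X Hom_def)+
  have N [simp]: "N \<in> Arr C" "Dom C N = T P" "Cod C N = Q" using N_Hom by (auto simp: Hom_def)
  define M where "M = inv_arr C N"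
  have "is_inverse C N M" using inv_arr_inverse[OF iso] unfolding M_def N_def .
  then have M [simp]: "M \<in> Arr C" "Dom C M = Q" "Cod C M = T P" and MN: "M \<cdot> N = idt C (T P)"
    and NM: "N \<cdot> M = idt C Q" by (auto simp: is_inverse_def Hom_def)
  define n where "n = tupling C 2 P p (T2 C X) (\<lambda>i. if i = 0 then T2pr1 C X else T2pr2 C X)"
  have n_Hom: "n \<in> Hom C (T2 C X) P"
    and n_pr: "i < 2 \<Longrightarrow> p i \<cdot> n = (if i = 0 then T2pr1 C X else T2pr2 C X)" for i
    unfolding n_def by (rule fiber_power_tupling[OF P]; use X T2pr_eq in \<open>simp add: Hom_def\<close>)+
  have n [simp]: "n \<in> Arr C" "Dom C n = T2 C X" "Cod C n = P" using n_Hom by (auto simp: Hom_def)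
  define m where "m = T2pair C X (p 0) (p 1)"
  have m [simp]: "m \<in> Arr C" "Dom C m = P" "Cod C m = T2 C X" "T2pr1 C X \<cdot> m = p 0" "T2pr2 C X \<cdot> m = p 1"
    unfolding m_def using X less p_eq[OF less] by simp_all
  have mn: "m \<cdot> n = idt C (T2 C X)"
    using X n_pr[OF less(1)] n_pr[OF less(2)] reassoc[OF m(4) n(1)] reassoc[OF m(5) n(1)]
    by - (rule T2_ext[OF X], simp_all)
  show ?thesis
    unfolding is_pullback_def
  proof (intro conjI allI ballI impI)
    show "D (\<pi> X) \<cdot> D (T2pr1 C X) = D (\<pi> X) \<cdot> D (T2pr2 C X)"
      using X by (simp add: T2pr_eq flip: D_cmp)
    fix Y a b
    assume ab: "a \<in> Hom C Y (Dom C (D (\<pi> X)))" "b \<in> Hom C Y (Dom C (D (\<pi> X)))" "D (\<pi> X) \<cdot> a = D (\<pi> X) \<cdot> b"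
    then have [simp]: "a \<in> Arr C" "Dom C a = Y" "Cod C a = T (T X)" "b \<in> Arr C" "Dom C b = Y" "Cod C b = T (T X)"
      using X by (auto simp: Hom_def)
    have Y: "Y \<in> Obj C" using Dom_Cod_Obj(1)[of a] by simp
    define h where "h = tupling C 2 Q q Y (\<lambda>i. if i = 0 then a else b)"
    have h_Hom: "h \<in> Hom C Y Q" and h_pr: "i < 2 \<Longrightarrow> q i \<cdot> h = (if i = 0 then a else b)" for i
      unfolding h_def by (rule fiber_power_tupling[OF Q Y]; use X ab(3) in \<open>simp add: Hom_def\<close>)+
    have h [simp]: "h \<in> Arr C" "Dom C h = Y" "Cod C h = Q" using h_Hom by (auto simp: Hom_def)
    have Dp: "D (p i) \<cdot> M \<cdot> h = (if i = 0 then a else b)" if "i < 2" for i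
    proof -
      have "D (p i) \<cdot> M \<cdot> h = q i \<cdot> (N \<cdot> M) \<cdot> h"
        using that by (simp flip: N_pr[OF that])
      then show ?thesis using h_pr[OF that] NM that by simp
    qed
    have Dm: "D (T2pr1 C X) \<cdot> D m = D (p 0)" "D (T2pr2 C X) \<cdot> D m = D (p 1)"
      using X by (simp_all flip: D_cmp)
    \<comment> \<open>Existence: lift \<open>a\<close> and \<open>b\<close> to \<open>Q\<close>,
      return to \<open>T P\<close> along \<open>M\<close>, and transport to
      \<open>T (T2 C X)\<close> by \<open>D m\<close>.\<close>
    have ex: "D m \<cdot> M \<cdot> h \<in> Hom C Y (T (T2 C X))" "D (T2pr1 C X) \<cdot> D m \<cdot> M \<cdot> h = a"
      "D (T2pr2 C X) \<cdot> D m \<cdot> M \<cdot> h = b"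
      using X Dp[OF less(1)] Dp[OF less(2)] by (simp_all add: reassoc[OF Dm(1)] reassoc[OF Dm(2)] Hom_def)
    \<comment> \<open>Uniqueness: the two projections fix \<open>N \<cdot> D n \<cdot> k\<close>,
      and \<open>D m \<cdot> M\<close> is a left inverse of \<open>N \<cdot> D n\<close> because
      \<open>M \<cdot> N\<close> and \<open>m \<cdot> n\<close> are identities.\<close>
    have un: "k = k'" if k: "k \<in> Hom C Y (T (T2 C X))" "k' \<in> Hom C Y (T (T2 C X))"
      "D (T2pr1 C X) \<cdot> k = D (T2pr1 C X) \<cdot> k'" "D (T2pr2 C X) \<cdot> k = D (T2pr2 C X) \<cdot> k'" for k k'
    proof -
      have [simp]: "k \<in> Arr C" "Dom C k = Y" "Cod C k = T (T2 C X)" "k' \<in> Arr C" "Dom C k' = Y"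
        "Cod C k' = T (T2 C X)" using k by (auto simp: Hom_def)
      have qN: "q i \<cdot> N \<cdot> D n \<cdot> l = D (if i = 0 then T2pr1 C X else T2pr2 C X) \<cdot> l"
        if "i < 2" "l \<in> Arr C" "Cod C l = T (T2 C X)" for i l
      proof -
        have "q i \<cdot> N \<cdot> D n \<cdot> l = (q i \<cdot> N) \<cdot> D n \<cdot> l" using that by simp
        also have "\<dots> = D (p i \<cdot> n) \<cdot> l" using that X by (simp add: N_pr)
        finally show ?thesis using n_pr[OF that(1)] by simp
      qed
      have "N \<cdot> D n \<cdot> k = N \<cdot> D n \<cdot> k'"
        by (rule fiber_power_ext[OF Q]) (use X k qN in \<open>auto simp: Hom_def\<close>)
      then have "(M \<cdot> N) \<cdot> D n \<cdot> k = (M \<cdot> N) \<cdot> D n \<cdot> k'" using X by simp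
      then have "D m \<cdot> D n \<cdot> k = D m \<cdot> D n \<cdot> k'" unfolding MN using X by simp
      then have "D (m \<cdot> n) \<cdot> k = D (m \<cdot> n) \<cdot> k'" using X by simp
      then show ?thesis unfolding mn using X by simp
    qed
    show "\<exists>!h. h \<in> Hom C Y (T (T2 C X)) \<and> D (T2pr1 C X) \<cdot> h = a \<and> D (T2pr2 C X) \<cdot> h = b"
      using ex un by (intro ex1I[of _ "D m \<cdot> M \<cdot> h"]) auto
  qed (use X in \<open>simp_all add: Hom_def\<close>)
qed

section \<open>Flip and vertical lift on sums and zeros\<close>

lemma proj_flip_cmp [simp]:
  "X \<in> Obj C \<Longrightarrow> \<pi> (T X) \<cdot> \<tau> X = D (\<pi> X)"
  "X \<in> Obj C \<Longrightarrow> h \<in> Arr C \<Longrightarrow> Cod C h = T (T X) \<Longrightarrow> \<pi> (T X) \<cdot> \<tau> X \<cdot> h = D (\<pi> X) \<cdot> h"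
  by (simp_all add: proj_flip reassoc[OF proj_flip])

lemma flip_flip_cmp [simp]:
  "X \<in> Obj C \<Longrightarrow> h \<in> Arr C \<Longrightarrow> Cod C h = T (T X) \<Longrightarrow> \<tau> X \<cdot> \<tau> X \<cdot> h = h"
  by (simp add: reassoc[OF flip_flip])

lemma Dproj_flip [simp]:
  assumes "X \<in> Obj C"
  shows "D (\<pi> X) \<cdot> \<tau> X = \<pi> (T X)"
proof -
  have "D (\<pi> X) \<cdot> \<tau> X = \<pi> (T X) \<cdot> \<tau> X \<cdot> \<tau> X" using assms by (simp del: flip_flip_cmp)
  then show ?thesis using assms by (simp add: flip_flip del: proj_flip_cmp)
qed

lemma Dproj_flip_cmp [simp]:
  "X \<in> Obj C \<Longrightarrow> h \<in> Arr C \<Longrightarrow> Cod C h = T (T X) \<Longrightarrow> D (\<pi> X) \<cdot> \<tau> X \<cdot> h = \<pi> (T X) \<cdot> h"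
  by (simp add: reassoc[OF Dproj_flip])

text \<open>By \<open>D_T2_pullback\<close> the axiom may be used with \<open>T (T2 C X)\<close>
  itself as fiber product; the comparison map is then the identity and its inverse drops
  out.\<close>

lemma flip_Dtplus:
  assumes X: "X \<in> Obj C"
  shows "\<tau> X \<cdot> D (tplus C X) = (\<tau> X \<cdot> D (T2pr1 C X)) +\<^bsub>T X\<^esub> (\<tau> X \<cdot> D (T2pr2 C X))"
proof -
  note pb = D_T2_pullback[OF X]
  have pr: "D (T2pr1 C X) \<in> Hom C (T (T2 C X)) (Dom C (D (\<pi> X)))"
    "D (T2pr2 C X) \<in> Hom C (T (T2 C X)) (Dom C (D (\<pi> X)))"
    "D (\<pi> X) \<cdot> D (T2pr1 C X) = D (\<pi> X) \<cdot> D (T2pr2 C X)"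
    using pb unfolding is_pullback_def by blast+
  note p = pullback_pairing[OF pb pr]
  have "pairing C (T (T2 C X)) (D (T2pr1 C X)) (D (T2pr2 C X)) (D (T2pr1 C X)) (D (T2pr2 C X)) =
      idt C (T (T2 C X))"
    by (rule pullback_ext[OF pb p(1)]) (use p X in \<open>simp_all add: Hom_def\<close>)
  from flip_plus[OF X pb this[symmetric]] show ?thesis
    using X by (simp add: vf_add_def inv_arr_idt)
qed

lemma flip_Dtplus_cmp:
  assumes X: "X \<in> Obj C" "h \<in> Arr C" "Cod C h = T (T2 C X)"
  shows "\<tau> X \<cdot> D (tplus C X) \<cdot> h = (\<tau> X \<cdot> D (T2pr1 C X) \<cdot> h) +\<^bsub>T X\<^esub> (\<tau> X \<cdot> D (T2pr2 C X) \<cdot> h)"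
proof -
  have "D (\<pi> X) \<cdot> D (T2pr1 C X) = D (\<pi> X) \<cdot> D (T2pr2 C X)"
    using X by (simp add: T2pr_eq flip: D_cmp)
  then show ?thesis using X by (subst reassoc[OF flip_Dtplus]) (simp_all add: tsum_cmp)
qed

text \<open>The tangent of a sum is a sum for the addition along \<open>D (\<pi> X)\<close>, not for
  the fiberwise one of \<open>T (T X)\<close> over \<open>T X\<close>; the flip turns the former
  into the latter.\<close>

lemma flip_D_tsum:
  assumes "X \<in> Obj C" "a \<in> Arr C" "b \<in> Arr C" "Cod C a = T X" "Cod C b = T X" "Dom C b = Dom C a"
    and "\<pi> X \<cdot> a = \<pi> X \<cdot> b" "h \<in> Arr C" "Cod C h = T (Dom C a)"
  shows "\<tau> X \<cdot> D (a +\<^bsub>X\<^esub> b) \<cdot> h = (\<tau> X \<cdot> D a \<cdot> h) +\<^bsub>T X\<^esub> (\<tau> X \<cdot> D b \<cdot> h)"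
proof -
  let ?p = "T2pair C X a b"
  have "D (T2pr1 C X) \<cdot> D ?p = D a" "D (T2pr2 C X) \<cdot> D ?p = D b"
    using assms by (simp_all flip: D_cmp)
  from reassoc[OF this(1), of h] reassoc[OF this(2), of h] show ?thesis
    using assms by (simp add: vf_add_def[of C X a b] flip_Dtplus_cmp)
qed

lemma tsum_zeros [simp]: "X \<in> Obj C \<Longrightarrow> \<zeta> X +\<^bsub>X\<^esub> \<zeta> X = \<zeta> X"
  using tsum_zero(1)[of X "\<zeta> X" "\<zeta> X"] by simp

text \<open>Since \<open>\<zeta> X\<close> is its own double, \<open>flip_D_tsum\<close> makes
  \<open>\<tau> X \<cdot> D (\<zeta> X)\<close> idempotent, hence a zero vector.\<close>

lemma flip_D_zero [simp]:
  assumes X: "X \<in> Obj C"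
  shows "\<tau> X \<cdot> D (\<zeta> X) = \<zeta> (T X)"
proof -
  have "(\<tau> X \<cdot> D (\<zeta> X)) +\<^bsub>T X\<^esub> (\<tau> X \<cdot> D (\<zeta> X)) = \<tau> X \<cdot> D (\<zeta> X)"
    using flip_D_tsum[of X "\<zeta> X" "\<zeta> X" "idt C (T X)"] X by simp
  moreover have "D (\<pi> X) \<cdot> D (\<zeta> X) = idt C (T X)"
    using X by (simp flip: D_cmp)
  ultimately show ?thesis using tsum_idem[of "T X" "\<tau> X \<cdot> D (\<zeta> X)"] X by simp
qed

lemma flip_zero_cmp [simp]:
  assumes X: "X \<in> Obj C" "h \<in> Arr C" "Cod C h = T X"
  shows "\<tau> X \<cdot> \<zeta> (T X) \<cdot> h = D (\<zeta> X) \<cdot> h"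
proof -
  have "\<tau> X \<cdot> \<zeta> (T X) = D (\<zeta> X)" using X by (simp flip: flip_D_zero)
  from reassoc[OF this] show ?thesis using X by simp
qed

text \<open>The same idempotence argument, with \<open>lift_plus\<close> as the source of
  additivity.\<close>

lemma lift_zero [simp]:
  assumes X: "X \<in> Obj C"
  shows "\<Lambda> X \<cdot> \<zeta> X = \<zeta> (T X) \<cdot> \<zeta> X"
proof -
  let ?p = "T2pair C X (\<zeta> X) (\<zeta> X)"
  have ok: "\<pi> (T X) \<cdot> \<Lambda> X \<cdot> T2pr1 C X = \<pi> (T X) \<cdot> \<Lambda> X \<cdot> T2pr2 C X"
    using X T2pr_eq by (simp add: reassoc[OF proj_lift])
  have "\<Lambda> X \<cdot> \<zeta> X = (\<Lambda> X \<cdot> tplus C X) \<cdot> ?p"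
    using X tsum_zeros[OF X] by (simp add: vf_add_def)
  also have "\<dots> = ((\<Lambda> X \<cdot> T2pr1 C X) +\<^bsub>T X\<^esub> (\<Lambda> X \<cdot> T2pr2 C X)) \<cdot> ?p"
    by (simp only: lift_plus[OF X, symmetric] vf_add_def)
  also have "\<dots> = (\<Lambda> X \<cdot> \<zeta> X) +\<^bsub>T X\<^esub> (\<Lambda> X \<cdot> \<zeta> X)"
    using X ok by (simp add: tsum_cmp)
  finally show ?thesis
    using tsum_idem[of "T X" "\<Lambda> X \<cdot> \<zeta> X"] X by (simp add: reassoc[OF proj_lift])
qed

lemma lift2_T2pair:
  assumes "X \<in> Obj C" "a \<in> Arr C" "b \<in> Arr C" "Cod C a = T X" "Cod C b = T X" "Dom C b = Dom C a"
    and "\<pi> X \<cdot> a = \<pi> X \<cdot> b"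
  shows "tlift2 C X \<cdot> T2pair C X a b = \<tau> X \<cdot> ((D (\<zeta> X) \<cdot> a) +\<^bsub>T X\<^esub> (\<Lambda> X \<cdot> b))"
proof -
  have ok: "\<pi> (T X) \<cdot> D (\<zeta> X) \<cdot> T2pr1 C X = \<pi> (T X) \<cdot> \<Lambda> X \<cdot> T2pr2 C X"
    using assms(1) T2pr_eq by (simp add: reassoc[OF proj_lift])
  show ?thesis using assms ok by (simp add: tlift2_def vf_add_def T2pair_cmp)
qed

section \<open>Vector fields and their bracket\<close>

lemma vector_field:
  assumes "v \<in> vector_fields C X"
  shows "v \<in> Arr C" "Dom C v = X" "Cod C v = T X" "\<pi> X \<cdot> v = idt C X"
  using assms by (auto simp: vector_fields_def Hom_def)

lemma vector_field_Obj: "v \<in> vector_fields C X \<Longrightarrow> X \<in> Obj C"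
  using Dom_Cod_Obj(1)[of v] by (simp add: vector_field)

text \<open>The flip is what gives both second-order vectors the common base point \<open>w\<close>:
  \<open>D v \<cdot> w\<close> itself lies over \<open>v\<close>.\<close>

lemma vf_delta:
  assumes v: "v \<in> vector_fields C X" and w: "w \<in> vector_fields C X"
  defines "\<delta> \<equiv> vf_delta C X v w"
  shows "\<delta> \<in> Arr C" "Dom C \<delta> = X" "Cod C \<delta> = T (T X)" "\<pi> (T X) \<cdot> \<delta> = w"
    "\<delta> +\<^bsub>T X\<^esub> (\<tau> X \<cdot> D v \<cdot> w) = D w \<cdot> v"
proof -
  note X = vector_field_Obj[OF v]
  note [simp] = vector_field[OF v] vector_field[OF w]
  have Dv: "D (\<pi> X) \<cdot> D v = idt C (T X)"
    using X by (simp flip: D_cmp)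
  note m = tminus[of "T X" "D w \<cdot> v" "\<tau> X \<cdot> D v \<cdot> w" \<delta>]
  from m show "\<delta> \<in> Arr C" "Dom C \<delta> = X" "Cod C \<delta> = T (T X)" "\<pi> (T X) \<cdot> \<delta> = w"
    "\<delta> +\<^bsub>T X\<^esub> (\<tau> X \<cdot> D v \<cdot> w) = D w \<cdot> v"
    using X v w by (simp_all add: \<delta>_def vf_delta_def reassoc[OF Dv])
qed

text \<open>Justifies the \<open>THE\<close> in \<open>vf_bracket\<close>. Flipping the difference
  and subtracting \<open>D (\<zeta> X) \<cdot> w\<close> leaves a vector whose two projections are
  both zero, and by \<open>lift_pullback\<close> it is the lift of a unique vector field.\<close>

lemma vf_delta_factors:
  assumes v: "v \<in> vector_fields C X" and w: "w \<in> vector_fields C X"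
  shows "\<exists>!u. u \<in> vector_fields C X \<and> vf_delta C X v w = tlift2 C X \<cdot> T2pair C X w u"
proof -
  note X = vector_field_Obj[OF v]
  define \<delta> where "\<delta> = vf_delta C X v w"
  note [simp] = vf_delta(1-4)[OF v w, folded \<delta>_def]
  let ?b = "D (\<zeta> X) \<cdot> w"
  note [simp] = X vector_field[OF v] vector_field[OF w]
  have Dw: "D (\<pi> X) \<cdot> D w = idt C (T X)"
    by (simp flip: D_cmp)
  have D\<zeta>: "D (\<pi> X) \<cdot> D (\<zeta> X) = idt C (T X)"
    by (simp flip: D_cmp)
  have Dv: "D (\<pi> X) \<cdot> D v = idt C (T X)"
    by (simp flip: D_cmp)
  \<comment> \<open>Both terms of the difference project to \<open>v\<close> under
    \<open>D (\<pi> X)\<close>, so \<open>\<delta>\<close> projects to zero. This also puts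
    \<open>\<tau> X \<cdot> \<delta>\<close> over \<open>\<zeta> X\<close>, the base point of
    \<open>?b\<close>, so that the two may be subtracted.\<close>
  have D\<delta>: "D (\<pi> X) \<cdot> \<delta> = \<zeta> X"
  proof (rule tsum_cancel[of X _ _ v])
    have "(D (\<pi> X) \<cdot> \<delta>) +\<^bsub>X\<^esub> v = D (\<pi> X) \<cdot> (\<delta> +\<^bsub>T X\<^esub> (\<tau> X \<cdot> D v \<cdot> w))"
      by (subst D_tsum) (simp_all add: reassoc[OF Dv])
    also have "\<dots> = v"
      unfolding \<delta>_def vf_delta(5)[OF v w] by (simp add: reassoc[OF Dw])
    also have "v = \<zeta> X +\<^bsub>X\<^esub> v" using tsum_zero(2)[of X v "\<zeta> X"] by simp
    finally show "(D (\<pi> X) \<cdot> \<delta>) +\<^bsub>X\<^esub> v = \<zeta> X +\<^bsub>X\<^esub> v" .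
  qed simp_all
  \<comment> \<open>The equation to solve is
    \<open>\<tau> X \<cdot> \<delta> = ?b + \<Lambda> X \<cdot> u\<close>, so \<open>z\<close> is
    the value that \<open>\<Lambda> X \<cdot> u\<close> must take.\<close>
  define z where "z = tminus C (T X) \<cdot> T2pair C (T X) (\<tau> X \<cdot> \<delta>) ?b"
  have z [simp]: "z \<in> Arr C" "Dom C z = X" "Cod C z = T (T X)" "\<pi> (T X) \<cdot> z = \<zeta> X"
    and zb: "z +\<^bsub>T X\<^esub> ?b = \<tau> X \<cdot> \<delta>"
    using tminus[OF _ _ _ _ _ _ _ z_def] by (simp_all add: D\<delta>)
  have Dz: "D (\<pi> X) \<cdot> z = \<zeta> X"
  proof (rule tsum_cancel[of X _ _ w])
    have "(D (\<pi> X) \<cdot> z) +\<^bsub>X\<^esub> w = D (\<pi> X) \<cdot> (z +\<^bsub>T X\<^esub> ?b)"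
      by (subst D_tsum) (simp_all add: reassoc[OF D\<zeta>])
    also have "\<dots> = w" by (simp add: zb)
    also have "w = \<zeta> X +\<^bsub>X\<^esub> w" using tsum_zero(2)[of X w "\<zeta> X"] by simp
    finally show "(D (\<pi> X) \<cdot> z) +\<^bsub>X\<^esub> w = \<zeta> X +\<^bsub>X\<^esub> w" .
  qed simp_all
  have pb_eq: "T2pair C X (\<pi> (T X)) (D (\<pi> X)) \<cdot> z = T2pair C X (\<zeta> X) (\<zeta> X) \<cdot> idt C X"
    using Dz by (simp add: T2pair_cmp)
  have zi: "z \<in> Hom C X (Dom C (T2pair C X (\<pi> (T X)) (D (\<pi> X))))"
    "idt C X \<in> Hom C X (Dom C (T2pair C X (\<zeta> X) (\<zeta> X)))"
    by (simp_all add: Hom_def)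
  define u where "u = pairing C (T X) (\<Lambda> X) (\<pi> X) z (idt C X)"
  have u: "u \<in> vector_fields C X" "\<Lambda> X \<cdot> u = z"
    using pullback_pairing[OF lift_pullback[OF X] zi pb_eq, folded u_def]
    by (simp_all add: vector_fields_def)
  \<comment> \<open>\<open>tlift2\<close> puts \<open>?b\<close> first, the difference puts it
    last.\<close>
  have comm: "?b +\<^bsub>T X\<^esub> z' = z' +\<^bsub>T X\<^esub> ?b"
    if "z' \<in> Arr C" "Dom C z' = X" "Cod C z' = T (T X)" "\<pi> (T X) \<cdot> z' = \<zeta> X" for z'
    using that by (intro tsum_comm) simp_all
  show ?thesis
  proof (intro ex1I[of _ u] conjI)
    note [simp] = vector_field[OF u(1)]
    show "vf_delta C X v w = tlift2 C X \<cdot> T2pair C X w u"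
      using u by (simp add: lift2_T2pair comm zb flip: \<delta>_def)
  next
    fix u' assume u': "u' \<in> vector_fields C X \<and> vf_delta C X v w = tlift2 C X \<cdot> T2pair C X w u'"
    then have u'_vf: "u' \<in> vector_fields C X" by blast
    note [simp] = vector_field[OF u'_vf]
    have pl: "\<pi> (T X) \<cdot> \<Lambda> X \<cdot> u' = \<zeta> X" by (simp add: reassoc[OF proj_lift])
    have "\<delta> = \<tau> X \<cdot> ((\<Lambda> X \<cdot> u') +\<^bsub>T X\<^esub> ?b)"
      using u' by (simp add: lift2_T2pair comm pl flip: \<delta>_def)
    then have "\<tau> X \<cdot> \<delta> = (\<Lambda> X \<cdot> u') +\<^bsub>T X\<^esub> ?b" by (simp add: pl)
    then have "(\<Lambda> X \<cdot> u') +\<^bsub>T X\<^esub> ?b = z +\<^bsub>T X\<^esub> ?b" using zb by simp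
    then have "\<Lambda> X \<cdot> u' = z" by (rule tsum_cancel[rotated -1]) (simp_all add: pl)
    then show "u' = u"
      using u vector_field[OF u(1)] by - (rule pullback_ext[OF lift_pullback[OF X], of u' X u], simp_all add: Hom_def)
  qed (fact u)
qed

text \<open>The flip is moved to the side of \<open>vf_delta\<close>, because second derivatives of
  functions into \<open>R\<close> turn out to be invariant under it.\<close>

lemma vf_bracket:
  assumes v: "v \<in> vector_fields C X" and w: "w \<in> vector_fields C X"
  shows "vf_bracket C X v w \<in> vector_fields C X"
    and "\<tau> X \<cdot> vf_delta C X v w = (D (\<zeta> X) \<cdot> w) +\<^bsub>T X\<^esub> (\<Lambda> X \<cdot> vf_bracket C X v w)"
proof -
  let ?u = "vf_bracket C X v w"
  note X = vector_field_Obj[OF v]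
  have u: "?u \<in> vector_fields C X" "vf_delta C X v w = tlift2 C X \<cdot> T2pair C X w ?u"
    using theI'[OF vf_delta_factors[OF v w], folded vf_bracket_def] by auto
  show "?u \<in> vector_fields C X" by (fact u)
  show "\<tau> X \<cdot> vf_delta C X v w = (D (\<zeta> X) \<cdot> w) +\<^bsub>T X\<^esub> (\<Lambda> X \<cdot> ?u)"
    using u X vector_field[OF w] vector_field[OF u(1)]
    by (simp add: lift2_T2pair reassoc[OF proj_lift])
qed

end

section \<open>Cartesian tangent categories\<close>

context cartesian_tangent_category
begin

section \<open>Products and their tangent bundles\<close>

lemma Prd_Arr [simp]:
  assumes "A \<in> Obj C" "B \<in> Obj C"
  shows "pr1 C A B \<in> Arr C" "Dom C (pr1 C A B) = Prd C A B" "Cod C (pr1 C A B) = A"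
    and "pr2 C A B \<in> Arr C" "Dom C (pr2 C A B) = Prd C A B" "Cod C (pr2 C A B) = B"
  using Prd_product[OF assms] unfolding is_product_def Hom_def by auto

lemma Prd_Obj [simp]: "A \<in> Obj C \<Longrightarrow> B \<in> Obj C \<Longrightarrow> Prd C A B \<in> Obj C"
  using Prd_Arr Dom_Obj by metis

lemma cpair_Arr [simp]:
  assumes "a \<in> Arr C" "b \<in> Arr C" "Dom C b = Dom C a"
  shows "\<langle>a, b\<rangle> \<in> Arr C" "Dom C \<langle>a, b\<rangle> = Dom C a" "Cod C \<langle>a, b\<rangle> = Prd C (Cod C a) (Cod C b)"
    and "Cod C a = A \<Longrightarrow> Cod C b = B \<Longrightarrow> pr1 C A B \<cdot> \<langle>a, b\<rangle> = a"
    and "Cod C a = A \<Longrightarrow> Cod C b = B \<Longrightarrow> pr2 C A B \<cdot> \<langle>a, b\<rangle> = b"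
  using product_pairing[OF Prd_product, of "Cod C a" "Cod C b" a "Dom C a" b] assms
  by (auto simp: cpair_def Hom_def)

lemma Prd_ext:
  assumes "A \<in> Obj C" "B \<in> Obj C" "h \<in> Arr C" "k \<in> Arr C" "Cod C h = Prd C A B" "Cod C k = Prd C A B"
    and "Dom C k = Dom C h" "pr1 C A B \<cdot> h = pr1 C A B \<cdot> k" "pr2 C A B \<cdot> h = pr2 C A B \<cdot> k"
  shows "h = k"
  using product_ext[OF Prd_product[OF assms(1,2)], of h "Dom C h" k] assms by (simp add: Hom_def)

lemma pr_cpair_cmp [simp]:
  assumes "a \<in> Arr C" "b \<in> Arr C" "Dom C b = Dom C a" "Cod C a = A" "Cod C b = B"
    and "h \<in> Arr C" "Cod C h = Dom C a"
  shows "pr1 C A B \<cdot> \<langle>a, b\<rangle> \<cdot> h = a \<cdot> h" "pr2 C A B \<cdot> \<langle>a, b\<rangle> \<cdot> h = b \<cdot> h"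
  using assms by (auto simp: reassoc[OF cpair_Arr(4)] reassoc[OF cpair_Arr(5)])

lemma cpair_cmp [simp]:
  assumes "a \<in> Arr C" "b \<in> Arr C" "Dom C b = Dom C a" "h \<in> Arr C" "Cod C h = Dom C a"
  shows "\<langle>a, b\<rangle> \<cdot> h = \<langle>a \<cdot> h, b \<cdot> h\<rangle>"
  by (rule Prd_ext[of "Cod C a" "Cod C b"]) (use assms in simp_all)

lemma cprod_Arr [simp]:
  assumes "f \<in> Arr C" "g \<in> Arr C"
  shows "f \<boxtimes> g \<in> Arr C" "Dom C (f \<boxtimes> g) = Prd C (Dom C f) (Dom C g)"
    "Cod C (f \<boxtimes> g) = Prd C (Cod C f) (Cod C g)"
  using assms by (simp_all add: cprod_def)

lemma cprod_cpair [simp]: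
  assumes "f \<in> Arr C" "g \<in> Arr C" "a \<in> Arr C" "b \<in> Arr C" "Dom C b = Dom C a"
    and "Cod C a = Dom C f" "Cod C b = Dom C g"
  shows "(f \<boxtimes> g) \<cdot> \<langle>a, b\<rangle> = \<langle>f \<cdot> a, g \<cdot> b\<rangle>"
  using assms by (simp add: cprod_def)

text \<open>The element of \<open>T (A \<times> B)\<close> with components \<open>a\<close> and
  \<open>b\<close>. Together with \<open>D_Prd_ext\<close> it exhibits
  \<open>T (A \<times> B)\<close> as a product with projections \<open>D (pr1 C A B)\<close> and
  \<open>D (pr2 C A B)\<close>; this is how \<open>chi_iso\<close> gets used.\<close>

definition Dpair :: "'o \<Rightarrow> 'o \<Rightarrow> 'm \<Rightarrow> 'm \<Rightarrow> 'm" where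
  "Dpair A B a b = inv_arr C (chi C A B) \<cdot> \<langle>a, b\<rangle>"

lemma chi_inverse:
  assumes "A \<in> Obj C" "B \<in> Obj C"
  shows "inv_arr C (chi C A B) \<in> Arr C" "Dom C (inv_arr C (chi C A B)) = Prd C (T A) (T B)"
    "Cod C (inv_arr C (chi C A B)) = T (Prd C A B)"
    and "chi C A B \<cdot> inv_arr C (chi C A B) = idt C (Prd C (T A) (T B))"
    and "inv_arr C (chi C A B) \<cdot> chi C A B = idt C (T (Prd C A B))"
  using inv_arr_inverse[OF chi_iso[OF assms]] assms by (auto simp: is_inverse_def Hom_def chi_def)

lemma D_Prd_ext:
  assumes "A \<in> Obj C" "B \<in> Obj C" "h \<in> Arr C" "k \<in> Arr C"
    and "Cod C h = T (Prd C A B)" "Cod C k = T (Prd C A B)" "Dom C k = Dom C h"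
    and "D (pr1 C A B) \<cdot> h = D (pr1 C A B) \<cdot> k" "D (pr2 C A B) \<cdot> h = D (pr2 C A B) \<cdot> k"
  shows "h = k"
proof -
  have "chi C A B \<cdot> h = chi C A B \<cdot> k" using assms by (simp add: chi_def)
  then have "inv_arr C (chi C A B) \<cdot> chi C A B \<cdot> h = inv_arr C (chi C A B) \<cdot> chi C A B \<cdot> k" by simp
  moreover have "chi C A B \<in> Arr C" "Dom C (chi C A B) = T (Prd C A B)"
    "Cod C (chi C A B) = Prd C (T A) (T B)" using assms by (simp_all add: chi_def)
  ultimately show ?thesis
    using assms reassoc[OF chi_inverse(5)[OF assms(1,2)]] by (simp add: chi_inverse)
qed

lemma Dpair_Arr [simp]:
  assumes "A \<in> Obj C" "B \<in> Obj C" "a \<in> Arr C" "b \<in> Arr C" "Cod C a = T A" "Cod C b = T B" "Dom C b = Dom C a"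
  shows "Dpair A B a b \<in> Arr C" "Dom C (Dpair A B a b) = Dom C a"
    "Cod C (Dpair A B a b) = T (Prd C A B)"
    and "D (pr1 C A B) \<cdot> Dpair A B a b = a" "D (pr2 C A B) \<cdot> Dpair A B a b = b"
proof -
  have c: "chi C A B \<in> Arr C" "Dom C (chi C A B) = T (Prd C A B)"
    "Cod C (chi C A B) = Prd C (T A) (T B)" using assms by (simp_all add: chi_def)
  show p: "Dpair A B a b \<in> Arr C" "Dom C (Dpair A B a b) = Dom C a"
    "Cod C (Dpair A B a b) = T (Prd C A B)"
    using assms by (simp_all add: Dpair_def chi_inverse)
  have "chi C A B \<cdot> Dpair A B a b = \<langle>a, b\<rangle>"
    unfolding Dpair_def using assms c by (simp add: reassoc[OF chi_inverse(4)] chi_inverse)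
  then have "\<langle>D (pr1 C A B) \<cdot> Dpair A B a b, D (pr2 C A B) \<cdot> Dpair A B a b\<rangle> = \<langle>a, b\<rangle>"
    using assms p by (simp add: chi_def)
  from arg_cong[OF this, of "\<lambda>x. pr1 C (T A) (T B) \<cdot> x"] arg_cong[OF this, of "\<lambda>x. pr2 C (T A) (T B) \<cdot> x"]
  show "D (pr1 C A B) \<cdot> Dpair A B a b = a" "D (pr2 C A B) \<cdot> Dpair A B a b = b"
    using assms p by simp_all
qed

lemma Dpr_Dpair_cmp [simp]:
  assumes "A \<in> Obj C" "B \<in> Obj C" "a \<in> Arr C" "b \<in> Arr C" "Cod C a = T A" "Cod C b = T B" "Dom C b = Dom C a"
    and "h \<in> Arr C" "Cod C h = Dom C a"
  shows "D (pr1 C A B) \<cdot> Dpair A B a b \<cdot> h = a \<cdot> h" "D (pr2 C A B) \<cdot> Dpair A B a b \<cdot> h = b \<cdot> h"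
  using assms by (auto simp: reassoc[OF Dpair_Arr(4)] reassoc[OF Dpair_Arr(5)])

lemma Dpair_cmp [simp]:
  assumes "A \<in> Obj C" "B \<in> Obj C" "a \<in> Arr C" "b \<in> Arr C" "Cod C a = T A" "Cod C b = T B" "Dom C b = Dom C a"
    and "h \<in> Arr C" "Cod C h = Dom C a"
  shows "Dpair A B a b \<cdot> h = Dpair A B (a \<cdot> h) (b \<cdot> h)"
  by (rule D_Prd_ext[of A B]) (use assms in simp_all)

lemma Dpair_Dpr:
  assumes "A \<in> Obj C" "B \<in> Obj C" "Z \<in> Arr C" "Cod C Z = T (Prd C A B)"
  shows "Dpair A B (D (pr1 C A B) \<cdot> Z) (D (pr2 C A B) \<cdot> Z) = Z"
  by (rule D_Prd_ext[of A B]) (use assms in simp_all)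

lemma D_cpair:
  assumes "f \<in> Arr C" "g \<in> Arr C" "Dom C g = Dom C f" "h \<in> Arr C" "Cod C h = T (Dom C f)"
  shows "D \<langle>f, g\<rangle> \<cdot> h = Dpair (Cod C f) (Cod C g) (D f \<cdot> h) (D g \<cdot> h)"
proof -
  have e: "D (pr1 C (Cod C f) (Cod C g)) \<cdot> D \<langle>f, g\<rangle> = D f" "D (pr2 C (Cod C f) (Cod C g)) \<cdot> D \<langle>f, g\<rangle> = D g"
    using assms by (simp_all flip: D_cmp)
  show ?thesis
    by (rule D_Prd_ext[of "Cod C f" "Cod C g"]) (use assms in \<open>simp_all add: reassoc[OF e(1)] reassoc[OF e(2)]\<close>)
qed

lemma proj_Dpair [simp]:
  assumes "A \<in> Obj C" "B \<in> Obj C" "a \<in> Arr C" "b \<in> Arr C" "Cod C a = T A" "Cod C b = T B" "Dom C b = Dom C a"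
  shows "\<pi> (Prd C A B) \<cdot> Dpair A B a b = \<langle>\<pi> A \<cdot> a, \<pi> B \<cdot> b\<rangle>"
proof -
  let ?z = "Dpair A B a b"
  have "\<pi> A \<cdot> D (pr1 C A B) \<cdot> ?z = pr1 C A B \<cdot> \<pi> (Prd C A B) \<cdot> ?z"
    "\<pi> B \<cdot> D (pr2 C A B) \<cdot> ?z = pr2 C A B \<cdot> \<pi> (Prd C A B) \<cdot> ?z"
    using assms by (simp_all del: Dpair_Arr(4,5))
  then show ?thesis by - (rule Prd_ext[of A B], use assms in simp_all)
qed

lemma zero_cpair:
  assumes "x \<in> Arr C" "y \<in> Arr C" "Dom C y = Dom C x" "Cod C x = A" "Cod C y = B"
  shows "\<zeta> (Prd C A B) \<cdot> \<langle>x, y\<rangle> = Dpair A B (\<zeta> A \<cdot> x) (\<zeta> B \<cdot> y)"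
proof -
  have [simp]: "A \<in> Obj C" "B \<in> Obj C" using assms by auto
  show ?thesis by (rule D_Prd_ext[of A B]) (use assms in simp_all)
qed

text \<open>Projections have fiberwise additive tangent maps, so the two sides agree after each of
  them.\<close>

lemma tsum_Dpair:
  assumes "A \<in> Obj C" "B \<in> Obj C"
    and "a \<in> Arr C" "a' \<in> Arr C" "Cod C a = T A" "Cod C a' = T A" "Dom C a' = Dom C a" "\<pi> A \<cdot> a = \<pi> A \<cdot> a'"
    and "b \<in> Arr C" "b' \<in> Arr C" "Cod C b = T B" "Cod C b' = T B" "Dom C b = Dom C a" "Dom C b' = Dom C b"
      "\<pi> B \<cdot> b = \<pi> B \<cdot> b'"
  shows "Dpair A B a b +\<^bsub>Prd C A B\<^esub> Dpair A B a' b' = Dpair A B (a +\<^bsub>A\<^esub> a') (b +\<^bsub>B\<^esub> b')"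
  by (rule D_Prd_ext[of A B]) (use assms in \<open>simp_all add: D_tsum\<close>)

abbreviation bang :: "'o \<Rightarrow> 'm" where "bang \<equiv> to_terminal C (pt C)"

lemma pt_Obj [simp]: "pt C \<in> Obj C"
  using pt_terminal unfolding is_terminal_def by blast

lemma bang_Arr [simp]:
  assumes "Y \<in> Obj C"
  shows "bang Y \<in> Arr C" "Dom C (bang Y) = Y" "Cod C (bang Y) = pt C"
  using to_terminal_Hom[OF pt_terminal assms] by (auto simp: Hom_def)

lemma bang_ext:
  assumes "h \<in> Arr C" "Cod C h = pt C"
  shows "h = bang (Dom C h)"
  using terminal_ext[OF pt_terminal, of h "Dom C h" "bang (Dom C h)"] assms by (simp add: Hom_def)

lemma bang_cmp [simp]:
  assumes "h \<in> Arr C" "Cod C h = Y"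
  shows "bang Y \<cdot> h = bang (Dom C h)"
proof -
  have "Y \<in> Obj C" using assms by auto
  then show ?thesis using bang_ext[of "bang Y \<cdot> h"] assms by simp
qed

text \<open>The two projections of \<open>pt \<times> pt\<close> coincide, hence so do those of \<open>T (pt \<times> pt)\<close>, which
  makes \<open>T pt\<close> subterminal.\<close>

lemma D_bang:
  assumes "Y \<in> Obj C" "h \<in> Arr C" "Cod C h = T Y"
  shows "D (bang Y) \<cdot> h = \<zeta> (pt C) \<cdot> bang (Dom C h)"
proof -
  let ?P = "pt C" and ?a = "D (bang Y) \<cdot> h" and ?b = "\<zeta> (pt C) \<cdot> bang (Dom C h)"
  have eq: "pr1 C ?P ?P = pr2 C ?P ?P"
    using bang_ext[of "pr1 C ?P ?P"] bang_ext[of "pr2 C ?P ?P"] by simp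
  have "?a = D (pr1 C ?P ?P) \<cdot> Dpair ?P ?P ?a ?b" using assms by simp
  also have "\<dots> = ?b" unfolding eq using assms by simp
  finally show ?thesis .
qed

lemma Tpart1_cpair:
  assumes "A \<in> Obj C" "B \<in> Obj C" "f \<in> Arr C" "Dom C f = Prd C A B"
    and "a \<in> Arr C" "y \<in> Arr C" "Cod C a = T A" "Cod C y = B" "Dom C y = Dom C a"
  shows "Tpart1 C A B f \<cdot> \<langle>a, y\<rangle> = D f \<cdot> Dpair A B a (\<zeta> B \<cdot> y)"
  using assms by (simp add: Tpart1_def Dpair_def chi_inverse)

lemma Tpart2_cpair:
  assumes "A \<in> Obj C" "B \<in> Obj C" "f \<in> Arr C" "Dom C f = Prd C A B"
    and "x \<in> Arr C" "b \<in> Arr C" "Cod C x = A" "Cod C b = T B" "Dom C b = Dom C x"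
  shows "Tpart2 C A B f \<cdot> \<langle>x, b\<rangle> = D f \<cdot> Dpair A B (\<zeta> A \<cdot> x) b"
  using assms by (simp add: Tpart2_def Dpair_def chi_inverse)

end

section \<open>Scalar multiplication\<close>

context scalar_tangent_category
begin

abbreviation R :: 'o where "R \<equiv> rng C"
abbreviation \<kappa> :: "'o \<Rightarrow> 'm" where "\<kappa> \<equiv> scal C"
abbreviation \<eta> :: 'm where "\<eta> \<equiv> eta C"
abbreviation const :: "'m \<Rightarrow> 'o \<Rightarrow> 'm" where "const c Y \<equiv> c \<cdot> bang Y"
abbreviation fsum :: "'m \<Rightarrow> 'm \<Rightarrow> 'm"  (infixl "\<oplus>" 65) where "a \<oplus> b \<equiv> fn_add C a b"
abbreviation fprod :: "'m \<Rightarrow> 'm \<Rightarrow> 'm"  (infixl "\<odot>" 70) where "a \<odot> b \<equiv> fn_mult C a b"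

section \<open>The ring of \<open>R\<close>-valued functions\<close>

lemma ring_group: "abelian_group_in C (ring_group C)"
  using ring_object category_axioms
  by (simp add: comm_ring_object_def Let_def abelian_group_in_def abelian_group_in_axioms_def)

interpretation ring: abelian_group_in C "ring_group C"
  by (rule ring_group)

lemma R_Obj [simp]: "R \<in> Obj C"
  using ring.gob_Obj by (simp add: ring_group_def)

lemma ring_Arr [simp]:
  shows "radd C \<in> Arr C" "Dom C (radd C) = Prd C R R" "Cod C (radd C) = R"
    and "rmult C \<in> Arr C" "Dom C (rmult C) = Prd C R R" "Cod C (rmult C) = R"
    and "rzero C \<in> Arr C" "Dom C (rzero C) = pt C" "Cod C (rzero C) = R"
    and "rone C \<in> Arr C" "Dom C (rone C) = pt C" "Cod C (rone C) = R"
    and "rneg C \<in> Arr C" "Dom C (rneg C) = R" "Cod C (rneg C) = R"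
  using ring_object ring.gadd_Hom ring.gzero_Hom ring.group_inverse
  unfolding comm_ring_object_def Let_def rneg_def is_group_inverse_def
  by (auto simp: ring_group_def Hom_def)

lemma fsum_gplus: "Cod C a = R \<Longrightarrow> Cod C b = R \<Longrightarrow> a \<oplus> b = gplus C (ring_group C) a b"
  by (simp add: fn_add_def gplus_def cpair_def ring_group_def)

lemma fsum_Arr [simp]:
  assumes "a \<in> Arr C" "b \<in> Arr C" "Cod C a = R" "Cod C b = R" "Dom C b = Dom C a"
  shows "a \<oplus> b \<in> Arr C" "Dom C (a \<oplus> b) = Dom C a" "Cod C (a \<oplus> b) = R"
    and "a \<odot> b \<in> Arr C" "Dom C (a \<odot> b) = Dom C a" "Cod C (a \<odot> b) = R"
  using assms by (simp_all add: fn_add_def fn_mult_def)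

lemma fprod_cmp [simp]:
  assumes "a \<in> Arr C" "b \<in> Arr C" "Cod C a = R" "Cod C b = R" "Dom C b = Dom C a"
    and "h \<in> Arr C" "Cod C h = Dom C a"
  shows "(a \<odot> b) \<cdot> h = (a \<cdot> h) \<odot> (b \<cdot> h)"
  using assms by (simp add: fn_mult_def)

lemma ring_Hom: "a \<in> Arr C \<Longrightarrow> Cod C a = R \<Longrightarrow> Dom C a = Y \<Longrightarrow> a \<in> Hom C Y (gob (ring_group C))"
  by (simp add: Hom_def ring_group_def)

lemma fsum_assoc:
  assumes "a \<in> Arr C" "b \<in> Arr C" "c \<in> Arr C" "Cod C a = R" "Cod C b = R" "Cod C c = R"
    and "Dom C b = Dom C a" "Dom C c = Dom C a"
  shows "(a \<oplus> b) \<oplus> c = a \<oplus> (b \<oplus> c)"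
  using ring.gplus_assoc[OF ring_Hom ring_Hom ring_Hom, of a "Dom C a" b c] assms
  by (simp add: fsum_gplus[symmetric])

lemma fsum_comm:
  assumes "a \<in> Arr C" "b \<in> Arr C" "Cod C a = R" "Cod C b = R" "Dom C b = Dom C a"
  shows "a \<oplus> b = b \<oplus> a"
  using ring.gplus_comm[OF ring_Hom ring_Hom, of a "Dom C a" b] assms
  by (simp add: fsum_gplus[symmetric])

lemma fsum_zero [simp]:
  assumes "a \<in> Arr C" "Cod C a = R" "Dom C a = Y"
  shows "a \<oplus> const (rzero C) Y = a"
proof -
  have "Y \<in> Obj C" using assms by auto
  then show ?thesis
    using ring.gplus_zero[OF ring_Hom, of a Y] assms by (simp add: fsum_gplus ring_group_def)
qed

lemma fsum_neg [simp]:
  assumes "a \<in> Arr C" "Cod C a = R"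
  shows "a \<oplus> (rneg C \<cdot> a) = const (rzero C) (Dom C a)"
proof -
  have "gplus C (ring_group C) a (rneg C \<cdot> a) = const (rzero C) (Dom C a)"
    using ring.gplus_neg(2)[OF ring_Hom[OF assms refl], folded rneg_def] by (simp add: ring_group_def)
  then show ?thesis using assms by (simp add: fsum_gplus)
qed

lemma fprod_comm:
  assumes "a \<in> Arr C" "b \<in> Arr C" "Cod C a = R" "Cod C b = R" "Dom C b = Dom C a"
  shows "a \<odot> b = b \<odot> a"
proof -
  have "rmult C \<cdot> \<langle>pr2 C R R, pr1 C R R\<rangle> = rmult C"
    using ring_object by (simp add: comm_ring_object_def Let_def)
  from arg_cong[OF this, of "\<lambda>x. x \<cdot> \<langle>a, b\<rangle>"] show ?thesis
    using assms by (simp add: fn_mult_def)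
qed

lemma fprod_one [simp]:
  assumes "a \<in> Arr C" "Cod C a = R" "Dom C a = Y"
  shows "a \<odot> const (rone C) Y = a"
proof -
  have "rmult C \<cdot> \<langle>idt C R, const (rone C) R\<rangle> = idt C R"
    using ring_object by (simp add: comm_ring_object_def Let_def)
  from arg_cong[OF this, of "\<lambda>x. x \<cdot> a"] show ?thesis
    using assms by (simp add: fn_mult_def)
qed

text \<open>Constants factor through \<open>pt C\<close>, and by \<open>D_bang\<close> every tangent
  vector arriving there is a zero vector.\<close>

lemma D_const [simp]:
  assumes "c \<in> Arr C" "Dom C c = pt C" "Y \<in> Obj C" "h \<in> Arr C" "Cod C h = T Y"
  shows "D (const c Y) \<cdot> h = \<zeta> (Cod C c) \<cdot> const c (Dom C h)"
  using assms by (simp add: D_bang)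

text \<open>\<open>T\<close> preserves products, so it carries the ring operations of
  \<open>R\<close> to operations on \<open>T R\<close>, in the classical picture those of the dual
  numbers. Unlike the fiberwise sum, they also act on base points.\<close>

definition dsum :: "'m \<Rightarrow> 'm \<Rightarrow> 'm"  (infixl "\<boxplus>" 65) where
  "a \<boxplus> b = D (radd C) \<cdot> Dpair R R a b"

definition dprod :: "'m \<Rightarrow> 'm \<Rightarrow> 'm"  (infixl "\<boxdot>" 70) where
  "a \<boxdot> b = D (rmult C) \<cdot> Dpair R R a b"

lemma dsum_Arr [simp]:
  assumes "a \<in> Arr C" "b \<in> Arr C" "Cod C a = T R" "Cod C b = T R" "Dom C b = Dom C a"
  shows "a \<boxplus> b \<in> Arr C" "Dom C (a \<boxplus> b) = Dom C a" "Cod C (a \<boxplus> b) = T R"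
    "\<pi> R \<cdot> (a \<boxplus> b) = (\<pi> R \<cdot> a) \<oplus> (\<pi> R \<cdot> b)"
    and "a \<boxdot> b \<in> Arr C" "Dom C (a \<boxdot> b) = Dom C a" "Cod C (a \<boxdot> b) = T R"
    "\<pi> R \<cdot> (a \<boxdot> b) = (\<pi> R \<cdot> a) \<odot> (\<pi> R \<cdot> b)"
  using assms by (simp_all add: dsum_def dprod_def fn_add_def fn_mult_def)

lemma dsum_cmp [simp]:
  assumes "a \<in> Arr C" "b \<in> Arr C" "Cod C a = T R" "Cod C b = T R" "Dom C b = Dom C a"
    and "h \<in> Arr C" "Cod C h = Dom C a"
  shows "(a \<boxplus> b) \<cdot> h = (a \<cdot> h) \<boxplus> (b \<cdot> h)"
  using assms by (simp add: dsum_def)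

lemma D_fsum:
  assumes "f \<in> Arr C" "g \<in> Arr C" "Cod C f = R" "Cod C g = R" "Dom C g = Dom C f"
    and "h \<in> Arr C" "Cod C h = T (Dom C f)"
  shows "D (f \<oplus> g) \<cdot> h = (D f \<cdot> h) \<boxplus> (D g \<cdot> h)" "D (f \<odot> g) \<cdot> h = (D f \<cdot> h) \<boxdot> (D g \<cdot> h)"
  using assms by (simp_all add: fn_add_def fn_mult_def dsum_def dprod_def D_cpair)

text \<open>The pattern for moving ring laws to \<open>T R\<close>: state the law for the
  projections of \<open>R \<times> R\<close>, apply \<open>D\<close>, and evaluate at
  \<open>Dpair R R a b\<close>.\<close>

lemma dsum_comm:
  assumes "a \<in> Arr C" "b \<in> Arr C" "Cod C a = T R" "Cod C b = T R" "Dom C b = Dom C a"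
  shows "a \<boxplus> b = b \<boxplus> a" "a \<boxdot> b = b \<boxdot> a"
proof -
  let ?p = "pr1 C R R" and ?q = "pr2 C R R" and ?z = "Dpair R R a b"
  have "D (?p \<oplus> ?q) \<cdot> ?z = D (?q \<oplus> ?p) \<cdot> ?z" by (subst fsum_comm) simp_all
  then show "a \<boxplus> b = b \<boxplus> a" using assms by (simp add: D_fsum)
  have "D (?p \<odot> ?q) \<cdot> ?z = D (?q \<odot> ?p) \<cdot> ?z" by (subst fprod_comm) simp_all
  then show "a \<boxdot> b = b \<boxdot> a" using assms by (simp add: D_fsum)
qed

lemma dsum_assoc:
  assumes "a \<in> Arr C" "b \<in> Arr C" "c \<in> Arr C" "Cod C a = T R" "Cod C b = T R" "Cod C c = T R"
    and "Dom C b = Dom C a" "Dom C c = Dom C a"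
  shows "(a \<boxplus> b) \<boxplus> c = a \<boxplus> (b \<boxplus> c)"
proof -
  let ?R2 = "Prd C R R"
  let ?x = "pr1 C R R \<cdot> pr1 C ?R2 R" and ?y = "pr2 C R R \<cdot> pr1 C ?R2 R" and ?w = "pr2 C ?R2 R"
  let ?z = "Dpair ?R2 R (Dpair R R a b) c"
  have "D ((?x \<oplus> ?y) \<oplus> ?w) \<cdot> ?z = D (?x \<oplus> (?y \<oplus> ?w)) \<cdot> ?z" by (subst fsum_assoc) simp_all
  then show ?thesis using assms by (simp add: D_fsum)
qed

lemma dsum_medial:
  assumes "a \<in> Arr C" "b \<in> Arr C" "c \<in> Arr C" "d \<in> Arr C"
    and "Cod C a = T R" "Cod C b = T R" "Cod C c = T R" "Cod C d = T R"
    and "Dom C b = Dom C a" "Dom C c = Dom C a" "Dom C d = Dom C a"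
  shows "(a \<boxplus> b) \<boxplus> (c \<boxplus> d) = (a \<boxplus> c) \<boxplus> (b \<boxplus> d)"
proof -
  have "(a \<boxplus> b) \<boxplus> (c \<boxplus> d) = a \<boxplus> ((b \<boxplus> c) \<boxplus> d)" using assms by (simp add: dsum_assoc)
  also have "b \<boxplus> c = c \<boxplus> b" using assms by (intro dsum_comm) simp_all
  also have "a \<boxplus> ((c \<boxplus> b) \<boxplus> d) = (a \<boxplus> c) \<boxplus> (b \<boxplus> d)" using assms by (simp add: dsum_assoc)
  finally show ?thesis .
qed

lemma zero_fsum:
  assumes "a \<in> Arr C" "b \<in> Arr C" "Cod C a = R" "Cod C b = R" "Dom C b = Dom C a"
  shows "\<zeta> R \<cdot> (a \<oplus> b) = (\<zeta> R \<cdot> a) \<boxplus> (\<zeta> R \<cdot> b)"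
proof -
  have "\<zeta> R \<cdot> (a \<oplus> b) = D (radd C) \<cdot> \<zeta> (Prd C R R) \<cdot> \<langle>a, b\<rangle>"
    using assms by (simp add: fn_add_def)
  then show ?thesis using assms by (simp add: zero_cpair dsum_def del: zero_nat_cmp)
qed

lemma dsum_zero:
  assumes "a \<in> Arr C" "Cod C a = T R" "Dom C a = Y"
  shows "a \<boxplus> (\<zeta> R \<cdot> const (rzero C) Y) = a" "(\<zeta> R \<cdot> const (rzero C) Y) \<boxplus> a = a"
proof -
  have Y [simp]: "Y \<in> Obj C" using assms by auto
  have "D (idt C R \<oplus> const (rzero C) R) \<cdot> a = a" using assms by (simp del: D_cmp)
  then show *: "a \<boxplus> (\<zeta> R \<cdot> const (rzero C) Y) = a"
    using assms by (subst (asm) D_fsum) (simp_all del: D_cmp)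
  have "(\<zeta> R \<cdot> const (rzero C) Y) \<boxplus> a = a \<boxplus> (\<zeta> R \<cdot> const (rzero C) Y)"
    using assms by (intro dsum_comm) simp_all
  with * show "(\<zeta> R \<cdot> const (rzero C) Y) \<boxplus> a = a" by simp
qed

text \<open>Interchange law: \<open>D (radd C)\<close> and \<open>D (rmult C)\<close> are tangent
  maps, hence fiberwise additive, and sums in \<open>T (R \<times> R)\<close> are
  componentwise.\<close>

lemma dsum_tsum:
  assumes "a \<in> Arr C" "a' \<in> Arr C" "Cod C a = T R" "Cod C a' = T R" "Dom C a' = Dom C a" "\<pi> R \<cdot> a = \<pi> R \<cdot> a'"
    and "b \<in> Arr C" "b' \<in> Arr C" "Cod C b = T R" "Cod C b' = T R" "Dom C b = Dom C a" "Dom C b' = Dom C b"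
      "\<pi> R \<cdot> b = \<pi> R \<cdot> b'"
  shows "(a +\<^bsub>R\<^esub> a') \<boxplus> (b +\<^bsub>R\<^esub> b') = (a \<boxplus> b) +\<^bsub>R\<^esub> (a' \<boxplus> b')"
    "(a +\<^bsub>R\<^esub> a') \<boxdot> (b +\<^bsub>R\<^esub> b') = (a \<boxdot> b) +\<^bsub>R\<^esub> (a' \<boxdot> b')"
  using assms by (simp_all add: dsum_def dprod_def D_tsum flip: tsum_Dpair)

text \<open>Eckmann--Hilton.\<close>

lemma dsum_fiber:
  assumes "a \<in> Arr C" "b \<in> Arr C" "Cod C a = T R" "Cod C b = T R" "Dom C a = Y" "Dom C b = Y"
    and "\<pi> R \<cdot> a = const (rzero C) Y" "\<pi> R \<cdot> b = const (rzero C) Y"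
  shows "a \<boxplus> b = a +\<^bsub>R\<^esub> b"
proof -
  let ?z = "\<zeta> R \<cdot> const (rzero C) Y"
  have Y [simp]: "Y \<in> Obj C" using assms by auto
  have "a +\<^bsub>R\<^esub> ?z = a" "?z +\<^bsub>R\<^esub> b = b" using assms by (simp_all add: tsum_zero)
  then have "a \<boxplus> b = (a +\<^bsub>R\<^esub> ?z) \<boxplus> (?z +\<^bsub>R\<^esub> b)" by simp
  also have "\<dots> = (a \<boxplus> ?z) +\<^bsub>R\<^esub> (?z \<boxplus> b)" using assms by (subst dsum_tsum) simp_all
  finally show ?thesis using assms by (simp add: dsum_zero)
qed

section \<open>The tangent fiber at zero\<close>

definition \<iota> :: 'm where "\<iota> = fib_incl C \<cdot> inv_arr C (fib_iso C)"

lemma fib_pullback: "is_pullback C (rzero C) (\<pi> R) (fib C) (bang (fib C)) (fib_incl C)"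
  using tangent_stable by (simp add: tangent_stable_def)

lemma fib_Arr [simp]:
  shows "fib_incl C \<in> Arr C" "Dom C (fib_incl C) = fib C" "Cod C (fib_incl C) = T R"
    and "fib_iso C \<in> Arr C" "Dom C (fib_iso C) = fib C" "Cod C (fib_iso C) = R"
  using fib_pullback tangent_stable by (auto simp: is_pullback_def tangent_stable_def Hom_def)

lemma fib_Obj [simp]: "fib C \<in> Obj C"
  using Dom_Cod_Obj(1)[of "fib_incl C"] by simp

lemma fib_proj [simp]:
  assumes "h \<in> Arr C" "Cod C h = fib C"
  shows "\<pi> R \<cdot> fib_incl C \<cdot> h = const (rzero C) (Dom C h)"
proof -
  have "\<pi> R \<cdot> fib_incl C = const (rzero C) (fib C)"
    using fib_pullback by (simp add: is_pullback_def)
  from reassoc[OF this] show ?thesis using assms by simp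
qed

lemma fib_inv [simp]:
  shows "inv_arr C (fib_iso C) \<in> Arr C" "Dom C (inv_arr C (fib_iso C)) = R" "Cod C (inv_arr C (fib_iso C)) = fib C"
    and "inv_arr C (fib_iso C) \<cdot> fib_iso C = idt C (fib C)" "fib_iso C \<cdot> inv_arr C (fib_iso C) = idt C R"
  using inv_arr_inverse[of "fib_iso C"] tangent_stable
  by (auto simp: is_inverse_def tangent_stable_def Hom_def)

lemma fib_inv_cmp [simp]:
  "h \<in> Arr C \<Longrightarrow> Cod C h = fib C \<Longrightarrow> inv_arr C (fib_iso C) \<cdot> fib_iso C \<cdot> h = h"
  "h \<in> Arr C \<Longrightarrow> Cod C h = R \<Longrightarrow> fib_iso C \<cdot> inv_arr C (fib_iso C) \<cdot> h = h"
  by (simp_all add: reassoc[OF fib_inv(4)] reassoc[OF fib_inv(5)])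

lemma to_fib [simp]:
  assumes "a \<in> Arr C" "Cod C a = T R" "\<pi> R \<cdot> a = const (rzero C) (Dom C a)"
  shows "to_fib C a \<in> Arr C" "Dom C (to_fib C a) = Dom C a" "Cod C (to_fib C a) = fib C"
    "fib_incl C \<cdot> to_fib C a = a"
  using pullback_pairing[OF fib_pullback, of "bang (Dom C a)" "Dom C a" a] assms
  by (auto simp: to_fib_def Hom_def)

lemma incl_to_fib_cmp:
  "a \<in> Arr C \<Longrightarrow> Cod C a = T R \<Longrightarrow> \<pi> R \<cdot> a = const (rzero C) (Dom C a) \<Longrightarrow>
    h \<in> Arr C \<Longrightarrow> Cod C h = Dom C a \<Longrightarrow> fib_incl C \<cdot> to_fib C a \<cdot> h = a \<cdot> h"
  by (simp add: reassoc[OF to_fib(4)])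

lemma \<iota>_Arr [simp]:
  shows "\<iota> \<in> Arr C" "Dom C \<iota> = R" "Cod C \<iota> = T R"
    and "\<pi> R \<cdot> \<iota> = const (rzero C) R"
  by (simp_all add: \<iota>_def)

lemma proj_\<iota>_cmp [simp]:
  "h \<in> Arr C \<Longrightarrow> Cod C h = R \<Longrightarrow> \<pi> R \<cdot> \<iota> \<cdot> h = const (rzero C) (Dom C h)"
  by (simp add: reassoc[OF \<iota>_Arr(4)])

text \<open>An arrow into the fiber is determined by its composite with \<open>fib_incl\<close>, the
  other projection of the pullback ending in the terminal object. Identities for
  \<open>\<eta>\<close> can therefore be checked after composing with
  \<open>\<iota>\<close>.\<close>

lemma \<iota>_cancel:
  assumes "a \<in> Arr C" "b \<in> Arr C" "Cod C a = R" "Cod C b = R" "Dom C b = Dom C a" "\<iota> \<cdot> a = \<iota> \<cdot> b"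
  shows "a = b"
proof -
  let ?i = "inv_arr C (fib_iso C)"
  have "?i \<cdot> a = ?i \<cdot> b"
    by (rule pullback_ext[OF fib_pullback, of _ "Dom C a"]) (use assms in \<open>simp_all add: Hom_def \<iota>_def\<close>)
  then have "fib_iso C \<cdot> ?i \<cdot> a = fib_iso C \<cdot> ?i \<cdot> b" by simp
  then show ?thesis using assms by simp
qed

text \<open>The additive half of \<open>fib_iso\<close> being a module isomorphism, read through its
  inverse; \<open>scal_\<iota>\<close> is the other half.\<close>

lemma \<iota>_fsum:
  assumes "a \<in> Arr C" "b \<in> Arr C" "Cod C a = R" "Cod C b = R" "Dom C b = Dom C a"
  shows "\<iota> \<cdot> (a \<oplus> b) = (\<iota> \<cdot> a) +\<^bsub>R\<^esub> (\<iota> \<cdot> b)"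
proof -
  let ?i = "inv_arr C (fib_iso C)" and ?p = "pr1 C (fib C) (fib C)" and ?q = "pr2 C (fib C) (fib C)"
  let ?s = "(fib_incl C \<cdot> ?p) +\<^bsub>R\<^esub> (fib_incl C \<cdot> ?q)"
  have fib_add: "fib_add C = to_fib C ?s" by (simp add: fib_add_def vf_add_def)
  have s: "?s \<in> Arr C" "Dom C ?s = Prd C (fib C) (fib C)" "Cod C ?s = T R"
    "\<pi> R \<cdot> ?s = const (rzero C) (Dom C ?s)" by simp_all
  have "fib_iso C \<cdot> fib_add C = radd C \<cdot> (fib_iso C \<boxtimes> fib_iso C)"
    using tangent_stable by (simp add: tangent_stable_def)
  from arg_cong[OF this, of "\<lambda>x. ?i \<cdot> x \<cdot> \<langle>?i \<cdot> a, ?i \<cdot> b\<rangle>"]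
  have "fib_add C \<cdot> \<langle>?i \<cdot> a, ?i \<cdot> b\<rangle> = ?i \<cdot> (a \<oplus> b)"
    using assms s by (simp add: fib_add fn_add_def)
  then have "\<iota> \<cdot> (a \<oplus> b) = fib_incl C \<cdot> to_fib C ?s \<cdot> \<langle>?i \<cdot> a, ?i \<cdot> b\<rangle>"
    using assms by (simp add: \<iota>_def fib_add)
  also have "\<dots> = ?s \<cdot> \<langle>?i \<cdot> a, ?i \<cdot> b\<rangle>" using assms s by (intro incl_to_fib_cmp) simp_all
  also have "\<dots> = (\<iota> \<cdot> a) +\<^bsub>R\<^esub> (\<iota> \<cdot> b)" using assms by (simp add: tsum_cmp \<iota>_def)
  finally show ?thesis .
qed

section \<open>Scalar multiplication on elements and the projection onto the fiber\<close>

lemma scal_Arr [simp]: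
  assumes "X \<in> Obj C"
  shows "\<kappa> X \<in> Arr C" "Dom C (\<kappa> X) = Prd C R (T X)" "Cod C (\<kappa> X) = T X"
    and "\<pi> X \<cdot> \<kappa> X = \<pi> X \<cdot> pr2 C R (T X)"
  using module_structure assms unfolding module_structure_def Let_def is_natural_def Hom_def by auto

lemma proj_scal_cmp [simp]:
  "X \<in> Obj C \<Longrightarrow> h \<in> Arr C \<Longrightarrow> Cod C h = Prd C R (T X) \<Longrightarrow>
    \<pi> X \<cdot> \<kappa> X \<cdot> h = \<pi> X \<cdot> pr2 C R (T X) \<cdot> h"
  by (simp add: reassoc[OF scal_Arr(4)])

lemma scal_nat:
  assumes "f \<in> Arr C" "r \<in> Arr C" "a \<in> Arr C" "Cod C r = R" "Cod C a = T (Dom C f)" "Dom C a = Dom C r"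
  shows "D f \<cdot> \<kappa> (Dom C f) \<cdot> \<langle>r, a\<rangle> = \<kappa> (Cod C f) \<cdot> \<langle>r, D f \<cdot> a\<rangle>"
proof -
  have "D f \<cdot> \<kappa> (Dom C f) = \<kappa> (Cod C f) \<cdot> (idt C R \<boxtimes> D f)"
    using module_structure assms(1) unfolding module_structure_def Let_def is_natural_def Hom_def by auto
  from arg_cong[OF this, of "\<lambda>x. x \<cdot> \<langle>r, a\<rangle>"] show ?thesis using assms by simp
qed

lemma scal_fsum:
  assumes "X \<in> Obj C" "r \<in> Arr C" "s \<in> Arr C" "a \<in> Arr C" "Cod C r = R" "Cod C s = R" "Cod C a = T X"
    and "Dom C s = Dom C r" "Dom C a = Dom C r"
  shows "\<kappa> X \<cdot> \<langle>r \<oplus> s, a\<rangle> = (\<kappa> X \<cdot> \<langle>r, a\<rangle>) +\<^bsub>X\<^esub> (\<kappa> X \<cdot> \<langle>s, a\<rangle>)"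
proof -
  let ?R2 = "Prd C R R"
  let ?r = "pr1 C R R \<cdot> pr1 C ?R2 (T X)" and ?s = "pr2 C R R \<cdot> pr1 C ?R2 (T X)" and ?u = "pr2 C ?R2 (T X)"
  have "\<kappa> X \<cdot> (radd C \<boxtimes> idt C (T X)) = (\<kappa> X \<cdot> \<langle>?r, ?u\<rangle>) +\<^bsub>X\<^esub> (\<kappa> X \<cdot> \<langle>?s, ?u\<rangle>)"
    using module_structure assms(1) unfolding module_structure_def Let_def vf_add_def by blast
  from arg_cong[OF this, of "\<lambda>x. x \<cdot> \<langle>\<langle>r, s\<rangle>, a\<rangle>"] show ?thesis
    using assms by (simp add: tsum_cmp fn_add_def)
qed

lemma scal_zero:
  assumes "X \<in> Obj C" "a \<in> Arr C" "Cod C a = T X" "Dom C a = Y"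
  shows "\<kappa> X \<cdot> \<langle>const (rzero C) Y, a\<rangle> = \<zeta> X \<cdot> \<pi> X \<cdot> a"
proof -
  let ?z = "const (rzero C) Y"
  have [simp]: "Y \<in> Obj C" using assms by auto
  have "?z \<oplus> ?z = ?z" by simp
  then have "(\<kappa> X \<cdot> \<langle>?z, a\<rangle>) +\<^bsub>X\<^esub> (\<kappa> X \<cdot> \<langle>?z, a\<rangle>) = \<kappa> X \<cdot> \<langle>?z, a\<rangle>"
    using scal_fsum[of X ?z ?z a] assms by simp
  from tsum_idem[OF assms(1) _ _ this] show ?thesis using assms by simp
qed

lemma scal_\<iota>:
  assumes "r \<in> Arr C" "s \<in> Arr C" "Cod C r = R" "Cod C s = R" "Dom C s = Dom C r"
  shows "\<kappa> R \<cdot> \<langle>r, \<iota> \<cdot> s\<rangle> = \<iota> \<cdot> (r \<odot> s)"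
proof -
  let ?i = "inv_arr C (fib_iso C)" and ?k = "\<kappa> R \<cdot> (idt C R \<boxtimes> fib_incl C)"
  have k: "?k \<in> Arr C" "Dom C ?k = Prd C R (fib C)" "Cod C ?k = T R"
    "\<pi> R \<cdot> ?k = const (rzero C) (Dom C ?k)" by (simp_all add: cprod_def)
  have "fib_iso C \<cdot> to_fib C ?k = rmult C \<cdot> (idt C R \<boxtimes> fib_iso C)"
    using tangent_stable by (simp add: tangent_stable_def fib_scal_def)
  from arg_cong[OF this, of "\<lambda>x. ?i \<cdot> x \<cdot> \<langle>r, ?i \<cdot> s\<rangle>"]
  have "to_fib C ?k \<cdot> \<langle>r, ?i \<cdot> s\<rangle> = ?i \<cdot> (r \<odot> s)"
    using assms k by (simp add: fn_mult_def)
  then have "\<iota> \<cdot> (r \<odot> s) = fib_incl C \<cdot> to_fib C ?k \<cdot> \<langle>r, ?i \<cdot> s\<rangle>"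
    using assms by (simp add: \<iota>_def)
  also have "\<dots> = ?k \<cdot> \<langle>r, ?i \<cdot> s\<rangle>" using assms k by (intro incl_to_fib_cmp) simp_all
  also have "\<dots> = \<kappa> R \<cdot> \<langle>r, \<iota> \<cdot> s\<rangle>" using assms by (simp add: \<iota>_def)
  finally show ?thesis by simp
qed

text \<open>\<open>\<iota> \<cdot> \<eta>\<close> translates a tangent vector to the fiber at zero:
  adding the zero vector at the negative of its base point moves the base point to zero and keeps
  the direction.\<close>

lemma
  shows eta_Arr [simp]: "\<eta> \<in> Arr C" "Dom C \<eta> = T R" "Cod C \<eta> = R"
    and \<iota>_eta_idt: "\<iota> \<cdot> \<eta> = (\<zeta> R \<cdot> rneg C \<cdot> \<pi> R) \<boxplus> idt C (T R)"
proof -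
  let ?a = "(\<zeta> R \<cdot> rneg C \<cdot> \<pi> R) \<boxplus> idt C (T R)"
  have "(rneg C \<cdot> \<pi> R) \<oplus> \<pi> R = \<pi> R \<oplus> (rneg C \<cdot> \<pi> R)" by (rule fsum_comm) simp_all
  then have a: "?a \<in> Arr C" "Cod C ?a = T R" "\<pi> R \<cdot> ?a = const (rzero C) (Dom C ?a)" "Dom C ?a = T R"
    by simp_all
  have e: "\<eta> = fib_iso C \<cdot> to_fib C ?a"
    by (simp add: eta_def Tpart2_cpair dsum_def)
  show "\<eta> \<in> Arr C" "Dom C \<eta> = T R" "Cod C \<eta> = R" using a by (simp_all add: e)
  show "\<iota> \<cdot> \<eta> = ?a" using a by (simp add: e \<iota>_def)
qed

lemma \<iota>_eta:
  assumes "a \<in> Arr C" "Cod C a = T R"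
  shows "\<iota> \<cdot> \<eta> \<cdot> a = (\<zeta> R \<cdot> rneg C \<cdot> \<pi> R \<cdot> a) \<boxplus> a"
  using assms by (simp add: reassoc[OF \<iota>_eta_idt])

lemma eta_eqI:
  assumes "a \<in> Arr C" "Cod C a = T R" "r \<in> Arr C" "Cod C r = R" "Dom C r = Dom C a"
    and "(\<zeta> R \<cdot> rneg C \<cdot> \<pi> R \<cdot> a) \<boxplus> a = \<iota> \<cdot> r"
  shows "\<eta> \<cdot> a = r"
  by (rule \<iota>_cancel) (use assms in \<open>simp_all add: \<iota>_eta\<close>)

section \<open>Additivity of \<open>\<eta>\<close>\<close>

lemma neg_zero [simp]:
  assumes "Y \<in> Obj C"
  shows "rneg C \<cdot> const (rzero C) Y = const (rzero C) Y"
proof -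
  let ?z = "const (rzero C) Y"
  have "?z \<oplus> (rneg C \<cdot> ?z) = ?z" using assms by (subst fsum_neg) simp_all
  moreover have "?z \<oplus> (rneg C \<cdot> ?z) = (rneg C \<cdot> ?z) \<oplus> ?z" using assms by (intro fsum_comm) simp_all
  moreover have "(rneg C \<cdot> ?z) \<oplus> ?z = rneg C \<cdot> ?z" using assms by (intro fsum_zero) simp_all
  ultimately show ?thesis by simp
qed

lemma neg_fsum:
  assumes "a \<in> Arr C" "b \<in> Arr C" "Cod C a = R" "Cod C b = R" "Dom C b = Dom C a"
  shows "rneg C \<cdot> (a \<oplus> b) = (rneg C \<cdot> a) \<oplus> (rneg C \<cdot> b)"
proof -
  let ?n = "\<lambda>x. rneg C \<cdot> x" and ?z = "const (rzero C) (Dom C a)"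
  have na: "a \<oplus> ?n a = ?z" "b \<oplus> ?n b = ?z" "(a \<oplus> b) \<oplus> ?n (a \<oplus> b) = ?z"
    using assms by (simp_all only: fsum_neg fsum_Arr)
  have c1: "?n (a \<oplus> b) \<oplus> (a \<oplus> b) = ?z"
    using na(3) assms by (subst fsum_comm) simp_all
  have "(?n a \<oplus> ?n b) \<oplus> (a \<oplus> b) = (a \<oplus> b) \<oplus> (?n a \<oplus> ?n b)"
    using assms by (intro fsum_comm) simp_all
  also have "\<dots> = a \<oplus> ((b \<oplus> ?n a) \<oplus> ?n b)" using assms by (simp add: fsum_assoc del: fsum_neg)
  also have "b \<oplus> ?n a = ?n a \<oplus> b" using assms by (intro fsum_comm) simp_all
  also have "a \<oplus> ((?n a \<oplus> b) \<oplus> ?n b) = (a \<oplus> ?n a) \<oplus> (b \<oplus> ?n b)"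
    using assms by (simp add: fsum_assoc del: fsum_neg)
  also have "\<dots> = ?z" using na assms by simp
  finally have c2: "(?n a \<oplus> ?n b) \<oplus> (a \<oplus> b) = ?z" .
  show ?thesis
    using c1 c2 abelian_group_in.gplus_cancel[OF ring_group, of "?n (a \<oplus> b)" "Dom C a" "?n a \<oplus> ?n b" "a \<oplus> b"] assms
    by (simp add: fsum_gplus[symmetric] ring_Hom)
qed

text \<open>Negation is additive, so the translation to zero distributes over
  \<open>\<boxplus>\<close> by rearranging four summands. Inside the fiber \<open>\<boxplus>\<close>
  is the fiberwise sum, which corresponds under \<open>\<iota>\<close> to
  \<open>\<oplus>\<close>.\<close>

lemma eta_dsum:
  assumes "a \<in> Arr C" "b \<in> Arr C" "Cod C a = T R" "Cod C b = T R" "Dom C b = Dom C a"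
  shows "\<eta> \<cdot> (a \<boxplus> b) = (\<eta> \<cdot> a) \<oplus> (\<eta> \<cdot> b)"
proof (rule eta_eqI)
  let ?n = "\<lambda>a. \<zeta> R \<cdot> rneg C \<cdot> \<pi> R \<cdot> a"
  have "?n (a \<boxplus> b) \<boxplus> (a \<boxplus> b) = (?n a \<boxplus> ?n b) \<boxplus> (a \<boxplus> b)"
    using assms by (simp add: neg_fsum zero_fsum)
  also have "\<dots> = (\<iota> \<cdot> \<eta> \<cdot> a) \<boxplus> (\<iota> \<cdot> \<eta> \<cdot> b)"
    using assms by (subst dsum_medial) (simp_all add: \<iota>_eta)
  also have "\<dots> = (\<iota> \<cdot> \<eta> \<cdot> a) +\<^bsub>R\<^esub> (\<iota> \<cdot> \<eta> \<cdot> b)" using assms by (intro dsum_fiber) simp_all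
  also have "\<dots> = \<iota> \<cdot> ((\<eta> \<cdot> a) \<oplus> (\<eta> \<cdot> b))" using assms by (simp add: \<iota>_fsum)
  finally show "?n (a \<boxplus> b) \<boxplus> (a \<boxplus> b) = \<iota> \<cdot> ((\<eta> \<cdot> a) \<oplus> (\<eta> \<cdot> b))" .
qed (use assms in simp_all)

lemma eta_tsum:
  assumes "a \<in> Arr C" "b \<in> Arr C" "Cod C a = T R" "Cod C b = T R" "Dom C b = Dom C a" "\<pi> R \<cdot> a = \<pi> R \<cdot> b"
  shows "\<eta> \<cdot> (a +\<^bsub>R\<^esub> b) = (\<eta> \<cdot> a) \<oplus> (\<eta> \<cdot> b)"
proof (rule eta_eqI)
  let ?n = "\<zeta> R \<cdot> rneg C \<cdot> \<pi> R \<cdot> b"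
  \<comment> \<open>The translating vector is a zero vector and may be doubled; the interchange law
    then distributes it over both summands.\<close>
  have "?n +\<^bsub>R\<^esub> ?n = ?n" using assms by (intro tsum_zero) simp_all
  then have "?n \<boxplus> (a +\<^bsub>R\<^esub> b) = (?n +\<^bsub>R\<^esub> ?n) \<boxplus> (a +\<^bsub>R\<^esub> b)" by simp
  also have "\<dots> = (?n \<boxplus> a) +\<^bsub>R\<^esub> (?n \<boxplus> b)" using assms by (intro dsum_tsum) simp_all
  also have "\<dots> = \<iota> \<cdot> ((\<eta> \<cdot> a) \<oplus> (\<eta> \<cdot> b))" using assms by (simp add: \<iota>_fsum \<iota>_eta)
  finally show "(\<zeta> R \<cdot> rneg C \<cdot> \<pi> R \<cdot> (a +\<^bsub>R\<^esub> b)) \<boxplus> (a +\<^bsub>R\<^esub> b) = \<iota> \<cdot> ((\<eta> \<cdot> a) \<oplus> (\<eta> \<cdot> b))"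
    using assms by simp
qed (use assms in simp_all)

lemma eta_\<iota> [simp]: "\<eta> \<cdot> \<iota> = idt C R"
  by (rule eta_eqI) (simp_all add: dsum_zero)

lemma eta_\<iota>_cmp [simp]: "r \<in> Arr C \<Longrightarrow> Cod C r = R \<Longrightarrow> \<eta> \<cdot> \<iota> \<cdot> r = r"
  by (simp add: reassoc[OF eta_\<iota>])

lemma D_eta_\<iota>_cmp [simp]:
  assumes "a \<in> Arr C" "Cod C a = T R"
  shows "D \<eta> \<cdot> D \<iota> \<cdot> a = a"
proof -
  have "D \<eta> \<cdot> D \<iota> = idt C (T R)" by (simp flip: D_cmp)
  from reassoc[OF this] show ?thesis using assms by simp
qed

lemma eta_zero [simp]: "\<eta> \<cdot> \<zeta> R = const (rzero C) R"
proof -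
  have "\<eta> \<cdot> \<zeta> R = \<eta> \<cdot> (\<zeta> R +\<^bsub>R\<^esub> \<zeta> R)" by simp
  also have "\<dots> = (\<eta> \<cdot> \<zeta> R) \<oplus> (\<eta> \<cdot> \<zeta> R)" by (rule eta_tsum) simp_all
  finally have "(\<eta> \<cdot> \<zeta> R) \<oplus> (\<eta> \<cdot> \<zeta> R) = \<eta> \<cdot> \<zeta> R" by simp
  moreover have "const (rzero C) R \<oplus> (\<eta> \<cdot> \<zeta> R) = (\<eta> \<cdot> \<zeta> R) \<oplus> const (rzero C) R"
    by (rule fsum_comm) simp_all
  ultimately show ?thesis
    using abelian_group_in.gplus_cancel[OF ring_group, of "\<eta> \<cdot> \<zeta> R" R "const (rzero C) R" "\<eta> \<cdot> \<zeta> R"]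
    by (simp add: fsum_gplus[symmetric] ring_Hom)
qed

lemma eta_zero_cmp [simp]: "r \<in> Arr C \<Longrightarrow> Cod C r = R \<Longrightarrow> \<eta> \<cdot> \<zeta> R \<cdot> r = const (rzero C) (Dom C r)"
  by (simp add: reassoc[OF eta_zero])

lemma D_eta_zero_cmp [simp]:
  assumes "a \<in> Arr C" "Cod C a = T R"
  shows "D \<eta> \<cdot> D (\<zeta> R) \<cdot> a = \<zeta> R \<cdot> const (rzero C) (Dom C a)"
proof -
  have "D \<eta> \<cdot> D (\<zeta> R) \<cdot> a = D (\<eta> \<cdot> \<zeta> R) \<cdot> a" using assms by (simp del: eta_zero)
  also have "\<dots> = \<zeta> R \<cdot> const (rzero C) (Dom C a)" unfolding eta_zero using assms by (subst D_const) simp_all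
  finally show ?thesis .
qed

text \<open>Translation back from zero. It reduces identities that are additive for
  \<open>\<boxplus>\<close> to zero vectors and vectors in the image of
  \<open>\<iota>\<close>.\<close>

lemma dsum_decomp:
  assumes "a \<in> Arr C" "Cod C a = T R"
  shows "(\<zeta> R \<cdot> \<pi> R \<cdot> a) \<boxplus> (\<iota> \<cdot> \<eta> \<cdot> a) = a"
proof -
  let ?z = "\<zeta> R \<cdot> \<pi> R \<cdot> a" and ?n = "\<zeta> R \<cdot> rneg C \<cdot> \<pi> R \<cdot> a"
  have "?z \<boxplus> (\<iota> \<cdot> \<eta> \<cdot> a) = (?z \<boxplus> ?n) \<boxplus> a" using assms by (simp add: \<iota>_eta dsum_assoc)
  also have "?z \<boxplus> ?n = \<zeta> R \<cdot> ((\<pi> R \<cdot> a) \<oplus> (rneg C \<cdot> \<pi> R \<cdot> a))"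
    using assms by (simp add: zero_fsum del: fsum_neg)
  also have "\<dots> = \<zeta> R \<cdot> const (rzero C) (Dom C a)" using assms by simp
  finally show ?thesis using assms by (simp add: dsum_zero)
qed

text \<open>The tangent of \<open>scal_\<iota>\<close>, taken at the projections of
  \<open>R \<times> R\<close>. It carries \<open>\<boxdot>\<close> into \<open>T (T R)\<close>,
  where the axioms on the derivatives of \<open>\<kappa>\<close> apply.\<close>

lemma D_scal_\<iota>:
  assumes "a \<in> Arr C" "b \<in> Arr C" "Cod C a = T R" "Cod C b = T R" "Dom C b = Dom C a"
  shows "D (\<kappa> R) \<cdot> Dpair R (T R) a (D \<iota> \<cdot> b) = D \<iota> \<cdot> (a \<boxdot> b)"
proof -
  let ?p = "pr1 C R R" and ?q = "pr2 C R R" and ?z = "Dpair R R a b"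
  have "D (\<kappa> R \<cdot> \<langle>?p, \<iota> \<cdot> ?q\<rangle>) \<cdot> ?z = D (\<iota> \<cdot> (?p \<odot> ?q)) \<cdot> ?z" by (simp add: scal_\<iota> del: D_cmp)
  then show ?thesis using assms by (simp add: D_cpair D_fsum)
qed

text \<open>Axiom (S2) at the unit; this is what fixes the scale of the chosen isomorphism between the
  tangent fiber and \<open>R\<close>.\<close>

lemma lift_\<iota>: "\<Lambda> R \<cdot> \<iota> = D \<iota> \<cdot> \<iota>"
proof -
  let ?R2 = "Prd C R R" and ?one = "const (rone C) R" and ?TR = "T R"
  \<comment> \<open>The vector at zero with coordinate one. Evaluated at \<open>\<iota>\<close> and
    \<open>?y\<close>, the left side of (S2) reduces to the tangent of
    \<open>r \<mapsto> r 1\<close>, the right side to \<open>tlift2\<close> of a zero vector and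
    \<open>\<iota>\<close>.\<close>
  let ?y = "\<iota> \<cdot> ?one"
  let ?r = "pr1 C R R \<cdot> pr1 C ?R2 ?TR" and ?s = "pr2 C R R \<cdot> pr1 C ?R2 ?TR" and ?u = "pr2 C ?R2 ?TR"
  have "Tpart1 C R ?TR (\<kappa> R) \<cdot> \<langle>\<iota>, ?y\<rangle> = D (\<kappa> R) \<cdot> Dpair R ?TR \<iota> (D \<iota> \<cdot> \<zeta> R \<cdot> ?one)"
    by (simp add: Tpart1_cpair)
  also have "\<dots> = D \<iota> \<cdot> (\<iota> \<boxdot> (\<zeta> R \<cdot> ?one))" by (rule D_scal_\<iota>) simp_all
  also have "\<iota> \<boxdot> (\<zeta> R \<cdot> ?one) = D (idt C R \<odot> ?one) \<cdot> \<iota>"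
    by (subst D_fsum) (simp_all del: D_cmp)
  also have "\<dots> = \<iota>" by simp
  finally have l: "Tpart1 C R ?TR (\<kappa> R) \<cdot> \<langle>\<iota>, ?y\<rangle> = D \<iota> \<cdot> \<iota>" .
  have z: "\<kappa> R \<cdot> \<langle>const (rzero C) R, ?y\<rangle> = \<zeta> R \<cdot> const (rzero C) R" by (simp add: scal_zero)
  have k: "\<kappa> R \<cdot> \<langle>idt C R, ?y\<rangle> = \<iota>" by (simp add: scal_\<iota>)
  have "Tpart1 C R ?TR (\<kappa> R) \<cdot> \<langle>\<iota>, ?y\<rangle> =
      (tlift2 C R \<cdot> T2pair C R (\<kappa> R \<cdot> \<langle>?r, ?u\<rangle>) (\<kappa> R \<cdot> \<langle>?s, ?u\<rangle>) \<cdot> (\<langle>\<pi> R, \<eta>\<rangle> \<boxtimes> idt C ?TR)) \<cdot> \<langle>\<iota>, ?y\<rangle>"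
    using Tpart1_scal[of R] by (simp add: Let_def)
  also have "\<dots> = tlift2 C R \<cdot> T2pair C R (\<zeta> R \<cdot> const (rzero C) R) \<iota>"
  proof -
    have l2: "tlift2 C R \<in> Arr C" "Dom C (tlift2 C R) = T2 C R"
      using T2pr_eq[of R] by (simp_all add: tlift2_def reassoc[OF proj_lift])
    show ?thesis using l2 z k by (simp add: T2pair_cmp)
  qed
  also have "\<dots> = \<tau> R \<cdot> ((D (\<zeta> R) \<cdot> \<zeta> R \<cdot> const (rzero C) R) +\<^bsub>?TR\<^esub> (\<Lambda> R \<cdot> \<iota>))"
    by (rule lift2_T2pair) simp_all
  also have "(D (\<zeta> R) \<cdot> \<zeta> R \<cdot> const (rzero C) R) +\<^bsub>?TR\<^esub> (\<Lambda> R \<cdot> \<iota>) = \<Lambda> R \<cdot> \<iota>"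
    by (rule tsum_zero) (simp_all add: reassoc[OF proj_lift])
  also have "\<tau> R \<cdot> \<Lambda> R \<cdot> \<iota> = \<Lambda> R \<cdot> \<iota>" by (simp add: reassoc[OF flip_lift])
  finally show ?thesis using l by simp
qed

lemma D_scal_zero:
  assumes "X \<in> Obj C" "r \<in> Arr C" "b \<in> Arr C" "Cod C r = R" "Cod C b = T (T X)" "Dom C b = Dom C r"
  shows "D (\<kappa> X) \<cdot> Dpair R (T X) (\<zeta> R \<cdot> r) b = \<tau> X \<cdot> \<kappa> (T X) \<cdot> \<langle>r, \<tau> X \<cdot> b\<rangle>"
  using Tpart2_cpair[of R "T X" "\<kappa> X" r b] Tpart2_scal[OF assms(1)] assms by simp

lemma D_proj_\<iota> [simp]:
  assumes "a \<in> Arr C" "Cod C a = T R"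
  shows "D (\<pi> R) \<cdot> D \<iota> \<cdot> a = \<zeta> R \<cdot> const (rzero C) (Dom C a)"
proof -
  have "D (\<pi> R) \<cdot> D \<iota> \<cdot> a = D (\<pi> R \<cdot> \<iota>) \<cdot> a" using assms by (simp del: \<iota>_Arr(4))
  also have "\<dots> = \<zeta> R \<cdot> const (rzero C) (Dom C a)" unfolding \<iota>_Arr(4) using assms by (subst D_const) simp_all
  finally show ?thesis .
qed

text \<open>The composite \<open>?F\<close> is additive because \<open>\<iota>\<close> is, so it can
  be computed on the two parts of \<open>dsum_decomp\<close>. Zero vectors go to zero; on the other
  part \<open>D \<iota> \<cdot> \<iota>\<close> is a vertical lift by \<open>lift_\<iota>\<close>,
  hence fixed by the flip.\<close>

lemma D_eta_flip_\<iota>: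
  assumes a: "a \<in> Arr C" "Cod C a = T R"
  shows "D \<eta> \<cdot> \<tau> R \<cdot> D \<iota> \<cdot> a = \<iota> \<cdot> \<eta> \<cdot> a"
proof -
  let ?F = "\<lambda>x. D \<eta> \<cdot> \<tau> R \<cdot> D \<iota> \<cdot> x" and ?p = "pr1 C R R" and ?q = "pr2 C R R"
  let ?x = "\<zeta> R \<cdot> \<pi> R \<cdot> a" and ?y = "\<iota> \<cdot> \<eta> \<cdot> a"
  have Y [simp]: "Dom C a \<in> Obj C" using a by simp
  \<comment> \<open>Written with the projections, the sum sits inside \<open>D\<close>, where
    \<open>\<iota>_fsum\<close> makes it a fiberwise sum that \<open>flip_D_tsum\<close> can
    split.\<close>
  have "?F (?x \<boxplus> ?y) = D \<eta> \<cdot> \<tau> R \<cdot> D (\<iota> \<cdot> (?p \<oplus> ?q)) \<cdot> Dpair R R ?x ?y"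
    using a by (simp add: D_fsum)
  also have "\<dots> = D \<eta> \<cdot> ((\<tau> R \<cdot> D (\<iota> \<cdot> ?p) \<cdot> Dpair R R ?x ?y) +\<^bsub>T R\<^esub> (\<tau> R \<cdot> D (\<iota> \<cdot> ?q) \<cdot> Dpair R R ?x ?y))"
    using a by (subst \<iota>_fsum) (simp_all add: flip_D_tsum del: D_cmp)
  also have "\<dots> = D \<eta> \<cdot> ((\<tau> R \<cdot> D \<iota> \<cdot> ?x) +\<^bsub>T R\<^esub> (\<tau> R \<cdot> D \<iota> \<cdot> ?y))"
    using a by simp
  also have "\<dots> = ?F ?x +\<^bsub>R\<^esub> ?F ?y" using a by (subst D_tsum) simp_all
  also have "?F ?x = \<zeta> R \<cdot> const (rzero C) (Dom C a)" using a by simp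
  also have "?F ?y = ?y"
  proof -
    have "\<tau> R \<cdot> D \<iota> \<cdot> \<iota> \<cdot> \<eta> \<cdot> a = \<tau> R \<cdot> \<Lambda> R \<cdot> \<iota> \<cdot> \<eta> \<cdot> a"
      using a by (simp add: reassoc[OF lift_\<iota>])
    also have "\<dots> = \<Lambda> R \<cdot> \<iota> \<cdot> \<eta> \<cdot> a" using a by (simp add: reassoc[OF flip_lift])
    also have "\<dots> = D \<iota> \<cdot> \<iota> \<cdot> \<eta> \<cdot> a" using a by (simp add: reassoc[OF lift_\<iota>])
    finally show ?thesis using a by simp
  qed
  also have "(\<zeta> R \<cdot> const (rzero C) (Dom C a)) +\<^bsub>R\<^esub> ?y = ?y" using a by (intro tsum_zero) simp_all
  finally show ?thesis unfolding dsum_decomp[OF a] .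
qed

text \<open>After composing with \<open>\<iota>\<close>, the flip in
  \<open>D_eta_flip_\<iota>\<close> meets the outer flip of (S3) and cancels it; naturality of
  \<open>\<kappa>\<close> at \<open>\<eta>\<close> then moves the scalar \<open>r\<close>
  outside.\<close>

lemma eta_dprod_zero:
  assumes "r \<in> Arr C" "b \<in> Arr C" "Cod C r = R" "Cod C b = T R" "Dom C b = Dom C r"
  shows "\<eta> \<cdot> ((\<zeta> R \<cdot> r) \<boxdot> b) = r \<odot> (\<eta> \<cdot> b)"
proof (rule \<iota>_cancel)
  let ?m = "(\<zeta> R \<cdot> r) \<boxdot> b"
  have "\<iota> \<cdot> \<eta> \<cdot> ?m = D \<eta> \<cdot> \<tau> R \<cdot> D \<iota> \<cdot> ?m" using assms by (simp add: D_eta_flip_\<iota>)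
  also have "\<dots> = D \<eta> \<cdot> \<tau> R \<cdot> D (\<kappa> R) \<cdot> Dpair R (T R) (\<zeta> R \<cdot> r) (D \<iota> \<cdot> b)"
    using assms by (simp add: D_scal_\<iota>)
  also have "\<dots> = D \<eta> \<cdot> \<kappa> (T R) \<cdot> \<langle>r, \<tau> R \<cdot> D \<iota> \<cdot> b\<rangle>" using assms by (simp add: D_scal_zero)
  also have "\<dots> = \<kappa> R \<cdot> \<langle>r, D \<eta> \<cdot> \<tau> R \<cdot> D \<iota> \<cdot> b\<rangle>"
    using scal_nat[of \<eta> r "\<tau> R \<cdot> D \<iota> \<cdot> b"] assms by simp
  also have "\<dots> = \<iota> \<cdot> (r \<odot> (\<eta> \<cdot> b))" using assms by (simp add: D_eta_flip_\<iota> scal_\<iota>)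
  finally show "\<iota> \<cdot> \<eta> \<cdot> ?m = \<iota> \<cdot> (r \<odot> (\<eta> \<cdot> b))" .
qed (use assms in simp_all)

text \<open>With the factors written as \<open>a + 0\<close> and \<open>0 + b\<close>, the
  interchange law yields one product with a zero vector on each side; these become the two terms of
  the product rule.\<close>

lemma eta_dprod:
  assumes "a \<in> Arr C" "b \<in> Arr C" "Cod C a = T R" "Cod C b = T R" "Dom C b = Dom C a"
  shows "\<eta> \<cdot> (a \<boxdot> b) = ((\<eta> \<cdot> a) \<odot> (\<pi> R \<cdot> b)) \<oplus> ((\<pi> R \<cdot> a) \<odot> (\<eta> \<cdot> b))"
proof -
  let ?za = "\<zeta> R \<cdot> \<pi> R \<cdot> a" and ?zb = "\<zeta> R \<cdot> \<pi> R \<cdot> b"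
  have "a +\<^bsub>R\<^esub> ?za = a" "?zb +\<^bsub>R\<^esub> b = b" using assms by (simp_all add: tsum_zero)
  then have "a \<boxdot> b = (a +\<^bsub>R\<^esub> ?za) \<boxdot> (?zb +\<^bsub>R\<^esub> b)" by simp
  also have "\<dots> = (a \<boxdot> ?zb) +\<^bsub>R\<^esub> (?za \<boxdot> b)" using assms by (intro dsum_tsum) simp_all
  also have "a \<boxdot> ?zb = ?zb \<boxdot> a" using assms by (intro dsum_comm) simp_all
  finally have "\<eta> \<cdot> (a \<boxdot> b) = (\<eta> \<cdot> (?zb \<boxdot> a)) \<oplus> (\<eta> \<cdot> (?za \<boxdot> b))"
    using assms fprod_comm[of "\<pi> R \<cdot> b" "\<pi> R \<cdot> a"] by (simp add: eta_tsum)
  then show ?thesis using assms fprod_comm[of "\<pi> R \<cdot> b" "\<eta> \<cdot> a"] by (simp add: eta_dprod_zero)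
qed

section \<open>Second-order tangent vectors of \<open>R\<close>\<close>

lemma fsum_zero_left:
  assumes "a \<in> Arr C" "Cod C a = R" "Dom C a = Y"
  shows "const (rzero C) Y \<oplus> a = a"
proof -
  have [simp]: "Y \<in> Obj C" using assms by auto
  have "const (rzero C) Y \<oplus> a = a \<oplus> const (rzero C) Y" using assms by (intro fsum_comm) simp_all
  then show ?thesis using assms by simp
qed

text \<open>\<open>\<eta> \<cdot> D \<eta>\<close> reads off the mixed second-order coordinate; its
  additivity comes from differentiating that of \<open>\<eta>\<close>.\<close>

lemma eta2_dsum:
  assumes "Z \<in> Arr C" "Cod C Z = T (T (Prd C R R))"
  shows "\<eta> \<cdot> D \<eta> \<cdot> D (D (radd C)) \<cdot> Z =
    (\<eta> \<cdot> D \<eta> \<cdot> D (D (pr1 C R R)) \<cdot> Z) \<oplus> (\<eta> \<cdot> D \<eta> \<cdot> D (D (pr2 C R R)) \<cdot> Z)"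
proof -
  let ?p = "D (pr1 C R R)" and ?q = "D (pr2 C R R)"
  have "D (radd C) = ?p \<boxplus> ?q"
    using Dpair_Dpr[of R R "idt C (T (Prd C R R))"] by (simp add: dsum_def)
  then have "\<eta> \<cdot> D (radd C) = (\<eta> \<cdot> ?p) \<oplus> (\<eta> \<cdot> ?q)" by (simp add: eta_dsum)
  from arg_cong[OF this, of "\<lambda>x. D x \<cdot> Z"] have "D \<eta> \<cdot> D (D (radd C)) \<cdot> Z = (D \<eta> \<cdot> D ?p \<cdot> Z) \<boxplus> (D \<eta> \<cdot> D ?q \<cdot> Z)"
    using assms by (simp add: D_fsum)
  then show ?thesis using assms by (simp add: eta_dsum)
qed

lemma flip_D_zero_cmp [simp]:
  "X \<in> Obj C \<Longrightarrow> h \<in> Arr C \<Longrightarrow> Cod C h = T X \<Longrightarrow> \<tau> X \<cdot> D (\<zeta> X) \<cdot> h = \<zeta> (T X) \<cdot> h"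
  by (simp add: reassoc[OF flip_D_zero])

text \<open>Symmetry of the mixed coordinate. Of the two parts of \<open>a\<close>, the one from
  \<open>\<zeta>\<close> flips to a zero vector, which contributes nothing, and the one from
  \<open>\<iota>\<close> is handled by \<open>D_eta_flip_\<iota>\<close>.\<close>

lemma eta2_flip:
  assumes a: "a \<in> Arr C" "Cod C a = T (T R)"
  shows "\<eta> \<cdot> D \<eta> \<cdot> \<tau> R \<cdot> a = \<eta> \<cdot> D \<eta> \<cdot> a"
proof -
  let ?R2 = "Prd C R R"
  \<comment> \<open>The decomposition \<open>dsum_decomp\<close> of the universal tangent vector, a
    section of \<open>D (radd C)\<close>; its tangent \<open>D d\<close> decomposes elements of
    \<open>T (T R)\<close>.\<close>
  define d where "d = Dpair R R (\<zeta> R \<cdot> \<pi> R) (\<iota> \<cdot> \<eta>)"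
  have d [simp]: "d \<in> Arr C" "Dom C d = T R" "Cod C d = T ?R2" and rd: "D (radd C) \<cdot> d = idt C (T R)"
    and pd: "D (pr1 C R R) \<cdot> d = \<zeta> R \<cdot> \<pi> R" "D (pr2 C R R) \<cdot> d = \<iota> \<cdot> \<eta>"
    using dsum_decomp[of "idt C (T R)"] by (simp_all add: d_def dsum_def)
  have e: "D (D (pr1 C R R)) \<cdot> D d \<cdot> a = D (\<zeta> R) \<cdot> D (\<pi> R) \<cdot> a"
    "D (D (pr2 C R R)) \<cdot> D d \<cdot> a = D \<iota> \<cdot> D \<eta> \<cdot> a"
    using arg_cong[OF pd(1), of "\<lambda>x. D x \<cdot> a"] arg_cong[OF pd(2), of "\<lambda>x. D x \<cdot> a"] a by simp_all
  have "\<tau> R \<cdot> a = \<tau> R \<cdot> D (D (radd C)) \<cdot> D d \<cdot> a"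
    using arg_cong[OF rd, of "\<lambda>x. D x \<cdot> a"] a by simp
  also have "\<dots> = D (D (radd C)) \<cdot> \<tau> ?R2 \<cdot> D d \<cdot> a"
    using flip_nat_cmp[of "radd C" "D d \<cdot> a"] a by simp
  finally have "\<eta> \<cdot> D \<eta> \<cdot> \<tau> R \<cdot> a =
      (\<eta> \<cdot> D \<eta> \<cdot> D (D (pr1 C R R)) \<cdot> \<tau> ?R2 \<cdot> D d \<cdot> a) \<oplus> (\<eta> \<cdot> D \<eta> \<cdot> D (D (pr2 C R R)) \<cdot> \<tau> ?R2 \<cdot> D d \<cdot> a)"
    using a by (simp add: eta2_dsum)
  also have "D (D (pr1 C R R)) \<cdot> \<tau> ?R2 \<cdot> D d \<cdot> a = \<zeta> (T R) \<cdot> D (\<pi> R) \<cdot> a"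
    using flip_nat_cmp[of "pr1 C R R" "D d \<cdot> a"] a e by simp
  also have "D (D (pr2 C R R)) \<cdot> \<tau> ?R2 \<cdot> D d \<cdot> a = \<tau> R \<cdot> D \<iota> \<cdot> D \<eta> \<cdot> a"
    using flip_nat_cmp[of "pr2 C R R" "D d \<cdot> a"] a e by simp
  finally show ?thesis using a by (simp add: D_eta_flip_\<iota> fsum_zero_left)
qed

text \<open>The lift puts the first-order coordinate into the mixed second-order slot: for vectors
  from \<open>\<iota>\<close> this is \<open>lift_\<iota>\<close>, while zero vectors lift to
  zero.\<close>

lemma eta2_lift:
  assumes a: "a \<in> Arr C" "Cod C a = T R"
  shows "\<eta> \<cdot> D \<eta> \<cdot> \<Lambda> R \<cdot> a = \<eta> \<cdot> a"
proof -
  let ?R2 = "Prd C R R" and ?z = "Dpair R R (\<zeta> R \<cdot> \<pi> R \<cdot> a) (\<iota> \<cdot> \<eta> \<cdot> a)"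
  have "\<Lambda> R \<cdot> a = \<Lambda> R \<cdot> D (radd C) \<cdot> ?z" using dsum_decomp[OF a] by (simp add: dsum_def)
  also have "\<dots> = D (D (radd C)) \<cdot> \<Lambda> ?R2 \<cdot> ?z"
    using lift_nat_cmp[of "radd C" ?z] a by simp
  finally have "\<eta> \<cdot> D \<eta> \<cdot> \<Lambda> R \<cdot> a =
      (\<eta> \<cdot> D \<eta> \<cdot> D (D (pr1 C R R)) \<cdot> \<Lambda> ?R2 \<cdot> ?z) \<oplus> (\<eta> \<cdot> D \<eta> \<cdot> D (D (pr2 C R R)) \<cdot> \<Lambda> ?R2 \<cdot> ?z)"
    using a by (simp add: eta2_dsum)
  also have "D (D (pr1 C R R)) \<cdot> \<Lambda> ?R2 \<cdot> ?z = \<zeta> (T R) \<cdot> \<zeta> R \<cdot> \<pi> R \<cdot> a"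
    using lift_nat_cmp[of "pr1 C R R" ?z] a by (simp add: reassoc[OF lift_zero])
  also have "D (D (pr2 C R R)) \<cdot> \<Lambda> ?R2 \<cdot> ?z = D \<iota> \<cdot> \<iota> \<cdot> \<eta> \<cdot> a"
    using lift_nat_cmp[of "pr2 C R R" ?z] a by (simp add: reassoc[OF lift_\<iota>])
  finally show ?thesis using a by (simp add: fsum_zero_left)
qed

section \<open>The action of vector fields on functions\<close>

lemma vf_act_fsum:
  assumes "v \<in> vector_fields C X" "f \<in> Hom C X R" "g \<in> Hom C X R"
  shows "vf_act C v (f \<oplus> g) = vf_act C v f \<oplus> vf_act C v g"
  using assms vector_field[OF assms(1)] by (simp add: Hom_def vf_act_def D_fsum eta_dsum)

text \<open>As \<open>v\<close> is a section, \<open>D f \<cdot> v\<close> has base point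
  \<open>f\<close>, so the base points occurring in \<open>eta_dprod\<close> are the
  undifferentiated factors.\<close>

lemma vf_act_fprod:
  assumes "v \<in> vector_fields C X" "f \<in> Hom C X R" "g \<in> Hom C X R"
  shows "vf_act C v (f \<odot> g) = (vf_act C v f \<odot> g) \<oplus> (f \<odot> vf_act C v g)"
  using assms vector_field[OF assms(1)] by (simp add: Hom_def vf_act_def D_fsum eta_dprod)

lemma vf_act_tsum:
  assumes "v \<in> vector_fields C X" "w \<in> vector_fields C X" "f \<in> Hom C X R"
  shows "vf_act C (v +\<^bsub>X\<^esub> w) f = vf_act C v f \<oplus> vf_act C w f"
proof -
  have [simp]: "f \<in> Arr C" "Dom C f = X" "Cod C f = R" using assms(3) by (auto simp: Hom_def)
  show ?thesis
    using vector_field[OF assms(1)] vector_field[OF assms(2)] by (simp add: vf_act_def D_tsum eta_tsum)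
qed

lemma vf_act_bracket:
  assumes v: "v \<in> vector_fields C X" and w: "w \<in> vector_fields C X" and f: "f \<in> Hom C X R"
  shows "vf_act C (vf_bracket C X v w) f = fn_minus C (vf_act C v (vf_act C w f)) (vf_act C w (vf_act C v f))"
proof -
  define u where "u = vf_bracket C X v w"
  define \<delta> where "\<delta> = vf_delta C X v w"
  note X [simp] = vector_field_Obj[OF v]
  note u = vf_bracket[OF v w, folded u_def \<delta>_def]
  note [simp] = vector_field[OF v] vector_field[OF w] vector_field[OF u(1)]
    vf_delta(1-4)[OF v w, folded \<delta>_def]
  have [simp]: "f \<in> Arr C" "Dom C f = X" "Cod C f = R" using f by (auto simp: Hom_def)
  \<comment> \<open>The second derivative of \<open>f\<close>. The two iterated actions are its
    values at \<open>D w \<cdot> v\<close> and \<open>D v \<cdot> w\<close>, and the bracket is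
    computed from its value at \<open>\<delta>\<close>.\<close>
  let ?E = "\<lambda>x. \<eta> \<cdot> D \<eta> \<cdot> D (D f) \<cdot> x"
  have E_tsum: "?E (a +\<^bsub>T X\<^esub> b) = ?E a \<oplus> ?E b"
    if "a \<in> Arr C" "b \<in> Arr C" "Cod C a = T (T X)" "Cod C b = T (T X)" "Dom C b = Dom C a"
      "\<pi> (T X) \<cdot> a = \<pi> (T X) \<cdot> b" for a b
    using that by (simp add: D_tsum eta_tsum)
  have E_flip: "?E (\<tau> X \<cdot> a) = ?E a" if "a \<in> Arr C" "Cod C a = T (T X)" for a
    using that flip_nat_cmp[of f a] by (simp add: eta2_flip)
  \<comment> \<open>Naturality of zero moves \<open>D (\<zeta> X)\<close> past \<open>f\<close> to
    \<open>D (\<zeta> R)\<close>, and \<open>\<eta>\<close> vanishes on zero vectors of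
    \<open>R\<close>.\<close>
  have E_zero: "?E (D (\<zeta> X) \<cdot> w) = const (rzero C) X"
  proof -
    have "D (D f) \<cdot> D (\<zeta> X) = D (\<zeta> R) \<cdot> D f" using D_cmp[of "\<zeta> X" "D f"] by simp
    from reassoc[OF this, of w] show ?thesis by simp
  qed
  have lift_w: "\<pi> (T X) \<cdot> \<Lambda> X \<cdot> u = \<zeta> X" by (simp add: reassoc[OF proj_lift])
  \<comment> \<open>The lift turns the first-order action of \<open>u\<close> into a second
    derivative, which is then comparable with \<open>?E \<delta>\<close>.\<close>
  have "vf_act C u f = \<eta> \<cdot> D \<eta> \<cdot> \<Lambda> R \<cdot> D f \<cdot> u" by (simp add: vf_act_def eta2_lift)
  also have "\<dots> = ?E (\<Lambda> X \<cdot> u)" using lift_nat_cmp[of f u] by simp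
  also have "\<dots> = ?E (D (\<zeta> X) \<cdot> w) \<oplus> ?E (\<Lambda> X \<cdot> u)" unfolding E_zero by (simp add: fsum_zero_left)
  also have "\<dots> = ?E (\<tau> X \<cdot> \<delta>)" unfolding u(2) by (subst E_tsum) (simp_all add: lift_w)
  also have "\<dots> = ?E \<delta>" by (simp add: E_flip)
  finally have uf: "vf_act C u f = ?E \<delta>" .
  have vwf: "vf_act C v (vf_act C w f) = ?E (D w \<cdot> v)" "vf_act C w (vf_act C v f) = ?E (D v \<cdot> w)"
    by (simp_all add: vf_act_def)
  have Dv: "D (\<pi> X) \<cdot> D v = idt C (T X)" by (simp flip: D_cmp)
  have "?E (D w \<cdot> v) = ?E \<delta> \<oplus> ?E (\<tau> X \<cdot> D v \<cdot> w)"
    unfolding vf_delta(5)[OF v w, folded \<delta>_def, symmetric]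
    by (rule E_tsum) (simp_all add: reassoc[OF Dv])
  also have "?E (\<tau> X \<cdot> D v \<cdot> w) = ?E (D v \<cdot> w)" by (rule E_flip) simp_all
  finally have sum: "?E (D w \<cdot> v) = ?E \<delta> \<oplus> ?E (D v \<cdot> w)" .
  have "?E \<delta> \<oplus> ?E (D v \<cdot> w) \<oplus> (rneg C \<cdot> ?E (D v \<cdot> w)) = ?E \<delta>"
    by (subst fsum_assoc) simp_all
  then show ?thesis unfolding u_def[symmetric] uf vwf fn_minus_def sum by simp
qed

end

theorem proposition5p3:
  fixes C :: "('o, 'm, 'x) scalar_tangent_category_scheme"
  assumes "scalar_tangent_category C"
    and "X \<in> Obj C"
    and "v \<in> vector_fields C X" and "w \<in> vector_fields C X"
    and "f \<in> Hom C X (rng C)" and "g \<in> Hom C X (rng C)"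
  shows "vf_act C v (fn_add C f g) = fn_add C (vf_act C v f) (vf_act C v g) \<and>
    vf_act C (vf_add C X v w) f = fn_add C (vf_act C v f) (vf_act C w f) \<and>
    vf_act C (vf_bracket C X v w) f =
      fn_minus C (vf_act C v (vf_act C w f)) (vf_act C w (vf_act C v f)) \<and>
    vf_act C v (fn_mult C f g) =
      fn_add C (fn_mult C (vf_act C v f) g) (fn_mult C f (vf_act C v g))"
proof -
  interpret scalar_tangent_category C by fact
  show ?thesis
    using assms(3-6) vf_act_fsum vf_act_tsum vf_act_bracket vf_act_fprod by blast
qed

end
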